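(* Let $\mathcal C_\varphi=\mathcal C_1\cup\dots\cup\mathcal C_r$ be a quasi fiber-type curve with data $F_i=\prod_jF_{i,j}^{m_{i,j}}$, $H_i$, $m_i$, let $p$ be a prime and $\Bbbk=\mathbb Z/p$, and assume $m_i=0\in\Bbbk$ for all $i=1,\dots,r$. Let $\omega=\sum_{i,j}m_{i,j}\alpha_i\sigma_{i,j}\in\mathcal R_{\varphi,\Bbbk}$ be a $1$-cochain associated with $\mathcal C_\varphi$ ($\alpha_i\in\Bbbk$). Write $W$ for the weak combinatorial type of $\mathcal C_\varphi$ and $h^1=\dim_\Bbbk H^1$. Then: (1) If $\sum_i\alpha_i=0\in\Bbbk$, then $\omega\in\mathcal R_{r-2}(W,\Bbbk)$, that is, $h^1(A^*_{W,\Bbbk},\cdot\wedge\omega)\ge r-2$. (2) If $\mathcal C_\varphi$ has index $k$ with $k=0\in\Bbbk$, then $\mathcal R_{\varphi,\Bbbk}\subset\mathcal R_{r-1}(W,\Bbbk)$, that is, $h^1(A^*_{W,\Bbbk},\cdot\wedge\omega)\ge r-1$.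
   Context: Quasi fiber-type curve. A reduced curve $\mathcal C\subset\mathbb P^2_{\mathbb C}$ with a decomposition $\mathcal C=\mathcal C_1\cup\dots\cup\mathcal C_r$ into subcurves without common components, $\mathcal C_i=\{F_i=0\}$, $F_i=\prod_jF_{i,j}^{m_{i,j}}$ with $F_{i,j}$ irreducible homogeneous and pairwise non-proportional, $m_{i,j}>0$, together with integers $m_i\ge0$ and homogeneous polynomials $H_i$ ($m_i=0$ if and only if $H_i$ is constant) such that the polynomials $G_i=F_iH_i^{m_i}$ all have the same degree $d$ and $G_1,\dots,G_r$ are distinct members of one pencil of degree $d$ curves (aligned in the projective space of degree $d$ curves) whose generic member is irreducible. The decomposition arises from a surjection of $\mathbb P^2\setminus\mathcal C$, induced by the pencil, onto a hyperbolic orbifold over $\mathbb P^1$ in which the point of $G_i$ is removed if $m_i=0$ and has orbifold order $m_i$ if $m_i>0$ (points of other multiple members of the pencil may also be orbifold points); hyperbolic means negative orbifold Euler characteristic $2-\sum(1-1/m)$, with $1/0:=0$. Standing assumption: for each $i$, the gcd over $j$ of the $m_{i,j}$ is $1$. The curve has index $k\ge1$ if the pencil also contains a member of the form $G^k$ different from the $G_i$, and $k\mid m_i$ for all $i$. $\varphi$ denotes the collection of data, and $\mathcal C_\varphi$ the curve with this decomposition. Weak combinatorial type. Let $\mathcal D$ be a reduced plane curve with irreducible components $\mathcal D_1,\dots,\mathcal D_s$ of degrees $d_a$, $S=\mathrm{Sing}(\mathcal D)$. For $P\in S$, $\Delta_P$ is the set of irreducible local branches at $P$, $\phi_P:\Delta_P\to\{1,\dots,s\}$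 sends a branch to the index of its component, and $\mu_P(\delta,\delta')$ is the local intersection number of branches of different components. $W=(\{1,\dots,s\},S,\{\Delta_P,\phi_P,\mu_P\})$. Graded algebra $A^*_{W,\Bbbk}$. $A^0=\Bbbk$; $A^1=\bigoplus_a\Bbbk\sigma_a$; $A^2=A^{2,0}\oplus A^{2,\infty}$; $A^i=0$ for $i\ge3$. $A^{2,\infty}$ is the $\Bbbk$-vector space on symbols $\bar\psi^a_\infty$ modulo the span of those with $p\nmid d_a$; $A^{2,0}=\bigoplus_{P\in S}(A_P\wedge A_P)/I_P$, where $A_P$ has basis $\{\psi_P^\delta\}_{\delta\in\Delta_P}$ and $I_P$ is spanned by all $\psi_P^{\delta_1}\wedge\psi_P^{\delta_2}+\psi_P^{\delta_2}\wedge\psi_P^{\delta_3}+\psi_P^{\delta_3}\wedge\psi_P^{\delta_1}$ together with, if $\#\phi_P(\Delta_P)=1$, all $\psi_P^{\delta_1}\wedge\psi_P^{\delta_2}$. The product is bilinear and alternating on $A^1$, with, for $a\ne b$, $$\sigma_a\wedge\sigma_b=\sum_{P\in S}\ \sum_{\phi_P(\delta_1)=a,\ \phi_P(\delta_2)=b}\mu_P(\delta_1,\delta_2)\psi_P^{\delta_1}\wedge\psi_P^{\delta_2}+d_b\bar\psi^a_\infty-d_a\bar\psi^b_\infty.$$ For $\omega\in A^1$, $(A^*_{W,\Bbbk},\cdot\wedge\omega)$ is the complex $A^0\to A^1\to A^2$ given by multiplication by $\omega$, and $\mathcal R_n(W,\Bbbk)=\{\omega\in A^1_{W,\Bbbk}\mid\dim_\Bbbk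 H^1(A^*_{W,\Bbbk},\cdot\wedge\omega)\ge n\}$. For $\mathcal C_\varphi$ the irreducible components are $\mathcal C_{i,j}=\{F_{i,j}=0\}$, with generators $\sigma_{i,j}$ of $A^1$. An element $\sum_{i,j}m_{i,j}\alpha_{i,j}\sigma_{i,j}$ is associated with $\mathcal C_\varphi$ if $\alpha_{i,j}=\alpha_i$ is independent of $j$ for each $i$; $\mathcal R_{\varphi,\Bbbk}\subset A^1_{W,\Bbbk}$ is the set of all such elements. *)

theory Defs
  imports
    Complex_Main
    "HOL-Library.Function_Algebras"
    "HOL-Computational_Algebra.Computational_Algebra"
    "Berlekamp_Zassenhaus.Finite_Field"
begin

section \<open>Quotients of vector spaces\<close>

definition basis_modulo ::
  "('k::field \<Rightarrow> 'v::ab_group_add \<Rightarrow> 'v) \<Rightarrow> 'v set \<Rightarrow> 'v set \<Rightarrow> 'v set \<Rightarrow> bool" where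
  "basis_modulo scale B U V \<longleftrightarrow> B \<subseteq> U \<and>
     (\<forall>S c. finite S \<longrightarrow> S \<subseteq> B \<longrightarrow> (\<Sum>b\<in>S. scale (c b) b) \<in> V \<longrightarrow> (\<forall>b\<in>S. c b = 0)) \<and>
     U \<subseteq> module.span scale (B \<union> V)"

text \<open>The dimension of \<open>U / V\<close> for subspaces \<open>V \<subseteq> U\<close>, with the convention of
  \<^const>\<open>vector_space.dim\<close> that infinite dimensions are reported as \<open>0\<close>.\<close>

definition quotient_dim ::
  "('k::field \<Rightarrow> 'v::ab_group_add \<Rightarrow> 'v) \<Rightarrow> 'v set \<Rightarrow> 'v set \<Rightarrow> nat" where
  "quotient_dim scale U V = card (SOME B. basis_modulo scale B U V)"

definition fun_scale :: "'k::field \<Rightarrow> ('a \<Rightarrow> 'k) \<Rightarrow> 'a \<Rightarrow> 'k" where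
  "fun_scale c f = (\<lambda>x. c * f x)"

interpretation fun_vs: vector_space "fun_scale :: 'k::field \<Rightarrow> ('a \<Rightarrow> 'k) \<Rightarrow> 'a \<Rightarrow> 'k"
  by unfold_locales (auto simp: fun_scale_def algebra_simps)

definition basis_vec :: "'a \<Rightarrow> 'a \<Rightarrow> 'k::field" where
  "basis_vec x = (\<lambda>y. if y = x then 1 else 0)"


section \<open>Ternary forms and the projective plane\<close>

text \<open>\<open>coeff (coeff (coeff F i) j) k\<close> is the coefficient of \<open>x\<^sup>i y\<^sup>j z\<^sup>k\<close>.\<close>

type_synonym tripoly = "complex poly poly poly"

definition tri_const :: "complex \<Rightarrow> tripoly" where
  "tri_const c = [:[:[:c:]:]:]"

text \<open>Substitution of \<open>(x, y, z)\<close> from a ring \<open>'r\<close> which is a complex algebra via \<open>h\<close>.\<close>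

fun tri_eval :: "(complex \<Rightarrow> 'r::comm_ring_1) \<Rightarrow> 'r \<times> 'r \<times> 'r \<Rightarrow> tripoly \<Rightarrow> 'r" where
  "tri_eval h (x, y, z) F =
     poly (map_poly (\<lambda>q. poly (map_poly (\<lambda>r. poly (map_poly h r) z) q) y) F) x"

definition homogeneous :: "nat \<Rightarrow> tripoly \<Rightarrow> bool" where
  "homogeneous d F \<longleftrightarrow>
     (\<forall>i j k. Polynomial.coeff (Polynomial.coeff (Polynomial.coeff F i) j) k \<noteq> 0 \<longrightarrow> i + j + k = d)"

definition form_degree :: "tripoly \<Rightarrow> nat" where
  "form_degree F = (THE d. homogeneous d F)"

definition proportional :: "tripoly \<Rightarrow> tripoly \<Rightarrow> bool" where
  "proportional F G \<longleftrightarrow> (\<exists>c. c \<noteq> 0 \<and> F = tri_const c * G)"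

text \<open>Points of the projective line and plane, by their representative whose first nonzero
  coordinate is \<open>1\<close>.\<close>

type_synonym pt1 = "complex \<times> complex"
type_synonym pt2 = "complex \<times> complex \<times> complex"

definition P1 :: "pt1 set" where
  "P1 = {(s, t). s = 1 \<or> (s = 0 \<and> t = 1)}"

definition P2 :: "pt2 set" where
  "P2 = {(x, y, z). x = 1 \<or> (x = 0 \<and> y = 1) \<or> (x = 0 \<and> y = 0 \<and> z = 1)}"

definition vanishes_at :: "tripoly \<Rightarrow> pt2 \<Rightarrow> bool" where
  "vanishes_at F P \<longleftrightarrow> tri_eval (\<lambda>c. c) P F = 0"


section \<open>Local branches of plane curves\<close>

text \<open>\<open>complex fps fps\<close> is the completed local ring \<open>\<complex>[[X, Y]]\<close> of the plane at a point,
  \<open>X\<close> being the inner and \<open>Y\<close> the outer variable.\<close>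

type_synonym local_ring = "complex fps fps"

definition loc_const :: "complex \<Rightarrow> local_ring" where
  "loc_const c = fps_const (fps_const c)"

definition loc_X :: local_ring where "loc_X = fps_const fps_X"
definition loc_Y :: local_ring where "loc_Y = fps_X"

text \<open>The affine chart in which the first nonzero coordinate of \<open>P\<close> is \<open>1\<close>, centred at \<open>P\<close>.\<close>

fun chart :: "pt2 \<Rightarrow> local_ring \<times> local_ring \<times> local_ring" where
  "chart (x, y, z) =
     (if x \<noteq> 0 then (1, loc_const y + loc_X, loc_const z + loc_Y)
      else if y \<noteq> 0 then (loc_X, 1, loc_const z + loc_Y)
      else (loc_X, loc_Y, 1))"

definition local_eq :: "pt2 \<Rightarrow> tripoly \<Rightarrow> local_ring" where
  "local_eq P F = tri_eval loc_const (chart P) F"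

text \<open>An irreducible branch of the germ \<open>f = 0\<close> is an irreducible factor of \<open>f\<close> up to
  associates, encoded as the principal ideal generated by that factor.\<close>

definition germ_branches :: "local_ring \<Rightarrow> local_ring set set" where
  "germ_branches f = {{g. h dvd g} | h. Factorial_Ring.irreducible h \<and> h dvd f}"

definition loc_scale :: "complex \<Rightarrow> local_ring \<Rightarrow> local_ring" where
  "loc_scale c f = loc_const c * f"

interpretation loc_vs: vector_space loc_scale
  by unfold_locales
    (auto simp: loc_scale_def loc_const_def algebra_simps simp flip: fps_const_add fps_const_mult)

text \<open>For branches \<open>\<delta> = (f)\<close> and \<open>\<delta>' = (g)\<close> this is the dimension of
  \<open>\<complex>[[X, Y]] / (f, g)\<close>.\<close>

definition intersection_number :: "local_ring set \<Rightarrow> local_ring set \<Rightarrow> nat" where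
  "intersection_number \<delta> \<delta>' = quotient_dim loc_scale UNIV {u + v | u v. u \<in> \<delta> \<and> v \<in> \<delta>'}"


section \<open>Weak combinatorial types\<close>

text \<open>Components are indexed by \<open>'s\<close>; the degrees \<open>d\<^sub>a\<close>, which enter the algebra below, are
  recorded as well.\<close>

record ('s, 'pt, 'b) wct =
  comps :: "'s set"
  cdeg :: "'s \<Rightarrow> nat"
  sing :: "'pt set"
  branches :: "'pt \<Rightarrow> 'b set"
  comp_of :: "'pt \<Rightarrow> 'b \<Rightarrow> 's"
  mult :: "'pt \<Rightarrow> 'b \<Rightarrow> 'b \<Rightarrow> nat"

definition singular_points :: "tripoly \<Rightarrow> pt2 set" where
  "singular_points f = {P \<in> P2. vanishes_at f P \<and> vanishes_at (pderiv f) P \<and>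
     vanishes_at (map_poly pderiv f) P \<and> vanishes_at (map_poly (map_poly pderiv) f) P}"

text \<open>The weak combinatorial type of the reduced curve with irreducible components
  \<open>F a = 0\<close>, \<open>a \<in> I\<close>.\<close>

definition curve_wct :: "'s set \<Rightarrow> ('s \<Rightarrow> tripoly) \<Rightarrow> ('s, pt2, local_ring set) wct" where
  "curve_wct I F = \<lparr>
     comps = I,
     cdeg = (\<lambda>a. form_degree (F a)),
     sing = singular_points (\<Prod>a\<in>I. F a),
     branches = (\<lambda>P. germ_branches (local_eq P (\<Prod>a\<in>I. F a))),
     comp_of = (\<lambda>P \<delta>. THE a. a \<in> I \<and> local_eq P (F a) \<in> \<delta>),
     mult = (\<lambda>P. intersection_number) \<rparr>"


section \<open>The algebra of a weak combinatorial type and its resonance sets\<close>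

definition A1 :: "('s, 'pt, 'b) wct \<Rightarrow> ('s \<Rightarrow> 'k::field) set" where
  "A1 W = {\<omega>. \<forall>a. a \<notin> comps W \<longrightarrow> \<omega> a = 0}"

text \<open>The degree two part is the space spanned by the basis vectors of the generators belonging to
  \<open>W\<close>, modulo the span of \<open>A2_relations\<close>. The generator \<open>Psi P \<delta> \<delta>'\<close> stands for
  \<open>\<psi>\<^sub>P\<^sup>\<delta> \<and> \<psi>\<^sub>P\<^sup>\<delta>'\<close>, so that the relations include those defining the exterior square.\<close>

datatype ('s, 'pt, 'b) A2_gen = Psi 'pt 'b 'b | Psi_inf 's

definition A2_relations :: "('s, 'pt, 'b) wct \<Rightarrow> (('s, 'pt, 'b) A2_gen \<Rightarrow> 'k::field) set" where
  "A2_relations W =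
     {basis_vec (Psi P \<delta> \<delta>) | P \<delta>. P \<in> sing W \<and> \<delta> \<in> branches W P} \<union>
     {basis_vec (Psi P \<delta> \<delta>') + basis_vec (Psi P \<delta>' \<delta>) | P \<delta> \<delta>'.
        P \<in> sing W \<and> \<delta> \<in> branches W P \<and> \<delta>' \<in> branches W P} \<union>
     {basis_vec (Psi P \<delta>1 \<delta>2) + basis_vec (Psi P \<delta>2 \<delta>3) + basis_vec (Psi P \<delta>3 \<delta>1) | P \<delta>1 \<delta>2 \<delta>3.
        P \<in> sing W \<and> \<delta>1 \<in> branches W P \<and> \<delta>2 \<in> branches W P \<and> \<delta>3 \<in> branches W P} \<union>
     {basis_vec (Psi P \<delta>1 \<delta>2) | P \<delta>1 \<delta>2.
        P \<in> sing W \<and> card (comp_of W P ` branches W P) = 1 \<and>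
        \<delta>1 \<in> branches W P \<and> \<delta>2 \<in> branches W P} \<union>
     {basis_vec (Psi_inf a) | a. a \<in> comps W \<and> \<not> CHAR('k) dvd cdeg W a}"

definition sigma_wedge :: "('s, 'pt, 'b) wct \<Rightarrow> 's \<Rightarrow> 's \<Rightarrow> ('s, 'pt, 'b) A2_gen \<Rightarrow> 'k::field" where
  "sigma_wedge W a b =
     (\<Sum>P\<in>sing W. \<Sum>\<delta>1 | \<delta>1 \<in> branches W P \<and> comp_of W P \<delta>1 = a.
        \<Sum>\<delta>2 | \<delta>2 \<in> branches W P \<and> comp_of W P \<delta>2 = b.
          fun_scale (of_nat (mult W P \<delta>1 \<delta>2)) (basis_vec (Psi P \<delta>1 \<delta>2)))
     + fun_scale (of_nat (cdeg W b)) (basis_vec (Psi_inf a))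
     - fun_scale (of_nat (cdeg W a)) (basis_vec (Psi_inf b))"

text \<open>A representative of the product in degree two; the diagonal terms are omitted because the
  product is alternating.\<close>

definition wedge ::
  "('s, 'pt, 'b) wct \<Rightarrow> ('s \<Rightarrow> 'k::field) \<Rightarrow> ('s \<Rightarrow> 'k) \<Rightarrow> ('s, 'pt, 'b) A2_gen \<Rightarrow> 'k" where
  "wedge W \<eta> \<omega> = (\<Sum>a\<in>comps W. \<Sum>b\<in>comps W - {a}. fun_scale (\<eta> a * \<omega> b) (sigma_wedge W a b))"

definition h1 :: "('s, 'pt, 'b) wct \<Rightarrow> ('s \<Rightarrow> 'k::field) \<Rightarrow> nat" where
  "h1 W \<omega> = quotient_dim fun_scale
     {\<eta> \<in> A1 W. wedge W \<eta> \<omega> \<in> fun_vs.span (A2_relations W)}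
     (range (\<lambda>c. fun_scale c \<omega>))"

definition resonance :: "nat \<Rightarrow> ('s, 'pt, 'b) wct \<Rightarrow> ('s \<Rightarrow> 'k::field) set" where
  "resonance n W = {\<omega> \<in> A1 W. h1 W \<omega> \<ge> n}"


section \<open>Quasi fiber-type curves\<close>

text \<open>With indices \<open>i < nparts\<close> and \<open>j < ncomps i\<close>: \<open>qF i j\<close> is the irreducible form \<open>F\<^sub>i\<^sub>j\<close> with
  multiplicity \<open>qmult i j\<close>, \<open>qorder i\<close> is \<open>m\<^sub>i\<close>, and \<open>qH i\<close> is \<open>H\<^sub>i\<close>. The pencil of degree \<open>pdeg\<close>
  is spanned by \<open>penA\<close> and \<open>penB\<close>, and \<open>qpt i\<close> is the point of the projective line
  corresponding to \<open>G\<^sub>i\<close>. The orbifold structure is \<open>orb\<close>, with value \<open>0\<close> at removed points and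
  \<open>1\<close> at ordinary points.\<close>

record quasi_fiber_data =
  nparts :: nat
  ncomps :: "nat \<Rightarrow> nat"
  qF :: "nat \<Rightarrow> nat \<Rightarrow> tripoly"
  qmult :: "nat \<Rightarrow> nat \<Rightarrow> nat"
  qorder :: "nat \<Rightarrow> nat"
  qH :: "nat \<Rightarrow> tripoly"
  pdeg :: nat
  penA :: tripoly
  penB :: tripoly
  qpt :: "nat \<Rightarrow> pt1"
  orb :: "pt1 \<Rightarrow> nat"

definition comp_index :: "quasi_fiber_data \<Rightarrow> (nat \<times> nat) set" where
  "comp_index \<phi> = {(i, j). i < nparts \<phi> \<and> j < ncomps \<phi> i}"

definition curve_points :: "quasi_fiber_data \<Rightarrow> pt2 set" where
  "curve_points \<phi> = {P \<in> P2. \<exists>(i, j) \<in> comp_index \<phi>. vanishes_at (qF \<phi> i j) P}"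

definition Fpart :: "quasi_fiber_data \<Rightarrow> nat \<Rightarrow> tripoly" where
  "Fpart \<phi> i = (\<Prod>j<ncomps \<phi> i. qF \<phi> i j ^ qmult \<phi> i j)"

definition Gpart :: "quasi_fiber_data \<Rightarrow> nat \<Rightarrow> tripoly" where
  "Gpart \<phi> i = Fpart \<phi> i * qH \<phi> i ^ qorder \<phi> i"

definition member :: "quasi_fiber_data \<Rightarrow> pt1 \<Rightarrow> tripoly" where
  "member \<phi> \<rho> = tri_const (fst \<rho>) * penA \<phi> + tri_const (snd \<rho>) * penB \<phi>"

text \<open>The rational map to the projective line sends \<open>P\<close> to the member through \<open>P\<close>.\<close>

definition pencil_map :: "quasi_fiber_data \<Rightarrow> pt2 \<Rightarrow> pt1" where
  "pencil_map \<phi> P = (THE \<rho>. \<rho> \<in> P1 \<and> vanishes_at (member \<phi> \<rho>) P)"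

definition decomposed_curve :: "quasi_fiber_data \<Rightarrow> bool" where
  "decomposed_curve \<phi> \<longleftrightarrow>
     nparts \<phi> \<ge> 1 \<and> (\<forall>i<nparts \<phi>. ncomps \<phi> i \<ge> 1) \<and>
     (\<forall>(i, j) \<in> comp_index \<phi>. Factorial_Ring.irreducible (qF \<phi> i j) \<and>
        (\<exists>e. homogeneous e (qF \<phi> i j)) \<and> qmult \<phi> i j > 0) \<and>
     (\<forall>(i, j) \<in> comp_index \<phi>. \<forall>(i', j') \<in> comp_index \<phi>.
        (i, j) \<noteq> (i', j') \<longrightarrow> \<not> proportional (qF \<phi> i j) (qF \<phi> i' j')) \<and>
     (\<forall>i<nparts \<phi>. Gcd (qmult \<phi> i ` {..<ncomps \<phi> i}) = 1)"

definition irreducible_pencil :: "quasi_fiber_data \<Rightarrow> bool" where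
  "irreducible_pencil \<phi> \<longleftrightarrow>
     homogeneous (pdeg \<phi>) (penA \<phi>) \<and> homogeneous (pdeg \<phi>) (penB \<phi>) \<and>
     (\<forall>s t. tri_const s * penA \<phi> + tri_const t * penB \<phi> = 0 \<longrightarrow> s = 0 \<and> t = 0) \<and>
     finite {\<rho> \<in> P1. \<not> Factorial_Ring.irreducible (member \<phi> \<rho>)}"

definition parts_in_pencil :: "quasi_fiber_data \<Rightarrow> bool" where
  "parts_in_pencil \<phi> \<longleftrightarrow>
     (\<forall>i<nparts \<phi>. qH \<phi> i \<noteq> 0 \<and> (\<exists>e. homogeneous e (qH \<phi> i)) \<and>
        (qorder \<phi> i = 0 \<longleftrightarrow> (\<exists>c. qH \<phi> i = tri_const c)) \<and>
        homogeneous (pdeg \<phi>) (Gpart \<phi> i) \<and>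
        qpt \<phi> i \<in> P1 \<and> proportional (Gpart \<phi> i) (member \<phi> (qpt \<phi> i))) \<and>
     inj_on (qpt \<phi>) {..<nparts \<phi>}"

text \<open>Away from the \<open>G\<^sub>i\<close>, a point of the projective line has positive order \<open>e\<close>, and its member is
  an \<open>e\<close>-th power (the scalar is absorbed by \<open>K\<close>). In the Euler characteristic a removed point
  contributes \<open>1 - 1 / 0 = 1\<close>.\<close>

definition hyperbolic_orbifold_map :: "quasi_fiber_data \<Rightarrow> bool" where
  "hyperbolic_orbifold_map \<phi> \<longleftrightarrow>
     (\<forall>i<nparts \<phi>. orb \<phi> (qpt \<phi> i) = qorder \<phi> i) \<and>
     (\<forall>\<rho> \<in> P1 - qpt \<phi> ` {..<nparts \<phi>}. orb \<phi> \<rho> \<ge> 1 \<and> (\<exists>K. member \<phi> \<rho> = K ^ orb \<phi> \<rho>)) \<and>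
     finite {\<rho> \<in> P1. orb \<phi> \<rho> \<noteq> 1} \<and>
     2 - (\<Sum>\<rho> | \<rho> \<in> P1 \<and> orb \<phi> \<rho> \<noteq> 1. 1 - 1 / real (orb \<phi> \<rho>)) < 0 \<and>
     (\<forall>P \<in> P2 - curve_points \<phi>. \<not> (vanishes_at (penA \<phi>) P \<and> vanishes_at (penB \<phi>) P)) \<and>
     pencil_map \<phi> ` (P2 - curve_points \<phi>) = {\<rho> \<in> P1. orb \<phi> \<rho> \<noteq> 0}"

definition quasi_fiber_type :: "quasi_fiber_data \<Rightarrow> bool" where
  "quasi_fiber_type \<phi> \<longleftrightarrow> decomposed_curve \<phi> \<and> irreducible_pencil \<phi> \<and> parts_in_pencil \<phi> \<and>
     hyperbolic_orbifold_map \<phi>"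

definition has_index :: "quasi_fiber_data \<Rightarrow> nat \<Rightarrow> bool" where
  "has_index \<phi> k \<longleftrightarrow> k \<ge> 1 \<and>
     (\<exists>\<rho> \<in> P1 - qpt \<phi> ` {..<nparts \<phi>}. \<exists>G e. homogeneous e G \<and> member \<phi> \<rho> = G ^ k) \<and>
     (\<forall>i<nparts \<phi>. k dvd qorder \<phi> i)"

definition wct_of :: "quasi_fiber_data \<Rightarrow> (nat \<times> nat, pt2, local_ring set) wct" where
  "wct_of \<phi> = curve_wct (comp_index \<phi>) (\<lambda>(i, j). qF \<phi> i j)"

definition associated_cochain :: "quasi_fiber_data \<Rightarrow> (nat \<Rightarrow> 'k::field) \<Rightarrow> nat \<times> nat \<Rightarrow> 'k" where
  "associated_cochain \<phi> \<alpha> =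
     (\<Sum>(i, j)\<in>comp_index \<phi>. fun_scale (of_nat (qmult \<phi> i j) * \<alpha> i) (basis_vec (i, j)))"

definition associated_cochains :: "quasi_fiber_data \<Rightarrow> (nat \<times> nat \<Rightarrow> 'k::field) set" where
  "associated_cochains \<phi> = range (associated_cochain \<phi>)"

end

theory Submission
  imports Defs "HOL-Computational_Algebra.Field_as_Ring"
begin

text \<open>
  Fix a branch \<open>\<delta>\<^sub>0\<close> at every singular point \<open>P\<close> and put \<open>e(\<delta>) = \<psi>\<^sub>\<delta> \<and> \<psi>\<^sub>\<delta>\<^sub>0\<close>. Modulo the relations at \<open>P\<close> one has
  \<open>\<psi>\<^sub>\<delta> \<and> \<psi>\<^sub>\<delta>' = e(\<delta>) - e(\<delta>')\<close>. Therefore \<open>\<sigma>\<^sub>a \<and> \<sigma>\<^sub>b = T(a, b) - T(b, a)\<close>, where \<open>T(a, b)\<close> is the sum over the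
  branches \<open>\<delta>\<close> of the component \<open>a\<close> of \<open>e(\<delta>)\<close> times the intersection number of \<open>\<delta>\<close> with the whole
  component \<open>b\<close>, plus the term at infinity with coefficient \<open>d\<^sub>b\<close>.

  Let \<open>a\<close> belong to the part \<open>i\<close> and sum \<open>m\<^sub>b T(a, b)\<close> over the components \<open>b\<close> of a part \<open>l \<noteq> i\<close>. The
  coefficient of \<open>e(\<delta>)\<close> becomes the intersection number of \<open>\<delta>\<close> with \<open>F\<^sub>l\<close>. As \<open>G\<^sub>l\<close> differs from
  \<open>F\<^sub>l\<close> by a power of exponent \<open>m\<^sub>l\<close>, which is zero in the field, it equals there the intersection
  number of \<open>\<delta>\<close> with \<open>G\<^sub>l\<close>. Since \<open>G\<^sub>i\<close> vanishes on \<open>\<delta>\<close>, all the other members of the pencil are proportional on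
  \<open>\<delta>\<close>, so this number is independent of \<open>l\<close>. In the same way the coefficient at infinity becomes
  the degree of the pencil. So the sum is an element \<open>E(a)\<close> independent of \<open>l\<close> (\<open>fiber_term_eq\<close>), and the product of the
  cochains associated with \<open>\<beta>\<close> and \<open>\<alpha>\<close> is the sum over \<open>a\<close> of
  \<open>m\<^sub>a (\<beta>\<^sub>i \<Sum>\<alpha> - \<alpha>\<^sub>i \<Sum>\<beta>) E(a)\<close> (\<open>wedge_associated_cochains_in_relations\<close>).

  If \<open>\<Sum>\<alpha> = 0\<close>, every \<open>\<beta>\<close> with \<open>\<Sum>\<beta> = 0\<close> gives a cocycle. If the pencil contains \<open>G\<^sup>k\<close> with \<open>k = 0\<close> in
  the field, then \<open>E(a)\<close> can be computed with this member; intersection numbers and degree are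
  multiples of \<open>k\<close>, so \<open>E(a) = 0\<close> and every \<open>\<beta>\<close> gives a cocycle. Different \<open>\<beta>\<close> give different cochains
  because the multiplicities within a part have greatest common divisor \<open>1\<close>. Counting dimensions
  modulo the line of \<open>\<omega>\<close> yields \<open>r - 2\<close> and \<open>r - 1\<close>.

  The argument rests on local intersection theory in \<open>R = \<complex>[[X, Y]]\<close>. Irreducible series are prime
  (\<open>irreducible_fps_imp_prime_elem\<close>), and intersection numbers are additive in products
  (\<open>intersection_number_mult\<close>); hence intersecting with all branches of a squarefree germ amounts to
  intersecting with the germ (\<open>sum_over_germ_branches\<close>). These results apply because coprime forms
  have germs generating an ideal of finite codimension (\<open>coprime_forms_finite_colength\<close>, by
  elimination) and because the germs of an irreducible form are squarefree
  (\<open>irreducible_form_locally_squarefree\<close>, by differentiation).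
\<close>

section \<open>Bases of quotient spaces\<close>

context vector_space begin

text \<open>Writing a finite part of \<open>B\<close> in terms of \<open>S\<close> and \<open>V\<close> uses only finitely many elements of \<open>V\<close>.
  Replacing \<open>V\<close> by a finite independent set \<open>C\<close> with the same span as these, \<open>B0 \<union> C\<close> is
  independent inside the span of \<open>S \<union> C\<close>, and \<open>C\<close> cancels from the resulting inequality.\<close>

lemma independent_modulo_card_le:
  assumes V: "subspace V" and S: "finite S"
    and B: "B \<subseteq> span (S \<union> V)"
    and indep: "\<forall>S c. finite S \<longrightarrow> S \<subseteq> B \<longrightarrow> (\<Sum>b\<in>S. scale (c b) b) \<in> V \<longrightarrow> (\<forall>b\<in>S. c b = 0)"
  shows "finite B \<and> card B \<le> card S"
proof -
  have *: "card B0 \<le> card S" if B0: "finite B0" "B0 \<subseteq> B" for B0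
  proof -
    have "\<exists>T. finite T \<and> T \<subseteq> V \<and> x \<in> span (S \<union> T)" if "x \<in> B" for x
    proof -
      have "x \<in> span (S \<union> V)" using that B by auto
      then obtain s v where sv: "x = s + v" "s \<in> span S" "v \<in> span V"
        by (auto simp: span_Un)
      then have "v \<in> V" using V by (metis span_eq_iff)
      moreover have "x \<in> span (S \<union> {v})"
        unfolding sv(1) using sv(2) span_mono[of S "S \<union> {v}"] by (intro span_add) (auto intro: span_base)
      ultimately show ?thesis by (intro exI[of _ "{v}"]) auto
    qed
    then obtain T where T: "\<And>x. x \<in> B \<Longrightarrow> finite (T x) \<and> T x \<subseteq> V \<and> x \<in> span (S \<union> T x)"
      by metis
    define U where "U = (\<Union>x\<in>B0. T x)"
    have U: "finite U" "U \<subseteq> V" using T B0 by (auto simp: U_def)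
    have B0U: "B0 \<subseteq> span (S \<union> U)"
    proof
      fix x assume "x \<in> B0"
      then have "x \<in> span (S \<union> T x)" "S \<union> T x \<subseteq> S \<union> U" using T B0 by (auto simp: U_def)
      then show "x \<in> span (S \<union> U)" using span_mono by blast
    qed
    obtain C where C: "C \<subseteq> U" "independent C" "U \<subseteq> span C"
      using maximal_independent_subset by blast
    have finC: "finite C" using C U finite_subset by blast
    have CV: "C \<subseteq> V" using C U by auto
    have disj: "B0 \<inter> C = {}"
    proof (rule ccontr)
      assume "B0 \<inter> C \<noteq> {}"
      then obtain x where x: "x \<in> B0" "x \<in> V" using CV by auto
      have "\<forall>b\<in>{x}. (\<lambda>_. 1) b = (0::'a)"
        using indep[rule_format, of "{x}" "\<lambda>_. 1"] x B0 by auto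
      then show False by auto
    qed
    have ind: "independent (B0 \<union> C)"
      unfolding independent_explicit_finite_subsets
    proof (intro allI impI ballI)
      fix S' u v assume S': "S' \<subseteq> B0 \<union> C" "finite S'" "(\<Sum>v\<in>S'. scale (u v) v) = 0" "v \<in> S'"
      have fin: "finite (S' \<inter> B0)" "finite (S' \<inter> C)" using S' by auto
      have split: "(\<Sum>v\<in>S'. scale (u v) v) = (\<Sum>v\<in>S'\<inter>B0. scale (u v) v) + (\<Sum>v\<in>S'\<inter>C. scale (u v) v)"
      proof -
        have "S' = (S' \<inter> B0) \<union> (S' \<inter> C)" using S' by auto
        then show ?thesis using sum.union_disjoint[OF fin, of "\<lambda>v. scale (u v) v"] disj by auto
      qed
      have inV: "(\<Sum>v\<in>S'\<inter>C. scale (u v) v) \<in> V"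
        using CV V by (intro subspace_sum subspace_scale) auto
      have "(\<Sum>v\<in>S'\<inter>B0. scale (u v) v) = - (\<Sum>v\<in>S'\<inter>C. scale (u v) v)"
        using split S'(3) by (simp add: eq_neg_iff_add_eq_0)
      then have "(\<Sum>v\<in>S'\<inter>B0. scale (u v) v) \<in> V"
        using inV V subspace_neg by simp
      then have z: "\<forall>b\<in>S' \<inter> B0. u b = 0"
        using indep[rule_format, of "S' \<inter> B0" u] fin B0 by blast
      then have "(\<Sum>v\<in>S'\<inter>B0. scale (u v) v) = 0" by simp
      then have "(\<Sum>v\<in>S'\<inter>C. scale (u v) v) = 0" using split S'(3) by simp
      then have "\<forall>b\<in>S' \<inter> C. u b = 0"
        using C(2) fin unfolding independent_explicit_finite_subsets by blast
      then show "u v = 0" using z S' by auto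
    qed
    have "S \<union> U \<subseteq> span (S \<union> C)"
      using C(3) span_mono[of C "S \<union> C"] span_superset[of "S \<union> C"] by blast
    then have "B0 \<subseteq> span (S \<union> C)" using B0U span_mono span_span by blast
    then have "B0 \<union> C \<subseteq> span (S \<union> C)" using span_superset[of "S \<union> C"] by blast
    then have "card (B0 \<union> C) \<le> card (S \<union> C)"
      using independent_span_bound[of "S \<union> C" "B0 \<union> C"] ind S finC by auto
    also have "\<dots> \<le> card S + card C" by (rule card_Un_le)
    finally show ?thesis using card_Un_disjoint[OF B0(1) finC disj] by linarith
  qed
  have fin: "finite B"
  proof (rule ccontr)
    assume "infinite B"
    then obtain B0 where "finite B0" "B0 \<subseteq> B" "card B0 = Suc (card S)"
      using infinite_arbitrarily_large by blast
    then show False using * by fastforce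
  qed
  then show ?thesis using * by blast
qed

text \<open>The exchange bound makes a subset of \<open>U\<close> of maximal size among those independent modulo \<open>V\<close>
  available; by maximality it generates \<open>U\<close> modulo \<open>V\<close>.\<close>

lemma exists_basis_modulo:
  assumes V: "subspace V" and S: "finite S" and U: "U \<subseteq> span (S \<union> V)"
  shows "\<exists>B. finite B \<and> basis_modulo scale B U V"
proof -
  define P where "P = (\<lambda>B. B \<subseteq> U \<and>
    (\<forall>S c. finite S \<longrightarrow> S \<subseteq> B \<longrightarrow> (\<Sum>b\<in>S. scale (c b) b) \<in> V \<longrightarrow> (\<forall>b\<in>S. c b = 0)))"
  have bound: "finite B \<and> card B \<le> card S" if "P B" for B
  proof (rule independent_modulo_card_le[OF V S])
    show "B \<subseteq> span (S \<union> V)" using that U by (auto simp: P_def)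
    show "\<forall>S c. finite S \<longrightarrow> S \<subseteq> B \<longrightarrow> (\<Sum>b\<in>S. scale (c b) b) \<in> V \<longrightarrow> (\<forall>b\<in>S. c b = 0)"
      using that unfolding P_def by (elim conjE)
  qed
  have "P {}" by (auto simp: P_def)
  moreover have "\<forall>B. P B \<longrightarrow> card B < Suc (card S)" using bound le_imp_less_Suc by metis
  ultimately obtain B where B: "P B" "\<And>B'. P B' \<Longrightarrow> card B' \<le> card B"
    using ex_has_greatest_nat[of P "{}" card "Suc (card S)"] by metis
  have finB: "finite B" using bound B by blast
  have "U \<subseteq> span (B \<union> V)"
  proof
    fix x assume x: "x \<in> U"
    show "x \<in> span (B \<union> V)"
    proof (rule ccontr)
      assume nx: "x \<notin> span (B \<union> V)"
      have "x \<notin> B" using nx span_base by blast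
      have "P (insert x B)" unfolding P_def
      proof (intro conjI allI impI)
        show "insert x B \<subseteq> U" using x B by (auto simp: P_def)
        fix T c assume T: "finite T" "T \<subseteq> insert x B" "(\<Sum>b\<in>T. scale (c b) b) \<in> V"
        show "\<forall>b\<in>T. c b = 0"
        proof (cases "x \<in> T \<and> c x \<noteq> 0")
          case True
          define w where "w = (\<Sum>b\<in>T - {x}. scale (c b) b)"
          have "(\<Sum>b\<in>T. scale (c b) b) = scale (c x) x + w"
            unfolding w_def using T True by (subst sum.remove[of T x]) auto
          then have "scale (c x) x = (\<Sum>b\<in>T. scale (c b) b) - w" by simp
          moreover have "w \<in> span (B \<union> V)" unfolding w_def using T
            by (intro span_sum span_scale span_base) auto
          moreover have "(\<Sum>b\<in>T. scale (c b) b) \<in> span (B \<union> V)" using T by (intro span_base) auto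
          ultimately have "scale (c x) x \<in> span (B \<union> V)" by (simp add: span_diff)
          then have "scale (inverse (c x)) (scale (c x) x) \<in> span (B \<union> V)" by (rule span_scale)
          then show ?thesis using True nx by simp
        next
          case False
          have "(\<Sum>b\<in>T. scale (c b) b) = (\<Sum>b\<in>T - {x}. scale (c b) b)"
            using False T by (intro sum.mono_neutral_right) auto
          then have "\<forall>b\<in>T - {x}. c b = 0" using B(1) T unfolding P_def
            by (metis Diff_subset_conv finite_Diff insert_is_Un)
          then show ?thesis using False by auto
        qed
      qed
      then have "card (insert x B) \<le> card B" by (rule B(2))
      then show False using \<open>x \<notin> B\<close> finB by simp
    qed
  qed
  then show ?thesis using B(1) finB unfolding basis_modulo_def P_def by blast
qed

lemma basis_modulo_card_le:
  assumes V: "subspace V" and "finite B" "basis_modulo scale B U V" "basis_modulo scale B' U V"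
  shows "finite B' \<and> card B' \<le> card B"
proof (rule independent_modulo_card_le[OF V])
  show "finite B" by fact
  show "B' \<subseteq> span (B \<union> V)" using assms(3,4) unfolding basis_modulo_def by (meson subset_trans)
  show "\<forall>S c. finite S \<longrightarrow> S \<subseteq> B' \<longrightarrow> (\<Sum>b\<in>S. scale (c b) b) \<in> V \<longrightarrow> (\<forall>b\<in>S. c b = 0)"
    using assms(4) unfolding basis_modulo_def by (elim conjE)
qed

lemma basis_modulo_card_unique:
  assumes V: "subspace V" and "finite B" "basis_modulo scale B U V" "basis_modulo scale B' U V"
  shows "card B' = card B"
  using basis_modulo_card_le[OF assms] basis_modulo_card_le[OF V _ assms(4,3)] by simp

text \<open>All bases modulo \<open>V\<close> have the same size, so it is irrelevant which of them the choice operator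
  in \<^const>\<open>quotient_dim\<close> picks.\<close>

lemma quotient_dim_eq_card:
  assumes "subspace V" "finite B" "basis_modulo scale B U V"
  shows "quotient_dim scale U V = card B"
  unfolding quotient_dim_def
  by (rule basis_modulo_card_unique[OF assms someI[of "\<lambda>B. basis_modulo scale B U V"]]) fact

lemma independent_family:
  assumes K: "finite K" and ind: "\<And>c k. (\<Sum>k\<in>K. scale (c k) (w k)) = 0 \<Longrightarrow> k \<in> K \<Longrightarrow> c k = 0"
  shows "independent (w ` K)" "card (w ` K) = card K"
proof -
  have inj: "inj_on w K"
  proof (rule inj_onI, rule ccontr)
    fix k l assume kl: "k \<in> K" "l \<in> K" "w k = w l" "k \<noteq> l"
    define c :: "'c \<Rightarrow> 'a" where "c = (\<lambda>m. if m = k then 1 else if m = l then - 1 else 0)"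
    have "(\<Sum>m\<in>K. scale (c m) (w m)) = (\<Sum>m\<in>{k, l}. scale (c m) (w m))"
      using kl K by (intro sum.mono_neutral_right) (auto simp: c_def)
    also have "\<dots> = 0" using kl by (simp add: c_def)
    finally have "c k = 0" using ind kl by blast
    then show False by (simp add: c_def)
  qed
  then show "card (w ` K) = card K" by (rule card_image)
  show "independent (w ` K)"
    unfolding independent_explicit_finite_subsets
  proof (intro allI impI ballI)
    fix S u v assume S: "S \<subseteq> w ` K" "finite S" "(\<Sum>v\<in>S. scale (u v) v) = 0" "v \<in> S"
    define c where "c = (\<lambda>k. if w k \<in> S then u (w k) else 0)"
    have "(\<Sum>k\<in>K. scale (c k) (w k)) = (\<Sum>v\<in>w ` K. scale (if v \<in> S then u v else 0) v)"
      unfolding c_def by (subst sum.reindex[OF inj]) simp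
    also have "\<dots> = (\<Sum>v\<in>S. scale (u v) v)"
      using S K by (intro sum.mono_neutral_cong_right) auto
    finally have 0: "(\<Sum>k\<in>K. scale (c k) (w k)) = 0" using S by simp
    obtain k where "k \<in> K" "v = w k" using S by auto
    then show "u v = 0" using ind[OF 0, of k] S by (simp add: c_def)
  qed
qed

text \<open>The form in which cocycles will be counted: a basis modulo the line through \<open>w\<close>, together
  with \<open>w\<close>, generates \<open>U\<close>.\<close>

lemma card_le_quotient_dim_line:
  assumes U: "finite T" "U \<subseteq> span T" and S: "S \<subseteq> U" "independent S" and V: "V = range (\<lambda>c. scale c w)"
  shows "card S \<le> quotient_dim scale U V + 1"
proof -
  have sV: "subspace V"
  proof (rule subspaceI)
    show "0 \<in> V" unfolding V by (metis rangeI scale_zero_left)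
    show "x + y \<in> V" if "x \<in> V" "y \<in> V" for x y
    proof -
      obtain a b where "x = scale a w" "y = scale b w" using \<open>x \<in> V\<close> \<open>y \<in> V\<close> by (auto simp: V)
      then have "x + y = scale (a + b) w" by (simp add: scale_left_distrib)
      then show ?thesis unfolding V by (metis rangeI)
    qed
    show "scale c x \<in> V" if "x \<in> V" for c x using that by (auto simp: V)
  qed
  have "span T \<subseteq> span (T \<union> V)" by (intro span_mono) auto
  then obtain B where B: "finite B" "basis_modulo scale B U V"
    using exists_basis_modulo[OF sV U(1), of U] U by blast
  have "V \<subseteq> span {w}" unfolding V by (auto intro: span_scale span_base)
  then have "B \<union> V \<subseteq> span (insert w B)"
    using span_mono[of "{w}" "insert w B"] span_superset[of "insert w B"] by blast
  then have "span (B \<union> V) \<subseteq> span (insert w B)" using span_mono span_span by blast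
  moreover have "U \<subseteq> span (B \<union> V)" using B(2) by (simp add: basis_modulo_def)
  ultimately have "S \<subseteq> span (insert w B)" using S(1) by (meson subset_trans)
  then have "card S \<le> card (insert w B)"
    using independent_span_bound[of "insert w B" S] S(2) B(1) by simp
  also have "\<dots> \<le> card B + 1" using B by (simp add: card_insert_if)
  finally show ?thesis using quotient_dim_eq_card[OF sV B] by simp
qed

end

section \<open>Unique factorisation of power series\<close>

lemma is_unit_fps_iff:
  fixes u :: "'a::comm_ring_1 fps"
  shows "u dvd 1 \<longleftrightarrow> (fps_nth u 0) dvd 1"
proof
  assume "u dvd 1"
  then obtain v where "1 = u * v" by (auto elim: dvdE)
  then have "1 = fps_nth u 0 * fps_nth v 0" by (metis fps_mult_nth_0 fps_one_nth)
  then show "(fps_nth u 0) dvd 1" by (rule dvdI)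
next
  assume "(fps_nth u 0) dvd 1"
  then obtain y where "fps_nth u 0 * y = 1" by (metis dvdE)
  then have "u * fps_right_inverse u y = 1" by (rule fps_right_inverse)
  then show "u dvd 1" by (metis dvdI)
qed

lemma fps_X_power_dvd_iff:
  fixes u :: "'a::comm_ring_1 fps"
  shows "fps_X ^ n dvd u \<longleftrightarrow> (\<forall>i<n. fps_nth u i = 0)"
proof
  assume "fps_X ^ n dvd u"
  then show "\<forall>i<n. fps_nth u i = 0" by (auto elim!: dvdE simp: fps_X_power_mult_nth)
next
  assume "\<forall>i<n. fps_nth u i = 0"
  then have "u = fps_X ^ n * fps_shift n u"
    by (intro fps_ext) (auto simp: fps_X_power_mult_nth)
  then show "fps_X ^ n dvd u" by (metis dvdI)
qed

lemma fps_X_dvd_iff: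
  fixes u :: "'a::comm_ring_1 fps"
  shows "fps_X dvd u \<longleftrightarrow> fps_nth u 0 = 0"
  using fps_X_power_dvd_iff[of 1 u] by simp

lemma mult_unit_dvdI:
  fixes a b :: "'a::comm_semiring_1"
  assumes "b dvd 1"
  shows "a * b dvd a"
proof -
  obtain c where "1 = b * c" using assms by (elim dvdE)
  then have "a = a * b * c" by (simp add: mult.assoc)
  then show ?thesis by (metis dvdI)
qed

lemma prime_elem_fps_X: "prime_elem (fps_X :: 'a::idom fps)"
  by (rule prime_elemI) (auto simp: fps_X_dvd_iff is_unit_fps_iff)

text \<open>The values at \<open>0\<close> of the elements of \<open>M\<close> form an ideal of a Euclidean ring, which is generated
  by the value of some \<open>u0 \<in> M\<close>. Subtracting a constant multiple of \<open>u0\<close> from \<open>u \<in> M\<close> leaves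
  an element divisible by the variable, and its quotient by the variable lies in \<open>M\<close> again because
  \<open>M\<close> is saturated. Iterating this produces the coefficients of a power series \<open>r\<close> with
  \<open>u = u0 * r\<close>.\<close>

lemma saturated_ideal_is_principal:
  fixes M :: "'a::euclidean_ring fps set"
  assumes add: "\<And>u v. u \<in> M \<Longrightarrow> v \<in> M \<Longrightarrow> u + v \<in> M"
    and mult: "\<And>r u. u \<in> M \<Longrightarrow> r * u \<in> M"
    and X: "\<And>u. fps_X * u \<in> M \<Longrightarrow> u \<in> M"
    and ex: "h \<in> M" "fps_nth h 0 \<noteq> 0"
  shows "\<exists>u0 \<in> M. \<forall>u \<in> M. u0 dvd u"
proof -
  have diff: "u - v \<in> M" if "u \<in> M" "v \<in> M" for u v
    using add[OF that(1) mult[OF that(2), of "- 1"]] by simp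
  obtain u0 where u0: "u0 \<in> M" "fps_nth u0 0 \<noteq> 0"
    and min: "\<And>u. u \<in> M \<Longrightarrow> fps_nth u 0 \<noteq> 0 \<Longrightarrow>
                euclidean_size (fps_nth u0 0) \<le> euclidean_size (fps_nth u 0)"
    using ex_has_least_nat[of "\<lambda>u. u \<in> M \<and> fps_nth u 0 \<noteq> 0" h "\<lambda>u. euclidean_size (fps_nth u 0)"] ex
    by blast
  have step: "\<exists>c v. v \<in> M \<and> u = fps_const c * u0 + fps_X * v" if u: "u \<in> M" for u
  proof -
    define c where "c = fps_nth u 0 div fps_nth u0 0"
    define w where "w = u - fps_const c * u0"
    have "w \<in> M" unfolding w_def by (intro diff mult u u0)
    have w0: "fps_nth w 0 = fps_nth u 0 mod fps_nth u0 0"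
      by (simp add: w_def c_def minus_div_mult_eq_mod)
    have "fps_nth w 0 = 0"
    proof (rule ccontr)
      assume "fps_nth w 0 \<noteq> 0"
      with min[OF \<open>w \<in> M\<close>] mod_size_less[OF u0(2), of "fps_nth u 0"] w0 show False by simp
    qed
    then obtain v where v: "w = fps_X * v" by (metis fps_X_dvd_iff dvdE)
    then have "v \<in> M" using \<open>w \<in> M\<close> X by simp
    moreover have "u = fps_const c * u0 + fps_X * v" using v by (simp add: w_def algebra_simps)
    ultimately show ?thesis by blast
  qed
  then obtain c v where cv: "\<And>u. u \<in> M \<Longrightarrow> v u \<in> M \<and> u = fps_const (c u) * u0 + fps_X * v u"
    by metis
  have "u0 dvd u" if u: "u \<in> M" for u
  proof
    have it: "(v ^^ n) u \<in> M" for n by (induction n) (use u cv in auto)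
    define r where "r = Abs_fps (\<lambda>n. c ((v ^^ n) u))"
    have tail: "u = (\<Sum>i<n. fps_const (fps_nth r i) * fps_X ^ i) * u0 + fps_X ^ n * (v ^^ n) u" for n
    proof (induction n)
      case (Suc n)
      have "fps_X ^ n * (v ^^ n) u = fps_X ^ n * (fps_const (c ((v ^^ n) u)) * u0 + fps_X * v ((v ^^ n) u))"
        using cv[OF it[of n]] by simp
      also have "\<dots> = fps_const (fps_nth r n) * fps_X ^ n * u0 + fps_X ^ Suc n * (v ^^ Suc n) u"
        by (simp add: r_def algebra_simps)
      finally show ?case using Suc by (simp add: distrib_right add.assoc)
    qed simp
    show "u = u0 * r"
    proof (rule fps_ext)
      fix n
      define s where "s = (\<Sum>i<Suc n. fps_const (fps_nth r i) * fps_X ^ i)"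
      have s: "fps_nth s i = fps_nth r i" if "i \<le> n" for i
        using that by (simp add: s_def fps_sum_nth fps_X_power_nth if_distrib sum.delta' cong: if_cong)
      have "fps_nth u n = fps_nth (s * u0) n + fps_nth (fps_X ^ Suc n * (v ^^ Suc n) u) n"
        using tail[of "Suc n"] unfolding s_def[symmetric] by (metis fps_add_nth)
      also have "fps_nth (fps_X ^ Suc n * (v ^^ Suc n) u) n = 0"
        unfolding fps_X_power_mult_nth by simp
      also have "fps_nth (s * u0) n = fps_nth (r * u0) n"
        unfolding fps_mult_nth by (intro sum.cong refl) (simp add: s)
      finally show "fps_nth u n = fps_nth (u0 * r) n" by (simp add: mult.commute)
    qed
  qed
  then show ?thesis using u0 by blast
qed

text \<open>If \<open>h\<close> divides \<open>f * g\<close> and is not associated with the variable, then the ideal of all \<open>u\<close> with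
  \<open>h dvd f * u\<close> is saturated, the variable being prime, hence generated by one element. This generator divides both \<open>h\<close> and
  \<open>g\<close>, so by irreducibility it is a unit, which means \<open>h dvd f\<close>, or associated with \<open>h\<close>, which
  means \<open>h dvd g\<close>.\<close>

lemma irreducible_fps_imp_prime_elem:
  fixes h :: "'a::euclidean_ring fps"
  assumes irr: "Factorial_Ring.irreducible h"
  shows "prime_elem h"
proof (cases "fps_X dvd h")
  case True
  then obtain w where w: "h = fps_X * w" by (elim dvdE)
  have "\<not> (fps_X :: 'a fps) dvd 1" by (simp add: is_unit_fps_iff)
  then have "w dvd 1" using irreducibleD[OF irr w] by blast
  then have "h dvd fps_X" unfolding w by (rule mult_unit_dvdI)
  then have eq: "h dvd u \<longleftrightarrow> fps_X dvd u" for u :: "'a fps" using True by (meson dvd_trans)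
  show ?thesis
    using prime_elem_fps_X irr unfolding prime_elem_def Factorial_Ring.irreducible_def eq by blast
next
  case False
  show ?thesis
  proof (rule prime_elemI)
    show "h \<noteq> 0" "\<not> h dvd 1" using irr by (auto simp: Factorial_Ring.irreducible_def)
    fix f g assume fg: "h dvd f * g"
    define M where "M = {u. h dvd f * u}"
    have "\<exists>u0 \<in> M. \<forall>u \<in> M. u0 dvd u"
    proof (rule saturated_ideal_is_principal)
      show "u + v \<in> M" if "u \<in> M" "v \<in> M" for u v
        using that by (simp add: M_def distrib_left)
      show "r * u \<in> M" if "u \<in> M" for r u
        using that dvd_mult[of h "f * u" r] by (simp add: M_def mult.left_commute)
      show "u \<in> M" if u: "fps_X * u \<in> M" for u
      proof -
        obtain w where w: "f * (fps_X * u) = h * w" using u by (auto simp: M_def elim: dvdE)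
        then have "fps_X dvd h * w" by (metis dvd_triv_left mult.left_commute)
        then obtain w' where "w = fps_X * w'"
          using False prime_elem_fps_X by (metis prime_elem_dvd_mult_iff dvdE)
        then have "fps_X * (f * u) = fps_X * (h * w')" using w by (simp add: ac_simps)
        then show ?thesis by (simp add: M_def)
      qed
      show "h \<in> M" by (simp add: M_def)
      show "fps_nth h 0 \<noteq> 0" using False by (simp add: fps_X_dvd_iff)
    qed
    then obtain u0 where u0: "h dvd f * u0" "\<And>u. h dvd f * u \<Longrightarrow> u0 dvd u" by (auto simp: M_def)
    have "u0 dvd h" "u0 dvd g" using u0(2) fg by auto
    then obtain w where w: "h = u0 * w" by (elim dvdE)
    then have "u0 dvd 1 \<or> w dvd 1" using irreducibleD[OF irr] by blast
    then show "h dvd f \<or> h dvd g"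
    proof
      assume "u0 dvd 1"
      then show ?thesis using u0(1) mult_unit_dvdI[of u0 f] by (meson dvd_trans)
    next
      assume "w dvd 1"
      then have "h dvd u0" unfolding w by (rule mult_unit_dvdI)
      then show ?thesis using \<open>u0 dvd g\<close> by (meson dvd_trans)
    qed
  qed
qed

text \<open>The sum of the two exponents of the lexicographically first monomial of \<open>f\<close>. It is additive on
  products and vanishes exactly on the units, so it measures the length of factorisations.\<close>

definition fps2_order :: "'a::idom fps fps \<Rightarrow> nat" where
  "fps2_order f = subdegree f + subdegree (fps_nth f (subdegree f))"

lemma fps2_order_mult:
  assumes "f \<noteq> 0" "g \<noteq> 0"
  shows "fps2_order (f * g) = fps2_order f + fps2_order g"
proof -
  have "fps_nth (f * g) (subdegree f + subdegree g) = fps_nth f (subdegree f) * fps_nth g (subdegree g)"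
    by simp
  then show ?thesis using assms by (simp add: fps2_order_def)
qed

lemma fps2_order_eq_0_iff:
  fixes f :: "'a::field fps fps"
  assumes "f \<noteq> 0"
  shows "fps2_order f = 0 \<longleftrightarrow> f dvd 1"
proof
  assume "fps2_order f = 0"
  then have 0: "subdegree f = 0" "subdegree (fps_nth f 0) = 0" by (auto simp: fps2_order_def)
  then have "fps_nth f 0 \<noteq> 0" using assms nth_subdegree_nonzero[of f] by simp
  then show "f dvd 1" using 0 nth_subdegree_nonzero[of "fps_nth f 0"] by (simp add: is_unit_fps_iff)
next
  assume "f dvd 1"
  then have "fps_nth (fps_nth f 0) 0 \<noteq> 0" by (simp add: is_unit_fps_iff)
  moreover from this have "fps_nth f 0 \<noteq> 0" by auto
  ultimately have "subdegree f = 0" "subdegree (fps_nth f 0) = 0"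
    using subdegree_leI[of f 0] subdegree_leI[of "fps_nth f 0" 0] by auto
  then show "fps2_order f = 0" by (simp add: fps2_order_def)
qed

lemma exists_irreducible_factor:
  fixes f :: "'a::field fps fps"
  assumes "f \<noteq> 0" "\<not> f dvd 1"
  shows "\<exists>h. Factorial_Ring.irreducible h \<and> h dvd f"
  using assms
proof (induction "fps2_order f" arbitrary: f rule: less_induct)
  case less
  show ?case
  proof (cases "Factorial_Ring.irreducible f")
    case False
    then obtain a b where ab: "f = a * b" "\<not> a dvd 1" "\<not> b dvd 1"
      using less.prems by (auto simp: Factorial_Ring.irreducible_def)
    then have "a \<noteq> 0" "b \<noteq> 0" using less.prems by auto
    then have "fps2_order a < fps2_order f"
      using ab fps2_order_mult[of a b] fps2_order_eq_0_iff[of b] by simp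
    from less.hyps[OF this \<open>a \<noteq> 0\<close> ab(2)] show ?thesis using ab(1) by (meson dvd_mult2)
  qed auto
qed

section \<open>Intersection numbers of plane germs\<close>

definition multiples :: "'a::comm_semiring_1 \<Rightarrow> 'a set" where
  "multiples h = {g. h dvd g}"

text \<open>Some power of each coordinate lies in the ideal generated by \<open>h\<close> and \<open>f\<close>, which is a way of saying
  that this ideal has finite codimension. Powers of the coordinates are what elimination theory
  delivers, and they permit divisions because the two coordinates are coprime.\<close>

definition finite_colength :: "local_ring \<Rightarrow> local_ring \<Rightarrow> bool" where
  "finite_colength h f \<longleftrightarrow> (\<exists>N u v u' v'. loc_X ^ N = h * u + f * v \<and> loc_Y ^ N = h * u' + f * v')"

definition ideal_sum :: "local_ring \<Rightarrow> local_ring \<Rightarrow> local_ring set" where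
  "ideal_sum h f = {u + v | u v. u \<in> multiples h \<and> v \<in> multiples f}"

lemma ideal_sum_iff: "w \<in> ideal_sum h f \<longleftrightarrow> (\<exists>a b. w = h * a + f * b)"
  unfolding ideal_sum_def multiples_def by (force elim: dvdE)

lemma intersection_number_multiples:
  "intersection_number (multiples h) (multiples f) = quotient_dim loc_scale UNIV (ideal_sum h f)"
  by (simp add: intersection_number_def ideal_sum_def)

lemma ideal_sum_mult: "w \<in> ideal_sum h f \<Longrightarrow> r * w \<in> ideal_sum h f"
proof -
  assume "w \<in> ideal_sum h f"
  then obtain a b where "w = h * a + f * b" by (auto simp: ideal_sum_iff)
  then have "r * w = h * (r * a) + f * (r * b)" by (simp add: algebra_simps)
  then show ?thesis by (auto simp: ideal_sum_iff)
qed

lemma ideal_sum_add: "w \<in> ideal_sum h f \<Longrightarrow> w' \<in> ideal_sum h f \<Longrightarrow> w + w' \<in> ideal_sum h f"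
proof -
  assume "w \<in> ideal_sum h f" "w' \<in> ideal_sum h f"
  then obtain a b a' b' where "w = h * a + f * b" "w' = h * a' + f * b'" by (auto simp: ideal_sum_iff)
  then have "w + w' = h * (a + a') + f * (b + b')" by (simp add: algebra_simps)
  then show ?thesis unfolding ideal_sum_iff by blast
qed

lemma subspace_ideal_sum: "loc_vs.subspace (ideal_sum h f)"
proof (rule loc_vs.subspaceI)
  have "0 = h * 0 + f * 0" by simp
  then show "0 \<in> ideal_sum h f" unfolding ideal_sum_iff by blast
qed (auto simp: loc_scale_def ideal_sum_mult ideal_sum_add)

lemma finite_colength_iff:
  "finite_colength h f \<longleftrightarrow> (\<exists>N. loc_X ^ N \<in> ideal_sum h f \<and> loc_Y ^ N \<in> ideal_sum h f)"
  unfolding finite_colength_def ideal_sum_iff by blast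

lemma finite_colength_mono:
  assumes "finite_colength h f" "h' dvd h" "f' dvd f"
  shows "finite_colength h' f'"
proof -
  obtain a b where "h = h' * a" "f = f' * b" using assms(2,3) by (elim dvdE)
  then have "ideal_sum h f \<subseteq> ideal_sum h' f'"
    by (auto simp: ideal_sum_iff mult.assoc) blast
  then show ?thesis using assms(1) unfolding finite_colength_iff by blast
qed

lemma loc_X_power_mult_nth: "fps_nth (loc_X ^ N * u) n = fps_X ^ N * fps_nth u n"
  by (simp add: loc_X_def)

text \<open>If \<open>X\<^sup>N u = h a\<close> and \<open>Y\<^sup>N u = h b\<close>, then \<open>Y\<^sup>N a = X\<^sup>N b\<close>; comparing coefficients, \<open>Y\<^sup>N\<close> divides \<open>b\<close>.\<close>

lemma dvd_of_X_Y_power_mult: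
  assumes "h dvd loc_X ^ N * u" "h dvd loc_Y ^ N * u" "h \<noteq> 0"
  shows "h dvd u"
proof -
  obtain a b where ab: "loc_X ^ N * u = h * a" "loc_Y ^ N * u = h * b" using assms by (elim dvdE)
  have "h * (loc_Y ^ N * a) = h * (loc_X ^ N * b)"
    using ab by (metis mult.left_commute)
  then have eq: "loc_Y ^ N * a = loc_X ^ N * b" using \<open>h \<noteq> 0\<close> by simp
  have "fps_nth b i = 0" if "i < N" for i
  proof -
    have "fps_nth (loc_Y ^ N * a) i = 0" using that by (simp add: loc_Y_def fps_X_power_mult_nth)
    then show ?thesis using eq loc_X_power_mult_nth by simp
  qed
  then obtain c where "b = loc_Y ^ N * c" using fps_X_power_dvd_iff[of N b] by (auto simp: loc_Y_def)
  then have "loc_Y ^ N * u = loc_Y ^ N * (h * c)" using ab(2) by (simp add: ac_simps)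
  then have "u = h * c" by (simp add: loc_Y_def)
  then show ?thesis by simp
qed

text \<open>Multiplying the expressions of \<open>X\<^sup>N\<close> and \<open>Y\<^sup>N\<close> through \<open>h\<close> and \<open>g\<close> by \<open>u\<close> shows that \<open>h\<close> divides both
  \<open>X\<^sup>N u\<close> and \<open>Y\<^sup>N u\<close>.\<close>

lemma coprime_factor_dvd:
  assumes fc: "finite_colength h g" and dvd: "h dvd g * u" and "h \<noteq> 0"
  shows "h dvd u"
proof -
  obtain N a b a' b' where N: "loc_X ^ N = h * a + g * b" "loc_Y ^ N = h * a' + g * b'"
    using fc unfolding finite_colength_def by blast
  have "loc_X ^ N * u = h * (a * u) + (g * u) * b" "loc_Y ^ N * u = h * (a' * u) + (g * u) * b'"
    unfolding N by (simp_all add: algebra_simps)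
  then have "h dvd loc_X ^ N * u" "h dvd loc_Y ^ N * u" using dvd by simp_all
  then show ?thesis using dvd_of_X_Y_power_mult \<open>h \<noteq> 0\<close> by blast
qed

lemma fps_const_sum: "fps_const (\<Sum>i\<in>A. f i) = (\<Sum>i\<in>A. fps_const (f i :: 'a::comm_monoid_add))"
  by (rule fps_ext) (simp add: fps_sum_nth)

text \<open>This makes the quotient by any ideal containing \<open>X\<^sup>N\<close> and \<open>Y\<^sup>N\<close> finite dimensional.\<close>

lemma local_ring_truncate:
  "\<exists>c r s. (u :: local_ring) = (\<Sum>(i, j)\<in>{..<N} \<times> {..<N}. loc_scale (c i j) (loc_X ^ i * loc_Y ^ j))
     + loc_X ^ N * r + loc_Y ^ N * s"
proof -
  define c where "c i j = fps_nth (fps_nth u j) i" for i j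
  define r where "r = (\<Sum>j<N. fps_const (fps_shift N (fps_nth u j)) * loc_Y ^ j)"
  define s where "s = fps_shift N u"
  have sc: "loc_scale a (loc_X ^ i * loc_Y ^ j) = fps_const (fps_const a * fps_X ^ i) * fps_X ^ j" for a i j
    by (simp add: loc_scale_def loc_const_def loc_X_def loc_Y_def mult.assoc[symmetric])
  have "(\<Sum>(i, j)\<in>{..<N} \<times> {..<N}. loc_scale (c i j) (loc_X ^ i * loc_Y ^ j))
      = (\<Sum>j<N. \<Sum>i<N. loc_scale (c i j) (loc_X ^ i * loc_Y ^ j))"
    by (subst sum.swap) (simp add: sum.cartesian_product)
  also have "\<dots> = (\<Sum>j<N. fps_const (\<Sum>i<N. fps_const (c i j) * fps_X ^ i) * fps_X ^ j)"
    unfolding sc by (intro sum.cong refl) (simp add: fps_const_sum sum_distrib_right)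
  finally have 1: "(\<Sum>(i, j)\<in>{..<N} \<times> {..<N}. loc_scale (c i j) (loc_X ^ i * loc_Y ^ j))
     = (\<Sum>j<N. fps_const (\<Sum>i<N. fps_const (c i j) * fps_X ^ i) * fps_X ^ j)" .
  have trunc: "(\<Sum>i<N. fps_const (fps_nth w i) * fps_X ^ i) + fps_X ^ N * fps_shift N w = w"
    for w :: "'a::comm_ring_1 fps"
    by (rule fps_ext) (simp add: fps_sum_nth fps_X_power_nth if_distrib sum.delta' fps_X_power_mult_nth cong: if_cong)
  have 2: "loc_X ^ N * r = (\<Sum>j<N. fps_const (fps_X ^ N * fps_shift N (fps_nth u j)) * fps_X ^ j)"
    by (simp add: r_def loc_X_def loc_Y_def sum_distrib_left mult.assoc[symmetric])
  have "(\<Sum>j<N. fps_const (\<Sum>i<N. fps_const (c i j) * fps_X ^ i) * fps_X ^ j) + loc_X ^ N * r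
      = (\<Sum>j<N. fps_const (fps_nth u j) * fps_X ^ j)"
    unfolding 2 sum.distrib[symmetric] distrib_right[symmetric] fps_const_add
    by (simp add: c_def trunc)
  then have "u = (\<Sum>j<N. fps_const (\<Sum>i<N. fps_const (c i j) * fps_X ^ i) * fps_X ^ j) + loc_X ^ N * r + loc_Y ^ N * s"
    using trunc[of u] by (simp add: s_def loc_Y_def)
  then show ?thesis unfolding 1[symmetric] by blast
qed

lemma basis_modulo_independentD:
  assumes "basis_modulo scale B U V" "finite S" "S \<subseteq> B" "(\<Sum>b\<in>S. scale (c b) b) \<in> V"
  shows "\<forall>b\<in>S. c b = 0"
  using assms unfolding basis_modulo_def by simp

lemma finite_colength_basis:
  assumes "finite_colength h f"
  shows "\<exists>B. finite B \<and> basis_modulo loc_scale B UNIV (ideal_sum h f)"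
proof -
  obtain N where N: "loc_X ^ N \<in> ideal_sum h f" "loc_Y ^ N \<in> ideal_sum h f"
    using assms by (auto simp: finite_colength_iff)
  define S where "S = (\<lambda>(i, j). loc_X ^ i * loc_Y ^ j) ` ({..<N} \<times> {..<N})"
  have "u \<in> loc_vs.span (S \<union> ideal_sum h f)" for u
  proof -
    obtain c r s where u: "u = (\<Sum>(i, j)\<in>{..<N} \<times> {..<N}. loc_scale (c i j) (loc_X ^ i * loc_Y ^ j))
     + loc_X ^ N * r + loc_Y ^ N * s" using local_ring_truncate by blast
    have "loc_X ^ N * r \<in> ideal_sum h f" "loc_Y ^ N * s \<in> ideal_sum h f"
      using ideal_sum_mult[OF N(1), of r] ideal_sum_mult[OF N(2), of s] by (simp_all add: mult.commute)
    then show ?thesis unfolding u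
      by (intro loc_vs.span_add loc_vs.span_sum)
         (auto simp: S_def intro!: loc_vs.span_scale intro: loc_vs.span_base)
  qed
  then show ?thesis
    by (intro loc_vs.exists_basis_modulo[of _ S] subspace_ideal_sum) (auto simp: S_def)
qed

text \<open>Multiplication by \<open>g\<close> and the projection give an exact sequence
  \<open>0 \<rightarrow> R/(h, f) \<rightarrow> R/(h, f g) \<rightarrow> R/(h, g) \<rightarrow> 0\<close>. Concretely, if \<open>B1\<close> and \<open>B2\<close> are bases of the outer
  terms, then \<open>g B1 \<union> B2\<close> is a basis of the middle one; injectivity on the left is
  \<open>coprime_factor_dvd\<close>.\<close>

lemma intersection_number_mult:
  assumes fc: "finite_colength h (f * g)" and h: "h \<noteq> 0" and g: "g \<noteq> 0"
  shows "intersection_number (multiples h) (multiples (f * g))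
       = intersection_number (multiples h) (multiples f) + intersection_number (multiples h) (multiples g)"
proof -
  have fcf: "finite_colength h f" and fcg: "finite_colength h g"
    using finite_colength_mono[OF fc] by auto
  obtain B1 where B1: "finite B1" "basis_modulo loc_scale B1 UNIV (ideal_sum h f)"
    using finite_colength_basis[OF fcf] by blast
  obtain B2 where B2: "finite B2" "basis_modulo loc_scale B2 UNIV (ideal_sum h g)"
    using finite_colength_basis[OF fcg] by blast
  have indep1: "\<forall>b\<in>S. c b = 0" if "S \<subseteq> B1" "(\<Sum>b\<in>S. loc_scale (c b) b) \<in> ideal_sum h f" for S c
    using basis_modulo_independentD[OF B1(2) _ that] finite_subset[OF that(1) B1(1)] by blast
  have indep2: "\<forall>b\<in>S. c b = 0" if "S \<subseteq> B2" "(\<Sum>b\<in>S. loc_scale (c b) b) \<in> ideal_sum h g" for S c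
    using basis_modulo_independentD[OF B2(2) _ that] finite_subset[OF that(1) B2(1)] by blast
  let ?V = "ideal_sum h (f * g)"
  have V_sub: "?V \<subseteq> ideal_sum h g"
  proof
    fix w assume "w \<in> ?V"
    then obtain a b where "w = h * a + f * g * b" by (auto simp: ideal_sum_iff)
    then have "w = h * a + g * (f * b)" by (simp add: ac_simps)
    then show "w \<in> ideal_sum h g" unfolding ideal_sum_iff by blast
  qed
  have cancel: "u \<in> ideal_sum h f" if gu: "g * u \<in> ?V" for u
  proof -
    obtain a b where "g * u = h * a + f * g * b" using gu by (auto simp: ideal_sum_iff)
    then have "g * (u - f * b) = h * a" by (simp add: algebra_simps)
    then have "h dvd g * (u - f * b)" by simp
    then have "h dvd u - f * b" using coprime_factor_dvd[OF fcg _ h] by blast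
    then obtain e where "u - f * b = h * e" by (elim dvdE)
    then have "u = h * e + f * b" by (simp add: algebra_simps)
    then show ?thesis unfolding ideal_sum_iff by blast
  qed
  have lift: "g * u \<in> ?V" if u: "u \<in> ideal_sum h f" for u
  proof -
    obtain a b where "u = h * a + f * b" using u by (auto simp: ideal_sum_iff)
    then have "g * u = h * (g * a) + f * g * b" by (simp add: algebra_simps)
    then show ?thesis unfolding ideal_sum_iff by blast
  qed
  have gV: "g * u \<in> ideal_sum h g" for u
  proof -
    have "g * u = h * 0 + g * u" by simp
    then show ?thesis unfolding ideal_sum_iff by blast
  qed
  have sc: "loc_scale c (g * b) = g * loc_scale c b" for c b by (simp add: loc_scale_def ac_simps)
  have inj: "inj_on ((*) g) B1" using g by (auto intro: inj_onI)
  have disj: "(*) g ` B1 \<inter> B2 = {}"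
  proof (rule ccontr)
    assume "(*) g ` B1 \<inter> B2 \<noteq> {}"
    then obtain x where "g * x \<in> B2" by auto
    then show False using indep2[of "{g * x}" "\<lambda>_. 1"] gV by simp
  qed
  define B where "B = (*) g ` B1 \<union> B2"
  have finB: "finite B" using B1 B2 by (simp add: B_def)
  have bas: "basis_modulo loc_scale B UNIV ?V"
    unfolding basis_modulo_def
  proof (intro conjI allI impI)
    fix S c assume S: "finite S" "S \<subseteq> B" "(\<Sum>b\<in>S. loc_scale (c b) b) \<in> ?V"
    define S1 where "S1 = {b \<in> B1. g * b \<in> S}"
    have S1: "S1 \<subseteq> B1" "S \<inter> (*) g ` B1 = (*) g ` S1" by (auto simp: S1_def)
    have "S = (S \<inter> B2) \<union> (S \<inter> (*) g ` B1)" using S by (auto simp: B_def)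
    then have "(\<Sum>b\<in>S. loc_scale (c b) b)
        = (\<Sum>b\<in>S \<inter> B2. loc_scale (c b) b) + (\<Sum>b\<in>S \<inter> (*) g ` B1. loc_scale (c b) b)"
      using sum.union_disjoint[of "S \<inter> B2" "S \<inter> (*) g ` B1" "\<lambda>b. loc_scale (c b) b"] S(1) disj
      by auto
    also have "(\<Sum>b\<in>S \<inter> (*) g ` B1. loc_scale (c b) b) = g * (\<Sum>b\<in>S1. loc_scale (c (g * b)) b)"
      unfolding S1(2) using inj_on_subset[OF inj S1(1)]
      by (subst sum.reindex) (auto simp: sc sum_distrib_left)
    finally have eq: "(\<Sum>b\<in>S. loc_scale (c b) b)
        = (\<Sum>b\<in>S \<inter> B2. loc_scale (c b) b) + g * (\<Sum>b\<in>S1. loc_scale (c (g * b)) b)" .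
    then have "(\<Sum>b\<in>S \<inter> B2. loc_scale (c b) b)
        = (\<Sum>b\<in>S. loc_scale (c b) b) - g * (\<Sum>b\<in>S1. loc_scale (c (g * b)) b)" by simp
    then have "(\<Sum>b\<in>S \<inter> B2. loc_scale (c b) b) \<in> ideal_sum h g"
      using S(3) V_sub gV loc_vs.subspace_diff[OF subspace_ideal_sum] by auto
    then have z2: "\<forall>b\<in>S \<inter> B2. c b = 0" by (intro indep2) auto
    then have "g * (\<Sum>b\<in>S1. loc_scale (c (g * b)) b) \<in> ?V" using eq S(3) by simp
    then have "(\<Sum>b\<in>S1. loc_scale (c (g * b)) b) \<in> ideal_sum h f" by (rule cancel)
    then have "\<forall>b\<in>S1. c (g * b) = 0" by (rule indep1[OF S1(1)])
    then show "\<forall>b\<in>S. c b = 0" using z2 S(2) S1(2) by (auto simp: B_def S1_def)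
  next
    show "UNIV \<subseteq> loc_vs.span (B \<union> ?V)"
    proof
      fix u :: local_ring
      have "u \<in> loc_vs.span (B2 \<union> ideal_sum h g)" using B2(2) by (auto simp: basis_modulo_def)
      then obtain s v where s: "u = s + v" "s \<in> loc_vs.span B2" "v \<in> loc_vs.span (ideal_sum h g)"
        by (auto simp: loc_vs.span_Un)
      have "v \<in> ideal_sum h g" using s(3) subspace_ideal_sum loc_vs.span_eq_iff by metis
      then obtain a b where v: "v = h * a + g * b" by (auto simp: ideal_sum_iff)
      have "b \<in> loc_vs.span (B1 \<union> ideal_sum h f)" using B1(2) by (auto simp: basis_modulo_def)
      then obtain s' v' where s': "b = s' + v'" "s' \<in> loc_vs.span B1" "v' \<in> loc_vs.span (ideal_sum h f)"
        by (auto simp: loc_vs.span_Un)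
      have "v' \<in> ideal_sum h f" using s'(3) subspace_ideal_sum loc_vs.span_eq_iff by metis
      then have "g * v' \<in> loc_vs.span (B \<union> ?V)" using lift by (intro loc_vs.span_base) auto
      moreover have "g * s' \<in> loc_vs.span (B \<union> ?V)" using s'(2)
      proof (induction rule: loc_vs.span_induct_alt)
        case base
        then show ?case by (simp add: loc_vs.span_zero)
      next
        case (step c x y)
        have "g * x \<in> loc_vs.span (B \<union> ?V)" using step by (intro loc_vs.span_base) (auto simp: B_def)
        then show ?case using step unfolding distrib_left sc[symmetric]
          by (intro loc_vs.span_add loc_vs.span_scale)
      qed
      moreover have "s \<in> loc_vs.span (B \<union> ?V)"
        using s(2) loc_vs.span_mono[of B2 "B \<union> ?V"] by (auto simp: B_def)
      moreover have "h * a \<in> loc_vs.span (B \<union> ?V)"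
      proof -
        have "h * a = h * a + f * g * 0" by simp
        then have "h * a \<in> ?V" unfolding ideal_sum_iff by blast
        then show ?thesis by (intro loc_vs.span_base) auto
      qed
      ultimately show "u \<in> loc_vs.span (B \<union> ?V)"
        unfolding s(1) v s'(1) distrib_left by (intro loc_vs.span_add)
    qed
  qed auto
  have "card B = card B1 + card B2"
    unfolding B_def using B1(1) B2(1) disj inj by (subst card_Un_disjoint) (auto simp: card_image)
  then show ?thesis
    unfolding intersection_number_multiples
    using loc_vs.quotient_dim_eq_card[OF subspace_ideal_sum finB bas]
      loc_vs.quotient_dim_eq_card[OF subspace_ideal_sum B1]
      loc_vs.quotient_dim_eq_card[OF subspace_ideal_sum B2] by simp
qed

lemma intersection_number_unit:
  assumes "f dvd 1"
  shows "intersection_number (multiples h) (multiples f) = 0"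
proof -
  obtain c where c: "1 = f * c" using assms by (elim dvdE)
  have "w \<in> ideal_sum h f" for w
  proof -
    have "w = h * 0 + f * (c * w)" using c by (metis mult.assoc mult_1 mult_zero_right add_0)
    then show ?thesis unfolding ideal_sum_iff by blast
  qed
  then have "ideal_sum h f = UNIV" by auto
  then have "basis_modulo loc_scale {} UNIV (ideal_sum h f)"
    by (auto simp: basis_modulo_def loc_vs.span_base)
  then show ?thesis unfolding intersection_number_multiples
    using loc_vs.quotient_dim_eq_card[OF subspace_ideal_sum, of "{}"] by simp
qed

lemma intersection_number_one: "intersection_number (multiples h) (multiples 1) = 0"
  by (rule intersection_number_unit) simp

lemma intersection_number_power:
  assumes "finite_colength h (f ^ n)" "h \<noteq> 0" "f \<noteq> 0"
  shows "intersection_number (multiples h) (multiples (f ^ n))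
       = n * intersection_number (multiples h) (multiples f)"
  using assms
proof (induction n)
  case (Suc n)
  have "finite_colength h (f ^ n)" using finite_colength_mono[OF Suc.prems(1), of h "f ^ n"] by simp
  then show ?case using intersection_number_mult[of h f "f ^ n"] Suc by simp
qed (simp add: intersection_number_one)

lemma intersection_number_prod:
  assumes "finite S" "finite_colength h (\<Prod>j\<in>S. f j)" "h \<noteq> 0" "\<And>j. j \<in> S \<Longrightarrow> f j \<noteq> 0"
  shows "intersection_number (multiples h) (multiples (\<Prod>j\<in>S. f j))
       = (\<Sum>j\<in>S. intersection_number (multiples h) (multiples (f j)))"
  using assms
proof (induction S rule: finite_induct)
  case (insert x S)
  have "finite_colength h (\<Prod>j\<in>S. f j)"
    using finite_colength_mono[OF insert.prems(1), of h "\<Prod>j\<in>S. f j"] insert.hyps by simp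
  then show ?case using intersection_number_mult[of h "f x" "\<Prod>j\<in>S. f j"] insert by simp
qed (simp add: intersection_number_one)

lemma germ_branches_eq: "germ_branches f = multiples ` {h. Factorial_Ring.irreducible h \<and> h dvd f}"
  by (auto simp: germ_branches_def multiples_def)

lemma multiples_eq_of_irreducible_dvd:
  fixes h q :: "'a::comm_semiring_1"
  assumes "Factorial_Ring.irreducible h" "Factorial_Ring.irreducible q" "h dvd q"
  shows "multiples h = multiples q"
proof -
  obtain w where w: "q = h * w" using assms by (elim dvdE)
  have "w dvd 1" using irreducibleD[OF assms(2) w] assms(1) by (auto simp: Factorial_Ring.irreducible_def)
  then have "q dvd h" unfolding w by (rule mult_unit_dvdI)
  then show ?thesis using assms(3) by (auto simp: multiples_def intro: dvd_trans)
qed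

text \<open>Irreducible factors are split off one at a time. As \<open>f\<close> is squarefree, the branch of the factor
  \<open>q\<close> is not a branch of the cofactor, so every branch is counted once, and additivity of
  intersection numbers applies.\<close>

lemma sum_over_germ_branches:
  assumes "f \<noteq> 0" and sqf: "\<And>q. Factorial_Ring.irreducible q \<Longrightarrow> \<not> q ^ 2 dvd f"
    and "finite_colength h f" and "h \<noteq> 0"
  shows "finite (germ_branches f) \<and>
    (\<Sum>\<delta>\<in>germ_branches f. intersection_number (multiples h) \<delta>)
      = intersection_number (multiples h) (multiples f)"
  using assms(1-3)
proof (induction "fps2_order f" arbitrary: f rule: less_induct)
  case less
  show ?case
  proof (cases "f dvd 1")
    case True
    then have "germ_branches f = {}"
      by (auto simp: germ_branches_eq Factorial_Ring.irreducible_def dest: dvd_trans)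
    then show ?thesis using intersection_number_unit[OF True] by simp
  next
    case False
    then obtain q where q: "Factorial_Ring.irreducible q" "q dvd f"
      using exists_irreducible_factor less.prems by blast
    then obtain f' where f': "f = q * f'" by (elim dvdE)
    have nz: "q \<noteq> 0" "f' \<noteq> 0" using f' less.prems by auto
    have "fps2_order f' < fps2_order f"
      unfolding f' using nz q(1) fps2_order_mult[OF nz] fps2_order_eq_0_iff[OF nz(1)]
      by (auto simp: Factorial_Ring.irreducible_def)
    moreover have "\<not> k ^ 2 dvd f'" if "Factorial_Ring.irreducible k" for k
      using less.prems(2)[OF that] unfolding f' by (meson dvd_mult)
    moreover have "finite_colength h f'"
      using finite_colength_mono[OF less.prems(3), of h f'] f' by simp
    ultimately have IH: "finite (germ_branches f')"
      "(\<Sum>\<delta>\<in>germ_branches f'. intersection_number (multiples h) \<delta>)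
        = intersection_number (multiples h) (multiples f')"
      using less.hyps[of f'] nz by auto
    have br: "germ_branches f = insert (multiples q) (germ_branches f')"
    proof (intro equalityI subsetI)
      fix \<delta> assume "\<delta> \<in> germ_branches f"
      then obtain k where k: "\<delta> = multiples k" "Factorial_Ring.irreducible k" "k dvd q * f'"
        by (auto simp: germ_branches_eq f')
      then have "k dvd q \<or> k dvd f'"
        using irreducible_fps_imp_prime_elem prime_elem_dvd_multD by blast
      then show "\<delta> \<in> insert (multiples q) (germ_branches f')"
        using k multiples_eq_of_irreducible_dvd[OF k(2) q(1)] by (auto simp: germ_branches_eq)
    next
      fix \<delta> assume "\<delta> \<in> insert (multiples q) (germ_branches f')"
      then show "\<delta> \<in> germ_branches f" using q by (auto simp: germ_branches_eq f' intro: dvd_mult)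
    qed
    have "multiples q \<notin> germ_branches f'"
    proof
      assume "multiples q \<in> germ_branches f'"
      then obtain k where "multiples q = multiples k" "k dvd f'" by (auto simp: germ_branches_eq)
      then have "q dvd f'" unfolding multiples_def by (metis dvd_refl dvd_trans mem_Collect_eq)
      then have "q ^ 2 dvd f" unfolding f' power2_eq_square by simp
      then show False using less.prems(2) q by blast
    qed
    then show ?thesis unfolding br using IH intersection_number_mult[of h q f'] less.prems(3) \<open>h \<noteq> 0\<close> nz
      by (simp add: f')
  qed
qed

section \<open>Ternary forms and elimination\<close>

lemma comm_ring_hom_poly_eval:
  assumes "comm_ring_hom (g :: 'a::comm_ring_1 \<Rightarrow> 'b::comm_ring_1)"
  shows "comm_ring_hom (\<lambda>q. poly (map_poly g q) y)"
proof -
  interpret comm_ring_hom g by fact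
  interpret m: map_poly_comm_ring_hom g ..
  show ?thesis
    by unfold_locales (simp_all add: m.hom_add m.hom_mult)
qed

lemma tri_eval_hom: "comm_ring_hom h \<Longrightarrow> comm_ring_hom (tri_eval h p)"
proof (cases p)
  case (fields x y z)
  assume "comm_ring_hom h"
  then show ?thesis unfolding fields tri_eval.simps[abs_def]
    by (intro comm_ring_hom_poly_eval)
qed

lemma loc_const_hom: "comm_ring_hom loc_const"
  by unfold_locales (simp_all add: loc_const_def)

lemma tri_const_hom: "comm_ring_hom tri_const"
  by unfold_locales (simp_all add: tri_const_def one_pCons)

lemma const_poly_hom: "comm_ring_hom (\<lambda>c. [:c:])"
  by unfold_locales (simp_all add: one_pCons)

lemma hom_poly_map_poly:
  assumes g: "comm_ring_hom (g :: 'b::comm_ring_1 \<Rightarrow> 'c::comm_ring_1)" and f: "f 0 = 0"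
  shows "g (poly (map_poly f p) x) = poly (map_poly (\<lambda>a. g (f a)) p) (g x)"
proof -
  interpret comm_ring_hom g by fact
  show ?thesis by (induction p) (simp_all add: map_poly_pCons f hom_add hom_mult)
qed

lemma hom_tri_eval:
  assumes g: "comm_ring_hom g" and h: "comm_ring_hom h"
  shows "g (tri_eval h (x, y, z) F) = tri_eval (\<lambda>c. g (h c)) (g x, g y, g z) F"
proof -
  interpret h: comm_ring_hom h by fact
  show ?thesis by (simp add: hom_poly_map_poly[OF g])
qed

definition var_x :: tripoly where "var_x = [:0, 1:]"
definition var_y :: tripoly where "var_y = [:[:0, 1:]:]"
definition var_z :: tripoly where "var_z = [:[:[:0, 1:]:]:]"

lemma poly_map_poly_const:
  fixes g :: "'a::comm_ring_1 \<Rightarrow> 'b::comm_ring_1"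
  shows "g 0 = 0 \<Longrightarrow> poly (map_poly g [:a:]) x = g a"
  by (cases "a = 0") (simp_all add: map_poly_pCons)

lemma tri_eval_var:
  assumes "comm_ring_hom h"
  shows "tri_eval h (x, y, z) var_x = x" "tri_eval h (x, y, z) var_y = y"
    "tri_eval h (x, y, z) var_z = z" "tri_eval h (x, y, z) (tri_const c) = h c"
proof -
  interpret h: comm_ring_hom h by fact
  show "tri_eval h (x, y, z) var_x = x" "tri_eval h (x, y, z) var_y = y"
    "tri_eval h (x, y, z) var_z = z" "tri_eval h (x, y, z) (tri_const c) = h c"
    by (simp_all add: var_x_def var_y_def var_z_def tri_const_def map_poly_pCons poly_map_poly_const)
qed

lemma tri_eval_identity: "tri_eval tri_const (var_x, var_y, var_z) F = F"
proof -
  have 1: "poly (map_poly tri_const r) var_z = [:[:r:]:]" for r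
    by (induction r) (simp_all add: map_poly_pCons tri_const_def var_z_def)
  have 2: "poly (map_poly (\<lambda>r. [:[:r:]:]) q) var_y = [:q:]" for q :: "complex poly poly"
    by (induction q) (simp_all add: map_poly_pCons var_y_def)
  have 3: "poly (map_poly (\<lambda>q. [:q:]) F) var_x = F"
    by (induction F) (simp_all add: map_poly_pCons var_x_def)
  show ?thesis by (simp add: 1 2 3)
qed

lemma poly_map_poly_sum:
  fixes g :: "'a::comm_ring_1 \<Rightarrow> 'b::comm_ring_1"
  assumes "g 0 = 0"
  shows "poly (map_poly g p) x = (\<Sum>i\<le>degree p. g (Polynomial.coeff p i) * x ^ i)"
proof -
  have "poly (map_poly g p) x = (\<Sum>i\<le>degree (map_poly g p). g (Polynomial.coeff p i) * x ^ i)"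
    by (simp add: poly_altdef coeff_map_poly assms)
  also have "\<dots> = (\<Sum>i\<le>degree p. g (Polynomial.coeff p i) * x ^ i)"
  proof (rule sum.mono_neutral_left)
    show "{..degree (map_poly g p)} \<subseteq> {..degree p}" using degree_map_poly_le[of g p] by auto
    show "\<forall>i\<in>{..degree p} - {..degree (map_poly g p)}. g (Polynomial.coeff p i) * x ^ i = 0"
      using coeff_eq_0[of "map_poly g p"] by (auto simp: coeff_map_poly assms not_le)
  qed auto
  finally show ?thesis .
qed

lemma tri_eval_scale:
  assumes h: "comm_ring_hom h" and F: "homogeneous d F"
  shows "tri_eval h (s * x, s * y, s * z) F = s ^ d * tri_eval h (x, y, z) F"
proof -
  interpret h: comm_ring_hom h by fact
  have exp: "tri_eval h (x, y, z) F = (\<Sum>i\<le>degree F. (\<Sum>j\<le>degree (Polynomial.coeff F i).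
      (\<Sum>k\<le>degree (Polynomial.coeff (Polynomial.coeff F i) j).
        h (Polynomial.coeff (Polynomial.coeff (Polynomial.coeff F i) j) k) * z ^ k) * y ^ j) * x ^ i)" for x y z
    by (simp add: poly_map_poly_sum)
  show ?thesis unfolding exp sum_distrib_left sum_distrib_right
  proof (intro sum.cong refl)
    fix i j k
    let ?c = "Polynomial.coeff (Polynomial.coeff (Polynomial.coeff F i) j) k"
    show "h ?c * (s * z) ^ k * (s * y) ^ j * (s * x) ^ i = s ^ d * (h ?c * z ^ k * y ^ j * x ^ i)"
    proof (cases "?c = 0")
      case False
      then have "d = i + j + k" using F by (simp add: homogeneous_def)
      then show ?thesis by (simp add: power_mult_distrib power_add algebra_simps)
    qed simp
  qed
qed

lemma homogeneous_mult:
  assumes "homogeneous d F" "homogeneous e G"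
  shows "homogeneous (d + e) (F * G)"
  unfolding homogeneous_def
proof (intro allI impI)
  fix i j k assume "Polynomial.coeff (Polynomial.coeff (Polynomial.coeff (F * G) i) j) k \<noteq> 0"
  then obtain i1 j1 k1 where "i1 \<le> i" "j1 \<le> j" "k1 \<le> k"
    "Polynomial.coeff (Polynomial.coeff (Polynomial.coeff F i1) j1) k1 *
     Polynomial.coeff (Polynomial.coeff (Polynomial.coeff G (i - i1)) (j - j1)) (k - k1) \<noteq> 0"
    by (fastforce simp: coeff_mult coeff_sum elim!: sum.not_neutral_contains_not_neutral)
  moreover from this have "i1 + j1 + k1 = d"
    using assms(1) unfolding homogeneous_def by (metis mult_zero_left)
  moreover from calculation have "(i - i1) + (j - j1) + (k - k1) = e"
    using assms(2) unfolding homogeneous_def by (metis mult_zero_right)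
  ultimately have "i1 + j1 + k1 = d" "(i - i1) + (j - j1) + (k - k1) = e" by auto
  then show "i + j + k = d + e" using \<open>i1 \<le> i\<close> \<open>j1 \<le> j\<close> \<open>k1 \<le> k\<close> by linarith
qed

lemma homogeneous_one: "homogeneous 0 1"
  by (auto simp: homogeneous_def coeff_1 split: if_splits)

lemma homogeneous_power: "homogeneous d F \<Longrightarrow> homogeneous (n * d) (F ^ n)"
  by (induction n) (auto simp: homogeneous_one intro: homogeneous_mult)

lemma homogeneous_prod:
  "finite S \<Longrightarrow> (\<And>j. j \<in> S \<Longrightarrow> homogeneous (d j) (F j)) \<Longrightarrow> homogeneous (\<Sum>j\<in>S. d j) (\<Prod>j\<in>S. F j)"
  by (induction S rule: finite_induct) (auto simp: homogeneous_one intro: homogeneous_mult)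

lemma homogeneous_unique:
  assumes "F \<noteq> 0" "homogeneous d F" "homogeneous e F"
  shows "d = e"
proof -
  obtain i where i: "Polynomial.coeff F i \<noteq> 0" using assms(1) by (meson leading_coeff_0_iff)
  obtain j where j: "Polynomial.coeff (Polynomial.coeff F i) j \<noteq> 0" using i by (meson leading_coeff_0_iff)
  obtain k where k: "Polynomial.coeff (Polynomial.coeff (Polynomial.coeff F i) j) k \<noteq> 0"
    using j by (meson leading_coeff_0_iff)
  show ?thesis using k assms(2,3) unfolding homogeneous_def by blast
qed

lemma form_degree_eq: "F \<noteq> 0 \<Longrightarrow> homogeneous d F \<Longrightarrow> form_degree F = d"
  unfolding form_degree_def using homogeneous_unique by (intro the_equality) auto

text \<open>The cofactor is an arbitrary polynomial, so degrees cannot be added directly. Substituting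
  \<open>(s x, s y, s z)\<close> for a new variable \<open>s\<close> turns \<open>F\<close> into \<open>s\<^sup>d F\<close> and \<open>G\<close> into \<open>s\<^sup>e G\<close>, and \<open>s\<^sup>d\<close> divides \<open>s\<^sup>e G\<close> only if
  \<open>d \<le> e\<close>.\<close>

lemma homogeneous_dvd_imp_le:
  assumes F: "homogeneous d F" and G: "homogeneous e G" and "F dvd G" "G \<noteq> 0"
  shows "d \<le> e"
proof (rule ccontr)
  assume "\<not> d \<le> e"
  define h where "h = (\<lambda>c. [:tri_const c:])"
  have hh: "comm_ring_hom h"
    unfolding h_def by unfold_locales (simp_all add: tri_const_def one_pCons)
  define s :: "tripoly poly" where "s = [:0, 1:]"
  define \<Theta> where "\<Theta> = tri_eval h (s * [:var_x:], s * [:var_y:], s * [:var_z:])"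
  have base: "tri_eval h ([:var_x:], [:var_y:], [:var_z:]) K = [:K:]" for K
    using hom_tri_eval[OF const_poly_hom tri_const_hom, of var_x var_y var_z K]
    by (simp add: tri_eval_identity h_def del: tri_eval.simps)
  interpret t: comm_ring_hom \<Theta> unfolding \<Theta>_def by (rule tri_eval_hom[OF hh])
  obtain Q where "G = F * Q" using assms by (elim dvdE)
  then have "\<Theta> G = \<Theta> F * \<Theta> Q" by (simp add: t.hom_mult)
  moreover have "\<Theta> G = s ^ e * [:G:]" "\<Theta> F = s ^ d * [:F:]"
    unfolding \<Theta>_def tri_eval_scale[OF hh F] tri_eval_scale[OF hh G] base by (rule refl)+
  ultimately have "s ^ e * [:G:] = s ^ e * (s ^ (d - e) * [:F:] * \<Theta> Q)"
    using \<open>\<not> d \<le> e\<close> by (simp add: mult.assoc power_add[symmetric] flip: mult.assoc)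
  moreover have "s ^ e \<noteq> 0" by (simp add: s_def)
  ultimately have "[:G:] = s ^ (d - e) * [:F:] * \<Theta> Q" by (meson mult_left_cancel)
  then have "poly [:G:] 0 = poly (s ^ (d - e) * [:F:] * \<Theta> Q) 0" by simp
  then have "G = 0" using \<open>\<not> d \<le> e\<close> by (simp add: s_def poly_power power_0_left)
  with \<open>G \<noteq> 0\<close> show False by simp
qed

text \<open>Let \<open>r\<close> be a nonzero element of least degree in the ideal generated by \<open>F\<close> and \<open>G\<close>. Pseudo-division
  by \<open>r\<close> leaves remainder zero on the whole ideal, so by Gauss's lemma the primitive part of \<open>r\<close> is
  a common divisor of \<open>F\<close> and \<open>G\<close>; coprimality makes \<open>r\<close> constant.\<close>

lemma elimination:
  fixes F G :: "'a::{factorial_ring_gcd,semiring_gcd_mult_normalize} poly"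
  assumes cop: "coprime F G"
  shows "\<exists>A B r. r \<noteq> 0 \<and> A * F + B * G = [:r:]"
proof -
  define J where "J = {A * F + B * G | A B. True}"
  have FJ: "F \<in> J" unfolding J_def by (intro CollectI exI[of _ 1] exI[of _ 0]) simp
  have GJ: "G \<in> J" unfolding J_def by (intro CollectI exI[of _ 0] exI[of _ 1]) simp
  have comb: "a * u - b * v \<in> J" if "u \<in> J" "v \<in> J" for a b u v
  proof -
    obtain A B A' B' where "u = A * F + B * G" "v = A' * F + B' * G" using \<open>u \<in> J\<close> \<open>v \<in> J\<close> by (auto simp: J_def)
    then have "a * u - b * v = (a * A - b * A') * F + (a * B - b * B') * G" by (simp add: algebra_simps)
    then show ?thesis unfolding J_def by blast
  qed
  \<comment> \<open>\<open>0\<close> and \<open>0\<close> are not coprime\<close>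
  have "\<exists>u. u \<in> J \<and> u \<noteq> 0" using FJ GJ cop by (metis coprime_0_left_iff not_is_unit_0)
  then obtain r where r: "r \<in> J" "r \<noteq> 0" and min: "\<And>u. u \<in> J \<Longrightarrow> u \<noteq> 0 \<Longrightarrow> degree r \<le> degree u"
    using ex_has_least_nat[of "\<lambda>u. u \<in> J \<and> u \<noteq> 0" _ degree] by blast
  have dv: "primitive_part r dvd u" if u: "u \<in> J" for u
  proof (cases "u = 0")
    case False
    obtain a q where aq: "a \<noteq> 0" "Polynomial.smult a u = r * q + pseudo_mod u r"
      using pseudo_mod(1)[OF r(2)] by blast
    have "pseudo_mod u r = [:a:] * u - q * r" using aq(2) by simp
    then have "pseudo_mod u r \<in> J" using comb u r by metis
    then have "pseudo_mod u r = 0" using pseudo_mod(2)[OF r(2), of u] min by fastforce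
    then have "Polynomial.smult a u = r * q" using aq by simp
    then have "primitive_part r * primitive_part q = Polynomial.smult (unit_factor a) (primitive_part u)"
      by (metis primitive_part_mult primitive_part_smult)
    then have "primitive_part r dvd Polynomial.smult (unit_factor a) (primitive_part u)" by (metis dvdI)
    moreover obtain e where "1 = unit_factor a * e" using aq(1) by (metis dvdE unit_factor_is_unit)
    then have "primitive_part u = Polynomial.smult e (Polynomial.smult (unit_factor a) (primitive_part u))"
      by (simp add: mult.commute)
    ultimately have "primitive_part r dvd primitive_part u" by (metis dvd_smult)
    then show ?thesis by (metis content_times_primitive_part dvd_smult)
  qed simp
  then have "is_unit (primitive_part r)" using FJ GJ cop by (meson coprime_common_divisor)
  then have "degree r = 0" by (metis degree_primitive_part is_unit_poly_iff degree_pCons_0)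
  then obtain c where "r = [:c:]" by (meson degree_eq_zeroE)
  moreover from this have "c \<noteq> 0" using r(2) by auto
  moreover obtain A B where "r = A * F + B * G" using r(1) by (auto simp: J_def)
  ultimately show ?thesis by metis
qed

section \<open>Coprime forms at a point of the plane\<close>

fun scaled :: "'r::comm_ring_1 \<Rightarrow> 'r \<times> 'r \<times> 'r \<Rightarrow> 'r \<times> 'r \<times> 'r" where
  "scaled s (x, y, z) = (s * x, s * y, s * z)"

definition constant_term :: "local_ring \<Rightarrow> complex" where
  "constant_term u = fps_nth (fps_nth u 0) 0"

lemma constant_term_hom: "comm_ring_hom constant_term"
  by unfold_locales (simp_all add: constant_term_def)

lemma local_unit_iff: "u dvd 1 \<longleftrightarrow> constant_term u \<noteq> 0"
  by (simp add: is_unit_fps_iff constant_term_def)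

lemma constant_term_simps [simp]:
  "constant_term (loc_const c) = c" "constant_term loc_X = 0" "constant_term loc_Y = 0"
  by (simp_all add: constant_term_def loc_const_def loc_X_def loc_Y_def)

text \<open>Let \<open>N\<close> be the order of the root \<open>c\<close> of \<open>p\<close>. The remaining factor of \<open>p\<close> does not vanish at \<open>c\<close>, so
  its value at \<open>c + t\<close> has a nonzero constant term.\<close>

lemma poly_at_local_parameter:
  assumes "p \<noteq> 0" "constant_term t = 0"
  shows "\<exists>N v. v dvd 1 \<and> poly (map_poly loc_const p) (loc_const c + t) = t ^ N * v"
proof -
  obtain q where q: "p = [:- c, 1:] ^ Polynomial.order c p * q" "\<not> [:- c, 1:] dvd q"
    using order_decomp[OF assms(1)] by blast
  define E where "E = (\<lambda>q. poly (map_poly loc_const q) (loc_const c + t))"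
  interpret l: comm_ring_hom loc_const by (rule loc_const_hom)
  interpret e: comm_ring_hom E unfolding E_def by (rule comm_ring_hom_poly_eval[OF loc_const_hom])
  interpret ct: comm_ring_hom constant_term by (rule constant_term_hom)
  have Et: "E [:- c, 1:] = t" by (simp add: E_def map_poly_pCons l.hom_uminus)
  have "constant_term (E q) = poly q c"
    unfolding E_def using hom_poly_map_poly[OF constant_term_hom, of loc_const q "loc_const c + t"]
    by (simp add: ct.hom_add assms(2) map_poly_id')
  then have "E q dvd 1" using q(2) by (simp add: local_unit_iff poly_eq_0_iff_dvd)
  moreover have "E p = t ^ Polynomial.order c p * E q"
    by (subst q(1)) (simp only: e.hom_mult e.hom_power Et)
  ultimately show ?thesis unfolding E_def by blast
qed

text \<open>Homogeneity as far as it is visible at one evaluation point. Unlike \<^const>\<open>homogeneous\<close> it is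
  evidently compatible with permuting the three coordinates.\<close>

definition scales :: "local_ring \<times> local_ring \<times> local_ring \<Rightarrow> tripoly \<Rightarrow> bool" where
  "scales p F \<longleftrightarrow> (\<exists>d. \<forall>s. tri_eval loc_const (scaled (loc_const s) p) F
      = loc_const s ^ d * tri_eval loc_const p F)"

text \<open>The local function \<open>t\<close> lies in the radical of every ideal generated by the germs of two coprime
  forms.\<close>

definition separates :: "local_ring \<times> local_ring \<times> local_ring \<Rightarrow> local_ring \<Rightarrow> bool" where
  "separates p t \<longleftrightarrow> (\<forall>F G. coprime F G \<longrightarrow> scales p F \<longrightarrow> scales p G \<longrightarrow>
     (\<exists>N. t ^ N \<in> ideal_sum (tri_eval loc_const p F) (tri_eval loc_const p G)))"

text \<open>Eliminating the first variable gives a nonzero \<open>r(y, z)\<close> in the ideal of the two forms. Its value at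
  \<open>(1, c + t)\<close> could vanish, but by homogeneity the evaluation may take place at any multiple \<open>s\<close>
  of the point. For all but finitely many \<open>s\<close> the polynomial \<open>r(s, z)\<close> is nonzero, and then
  \<open>r(s, s (c + t))\<close> is a power of \<open>t\<close> times a unit.\<close>

lemma separates_base:
  assumes t: "constant_term t = 0"
  shows "separates (a, 1, loc_const c + t) t"
  unfolding separates_def
proof (intro allI impI)
  fix F G :: tripoly
  let ?p = "(a, 1, loc_const c + t)"
  assume cop: "coprime F G" and F: "scales ?p F" and G: "scales ?p G"
  obtain A B r where r: "r \<noteq> 0" "A * F + B * G = [:r:]" using elimination[OF cop] by blast
  obtain d where d: "\<And>s. tri_eval loc_const (scaled (loc_const s) ?p) F
      = loc_const s ^ d * tri_eval loc_const ?p F" using F unfolding scales_def by blast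
  obtain e where e: "\<And>s. tri_eval loc_const (scaled (loc_const s) ?p) G
      = loc_const s ^ e * tri_eval loc_const ?p G" using G unfolding scales_def by blast
  have "finite {u. poly r u = 0}" using poly_roots_finite[OF r(1)] .
  then have "finite ((\<lambda>s::complex. [:s:]) -` {u. poly r u = 0})"
    by (intro finite_vimageI) (auto intro: injI)
  then have "finite (insert 0 {s::complex. poly r [:s:] = 0})" by (simp add: vimage_def)
  then obtain s :: complex where s: "s \<noteq> 0" "poly r [:s:] \<noteq> 0"
    using ex_new_if_finite[OF infinite_UNIV_char_0, of "insert 0 {s::complex. poly r [:s:] = 0}"] by auto
  interpret l: comm_ring_hom loc_const by (rule loc_const_hom)
  interpret ct: comm_ring_hom constant_term by (rule constant_term_hom)
  define \<Theta> where "\<Theta> = tri_eval loc_const (scaled (loc_const s) ?p)"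
  interpret th: comm_ring_hom \<Theta> unfolding \<Theta>_def by (rule tri_eval_hom[OF loc_const_hom])
  define w where "w = loc_const (s * c) + loc_const s * t"
  define E where "E = (\<lambda>q. poly (map_poly loc_const q) w)"
  have Eh: "comm_ring_hom E" unfolding E_def by (rule comm_ring_hom_poly_eval[OF loc_const_hom])
  interpret e: comm_ring_hom E by (rule Eh)
  have w: "loc_const s * (loc_const c + t) = w" by (simp add: w_def l.hom_mult algebra_simps)
  have Es: "E [:s:] = loc_const s" unfolding E_def by (rule poly_map_poly_const) simp
  obtain N v where Nv: "v dvd 1" "E (poly r [:s:]) = (loc_const s * t) ^ N * v"
    using poly_at_local_parameter[OF s(2), of "loc_const s * t" "s * c"] t
    unfolding E_def w_def by (auto simp: ct.hom_mult)
  have "\<Theta> [:r:] = poly (map_poly E r) (loc_const s)"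
    unfolding \<Theta>_def scaled.simps tri_eval.simps w E_def[symmetric]
    by (subst poly_map_poly_const) simp_all
  also have "\<dots> = E (poly r [:s:])"
    using hom_poly_map_poly[OF Eh, of "\<lambda>x. x" r "[:s:]"] by (simp add: Es map_poly_id')
  also note Nv(2)
  finally have 1: "\<Theta> A * (loc_const s ^ d * tri_eval loc_const ?p F) + \<Theta> B * (loc_const s ^ e * tri_eval loc_const ?p G)
      = t ^ N * (loc_const s ^ N * v)"
    unfolding r(2)[symmetric] th.hom_add th.hom_mult
    unfolding \<Theta>_def d e by (simp add: power_mult_distrib ac_simps del: tri_eval.simps)
  have "loc_const s ^ N * v dvd 1" using s(1) Nv(1) by (simp add: local_unit_iff ct.hom_mult ct.hom_power)
  then obtain z where z: "1 = loc_const s ^ N * v * z" by (elim dvdE)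
  have "t ^ N = t ^ N * (loc_const s ^ N * v) * z" using z by (simp add: mult.assoc)
  also have "\<dots> = tri_eval loc_const ?p F * (\<Theta> A * loc_const s ^ d * z) + tri_eval loc_const ?p G * (\<Theta> B * loc_const s ^ e * z)"
    unfolding 1[symmetric] by (simp add: algebra_simps del: tri_eval.simps)
  finally show "\<exists>N. t ^ N \<in> ideal_sum (tri_eval loc_const ?p F) (tri_eval loc_const ?p G)"
    unfolding ideal_sum_iff by blast
qed

lemma coprime_involution:
  assumes "comm_ring_hom g" "\<And>x. g (g x) = x" "coprime F G"
  shows "coprime (g F) (g G)"
proof (rule coprimeI)
  interpret comm_ring_hom g by fact
  fix d assume "d dvd g F" "d dvd g G"
  then have "g d dvd F" "g d dvd G" using hom_dvd assms(2) by metis+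
  then have "g d dvd 1" using assms(3) coprime_common_divisor by blast
  then have "g (g d) dvd g 1" by (rule hom_dvd)
  then show "d dvd 1" using assms(2) by simp
qed

text \<open>Permutations of the variables are automorphisms of the polynomial ring, so they preserve
  coprimality.\<close>

lemma separates_permute:
  fixes \<sigma> :: "tripoly \<Rightarrow> tripoly"
  assumes "comm_ring_hom \<sigma>" "\<And>x. \<sigma> (\<sigma> x) = x"
    and ev: "\<And>F. tri_eval loc_const p (\<sigma> F) = tri_eval loc_const q F"
    and evs: "\<And>F s. tri_eval loc_const (scaled s p) (\<sigma> F) = tri_eval loc_const (scaled s q) F"
    and sep: "separates p t"
  shows "separates q t"
  unfolding separates_def
proof (intro allI impI)
  fix F G assume "coprime F G" "scales q F" "scales q G"
  then have "coprime (\<sigma> F) (\<sigma> G)" "scales p (\<sigma> F)" "scales p (\<sigma> G)"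
    using coprime_involution[OF assms(1,2)] by (simp_all add: scales_def ev evs del: tri_eval.simps)
  then show "\<exists>N. t ^ N \<in> ideal_sum (tri_eval loc_const q F) (tri_eval loc_const q G)"
    using sep unfolding separates_def ev[symmetric] by blast
qed

definition swap_xy :: "tripoly \<Rightarrow> tripoly" where "swap_xy = tri_eval tri_const (var_y, var_x, var_z)"
definition swap_yz :: "tripoly \<Rightarrow> tripoly" where "swap_yz = tri_eval tri_const (var_x, var_z, var_y)"

lemma tri_eval_swap:
  assumes h: "comm_ring_hom h"
  shows "tri_eval h (a, b, c) (swap_xy F) = tri_eval h (b, a, c) F"
    "tri_eval h (a, b, c) (swap_yz F) = tri_eval h (a, c, b) F"
  unfolding swap_xy_def swap_yz_def hom_tri_eval[OF tri_eval_hom[OF h] tri_const_hom] tri_eval_var[OF h]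
  by (rule refl)+

lemma swap_involution: "swap_xy (swap_xy F) = F" "swap_yz (swap_yz F) = F"
  using tri_eval_swap[OF tri_const_hom] tri_eval_identity unfolding swap_xy_def swap_yz_def by metis+

lemma separates_swap_xy: "separates (a, b, c) t \<Longrightarrow> separates (b, a, c) t"
  by (rule separates_permute[of swap_xy])
     (auto simp: swap_xy_def[abs_def] tri_eval_hom[OF tri_const_hom] swap_involution[unfolded swap_xy_def]
        tri_eval_swap[OF loc_const_hom, unfolded swap_xy_def] simp del: tri_eval.simps)

lemma separates_swap_yz: "separates (a, b, c) t \<Longrightarrow> separates (a, c, b) t"
  by (rule separates_permute[of swap_yz])
     (auto simp: swap_yz_def[abs_def] tri_eval_hom[OF tri_const_hom] swap_involution[unfolded swap_yz_def]
        tri_eval_swap[OF loc_const_hom, unfolded swap_yz_def] simp del: tri_eval.simps)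

text \<open>Transpositions of the coordinates carry a triple \<open>(a, 1, c + t)\<close> into each of the three kinds of
  affine charts, for either of the two local coordinates \<open>t\<close>.\<close>

lemma separates_chart: "separates (chart P) loc_X \<and> separates (chart P) loc_Y"
proof (cases P)
  case (fields x y z)
  have zero: "loc_const 0 = 0" by (simp add: loc_const_def)
  have base: "separates (a, 1, loc_const c + loc_X) loc_X" "separates (a, 1, loc_const c + loc_Y) loc_Y"
    "separates (a, 1, loc_X) loc_X" "separates (a, 1, loc_Y) loc_Y" for a c
    using separates_base[of loc_X a c] separates_base[of loc_Y a c]
      separates_base[of loc_X a 0] separates_base[of loc_Y a 0] by (simp_all add: zero)
  consider "x \<noteq> 0" | "x = 0" "y \<noteq> 0" | "x = 0" "y = 0" by blast
  then show ?thesis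
  proof cases
    case 1
    have "separates (1, loc_const y + loc_X, loc_const z + loc_Y) loc_X"
      by (rule separates_swap_yz, rule separates_swap_xy) (rule base)
    moreover have "separates (1, loc_const y + loc_X, loc_const z + loc_Y) loc_Y"
      by (rule separates_swap_xy) (rule base)
    ultimately show ?thesis using 1 fields by simp
  next
    case 2
    have "separates (loc_X, 1, loc_const z + loc_Y) loc_X"
      by (rule separates_swap_xy, rule separates_swap_yz, rule separates_swap_xy) (rule base)
    then show ?thesis using 2 fields base by simp
  next
    case 3
    have "separates (loc_X, loc_Y, 1) loc_X"
      by (rule separates_swap_yz, rule separates_swap_xy, rule separates_swap_yz, rule separates_swap_xy) (rule base)
    moreover have "separates (loc_X, loc_Y, 1) loc_Y"
      by (rule separates_swap_yz) (rule base)
    ultimately show ?thesis using 3 fields by simp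
  qed
qed

lemma homogeneous_scales: "homogeneous d F \<Longrightarrow> scales p F"
  using tri_eval_scale[OF loc_const_hom, of d F] unfolding scales_def by (cases p) (auto simp del: tri_eval.simps)

text \<open>The local form of the fact that curves without common component meet in isolated points.\<close>

lemma coprime_forms_finite_colength:
  assumes "coprime F G" "homogeneous d F" "homogeneous e G"
  shows "finite_colength (local_eq P F) (local_eq P G)"
proof -
  obtain N M where "loc_X ^ N \<in> ideal_sum (local_eq P F) (local_eq P G)"
    "loc_Y ^ M \<in> ideal_sum (local_eq P F) (local_eq P G)"
    using separates_chart[of P] assms homogeneous_scales unfolding separates_def local_eq_def by blast
  then have "loc_X ^ M * loc_X ^ N \<in> ideal_sum (local_eq P F) (local_eq P G)"
    "loc_Y ^ N * loc_Y ^ M \<in> ideal_sum (local_eq P F) (local_eq P G)"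
    by (auto intro: ideal_sum_mult)
  then have "loc_X ^ (M + N) \<in> ideal_sum (local_eq P F) (local_eq P G)"
    "loc_Y ^ (M + N) \<in> ideal_sum (local_eq P F) (local_eq P G)"
    by (simp_all add: power_add mult.commute)
  then show ?thesis unfolding finite_colength_iff by blast
qed

lemma local_eq_hom: "comm_ring_hom (local_eq P)"
  unfolding local_eq_def by (rule tri_eval_hom[OF loc_const_hom])

lemma finite_colength_imp_not_dvd:
  assumes "finite_colength h g" "\<not> h dvd 1" "h \<noteq> 0"
  shows "\<not> h dvd g"
proof
  assume "h dvd g"
  then obtain N a b a' b' where N: "loc_X ^ N = h * a + g * b" "loc_Y ^ N = h * a' + g * b'"
    using assms(1) unfolding finite_colength_def by blast
  then have "h dvd loc_X ^ N * 1" "h dvd loc_Y ^ N * 1" using \<open>h dvd g\<close> by (auto intro: dvd_mult2)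
  then have "h dvd 1" using dvd_of_X_Y_power_mult assms(3) by blast
  with assms(2) show False by simp
qed

section \<open>Irreducible forms are locally squarefree\<close>

text \<open>Derivations serve to detect multiple factors: a square dividing \<open>u\<close> leaves a factor in \<open>D u\<close>.\<close>

definition derivation :: "('r::comm_ring_1 \<Rightarrow> 'r) \<Rightarrow> bool" where
  "derivation D \<longleftrightarrow> (\<forall>u v. D (u + v) = D u + D v) \<and> (\<forall>u v. D (u * v) = D u * v + u * D v)"

lemma derivation_zero: "derivation D \<Longrightarrow> D 0 = 0"
  unfolding derivation_def by (metis add_cancel_right_right)

lemma poly_map_poly_pCons:
  fixes g :: "'a::comm_ring_1 \<Rightarrow> 'b::comm_ring_1"
  shows "g 0 = 0 \<Longrightarrow> poly (map_poly g (pCons a q)) y = g a + y * poly (map_poly g q) y"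
  by (cases "a = 0 \<and> q = 0") (auto simp: map_poly_pCons)

lemma derivation_poly_map_poly:
  assumes D: "derivation D" and g: "comm_ring_hom g" and Dg: "\<And>r. D (g r) = g' r"
  shows "D (poly (map_poly g q) y) = poly (map_poly g' q) y + poly (map_poly g (pderiv q)) y * D y"
proof -
  interpret g: comm_ring_hom g by fact
  interpret m: map_poly_comm_ring_hom g ..
  have g'0: "g' 0 = 0" using Dg[of 0] derivation_zero[OF D] by simp
  have D_add: "D (u + v) = D u + D v" and D_mult: "D (u * v) = D u * v + u * D v" for u v
    using D by (auto simp: derivation_def)
  show ?thesis
  proof (induction q)
    case 0
    then show ?case by (simp add: derivation_zero[OF D])
  next
    case (pCons a q)
    have "D (poly (map_poly g (pCons a q)) y)
      = g' a + D y * poly (map_poly g q) y + y * D (poly (map_poly g q) y)"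
      using pCons.hyps by (simp add: map_poly_pCons D_add D_mult Dg algebra_simps)
    also have "\<dots> = poly (map_poly g' (pCons a q)) y + poly (map_poly g (pderiv (pCons a q))) y * D y"
      unfolding pCons.IH pderiv_pCons m.hom_add
      by (simp add: poly_map_poly_pCons g'0 algebra_simps)
    finally show ?case .
  qed
qed

lemma poly_map_poly_add:
  assumes "g 0 = 0" "k 0 = 0"
  shows "poly (map_poly (\<lambda>r. g r + k r) q) y = poly (map_poly g q) y + (poly (map_poly k q) y :: 'b::comm_ring_1)"
  by (induction q) (simp_all add: map_poly_pCons assms algebra_simps)

lemma poly_map_poly_mult_right:
  assumes "k 0 = 0"
  shows "poly (map_poly (\<lambda>r. k r * e) q) y = poly (map_poly k q) y * (e :: 'b::comm_ring_1)"
  by (induction q) (simp_all add: map_poly_pCons assms algebra_simps)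

lemma map_poly_comp: "g 0 = 0 \<Longrightarrow> map_poly (\<lambda>r. g (f r)) q = map_poly g (map_poly f q)" if "f 0 = 0"
  by (rule poly_eqI) (simp add: coeff_map_poly that)

text \<open>The chain rule, obtained by treating the three nested polynomial layers one after the other.\<close>

lemma derivation_tri_eval:
  assumes D: "derivation D" and h: "comm_ring_hom h" and Dh: "\<And>c. D (h c) = 0"
  shows "D (tri_eval h (x, y, z) F) = tri_eval h (x, y, z) (pderiv F) * D x
     + tri_eval h (x, y, z) (map_poly pderiv F) * D y
     + tri_eval h (x, y, z) (map_poly (map_poly pderiv) F) * D z"
proof -
  interpret h: comm_ring_hom h by fact
  define E1 where "E1 = (\<lambda>r. poly (map_poly h r) z)"
  define E2 where "E2 = (\<lambda>q. poly (map_poly E1 q) y)"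
  have h1: "comm_ring_hom E1" unfolding E1_def by (rule comm_ring_hom_poly_eval[OF h])
  have h2: "comm_ring_hom E2" unfolding E2_def by (rule comm_ring_hom_poly_eval[OF h1])
  interpret e1: comm_ring_hom E1 by (rule h1)
  interpret e2: comm_ring_hom E2 by (rule h2)
  have "poly (map_poly (\<lambda>_. 0) r) z = 0" for r :: "complex poly"
    by (induction r) (simp_all add: map_poly_pCons)
  then have D1: "D (E1 r) = E1 (pderiv r) * D z" for r
    unfolding E1_def derivation_poly_map_poly[OF D h Dh] by simp
  have D2: "D (E2 q) = E2 (map_poly pderiv q) * D z + E2 (pderiv q) * D y" for q
    unfolding E2_def derivation_poly_map_poly[OF D h1 D1]
    by (simp add: poly_map_poly_mult_right map_poly_comp[of pderiv E1])
  have "D (poly (map_poly E2 F) x) = poly (map_poly E2 (map_poly (map_poly pderiv) F)) x * D z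
      + poly (map_poly E2 (map_poly pderiv F)) x * D y + poly (map_poly E2 (pderiv F)) x * D x"
    unfolding derivation_poly_map_poly[OF D h2 D2]
    by (simp add: poly_map_poly_add poly_map_poly_mult_right map_poly_comp[of pderiv E2] map_poly_comp[of "map_poly pderiv" E2])
  then show ?thesis by (simp add: E1_def E2_def algebra_simps)
qed

definition loc_DX :: "local_ring \<Rightarrow> local_ring" where "loc_DX u = Abs_fps (\<lambda>n. fps_deriv (fps_nth u n))"
definition loc_DY :: "local_ring \<Rightarrow> local_ring" where "loc_DY u = fps_deriv u"

lemma derivation_DX: "derivation loc_DX"
proof -
  have "loc_DX (u * v) = loc_DX u * v + u * loc_DX v" for u v
  proof (rule fps_ext)
    fix n
    have "fps_deriv (\<Sum>i=0..n. fps_nth u i * fps_nth v (n - i))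
        = (\<Sum>i=0..n. fps_deriv (fps_nth u i * fps_nth v (n - i)))"
      by (rule fps_deriv_sum)
    then show "fps_nth (loc_DX (u * v)) n = fps_nth (loc_DX u * v + u * loc_DX v) n"
      by (simp add: loc_DX_def fps_mult_nth sum.distrib add.commute)
  qed
  moreover have "loc_DX (u + v) = loc_DX u + loc_DX v" for u v
    by (rule fps_ext) (simp add: loc_DX_def)
  ultimately show ?thesis by (simp add: derivation_def)
qed

lemma derivation_DY: "derivation loc_DY"
  by (simp add: derivation_def loc_DY_def algebra_simps)

lemma loc_D_simps:
  "loc_DX (loc_const c) = 0" "loc_DX loc_X = 1" "loc_DX loc_Y = 0" "loc_DX 1 = 0"
  "loc_DY (loc_const c) = 0" "loc_DY loc_X = 0" "loc_DY loc_Y = 1" "loc_DY 1 = 0"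
  by (auto simp: loc_DX_def loc_DY_def loc_const_def loc_X_def loc_Y_def fps_eq_iff)

lemma euler_identity:
  assumes "homogeneous d F"
  shows "var_x * pderiv F + var_y * map_poly pderiv F + var_z * map_poly (map_poly pderiv) F = of_nat d * F"
proof -
  have x: "Polynomial.coeff (var_x * G) i = (if i = 0 then 0 else Polynomial.coeff G (i - 1))" for G i
    by (simp add: var_x_def coeff_pCons split: nat.split)
  have y: "Polynomial.coeff (Polynomial.coeff (var_y * G) i) j
      = (if j = 0 then 0 else Polynomial.coeff (Polynomial.coeff G i) (j - 1))" for G i j
    by (simp add: var_y_def coeff_pCons split: nat.split)
  have z: "Polynomial.coeff (Polynomial.coeff (Polynomial.coeff (var_z * G) i) j) k
      = (if k = 0 then 0 else Polynomial.coeff (Polynomial.coeff (Polynomial.coeff G i) j) (k - 1))" for G i j k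
    by (simp add: var_z_def coeff_pCons split: nat.split)
  show ?thesis
  proof (intro poly_eqI)
    fix i j k
    let ?c = "Polynomial.coeff (Polynomial.coeff (Polynomial.coeff F i) j) k"
    have 1: "Polynomial.coeff (Polynomial.coeff (Polynomial.coeff (var_x * pderiv F) i) j) k = of_nat i * ?c"
      by (cases i) (simp_all add: x coeff_pderiv of_nat_poly flip: of_nat_Suc)
    have 2: "Polynomial.coeff (Polynomial.coeff (Polynomial.coeff (var_y * map_poly pderiv F) i) j) k = of_nat j * ?c"
      by (cases j) (simp_all add: y coeff_map_poly coeff_pderiv of_nat_poly flip: of_nat_Suc)
    have 3: "Polynomial.coeff (Polynomial.coeff (Polynomial.coeff (var_z * map_poly (map_poly pderiv) F) i) j) k = of_nat k * ?c"
      by (cases k) (simp_all add: z coeff_map_poly coeff_pderiv flip: of_nat_Suc)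
    have 4: "Polynomial.coeff (Polynomial.coeff (Polynomial.coeff (of_nat d * F) i) j) k = of_nat d * ?c"
      by (simp add: of_nat_poly)
    have "?c \<noteq> 0 \<Longrightarrow> d = i + j + k" using assms by (auto simp: homogeneous_def)
    then show "Polynomial.coeff (Polynomial.coeff (Polynomial.coeff (var_x * pderiv F + var_y * map_poly pderiv F
        + var_z * map_poly (map_poly pderiv) F) i) j) k = Polynomial.coeff (Polynomial.coeff (Polynomial.coeff (of_nat d * F) i) j) k"
      unfolding coeff_add 1 2 3 4 by (cases "?c = 0") (simp_all add: distrib_right)
  qed
qed

lemma homogeneous_partials:
  assumes "homogeneous d F"
  shows "homogeneous (d - 1) (pderiv F)" "homogeneous (d - 1) (map_poly pderiv F)"
    "homogeneous (d - 1) (map_poly (map_poly pderiv) F)"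
proof -
  have *: "Polynomial.coeff (Polynomial.coeff (Polynomial.coeff F i) j) k \<noteq> 0 \<Longrightarrow> i + j + k = d" for i j k
    using assms unfolding homogeneous_def by blast
  show "homogeneous (d - 1) (pderiv F)" unfolding homogeneous_def
    by (auto simp: coeff_pderiv of_nat_poly simp flip: of_nat_Suc dest!: *)
  show "homogeneous (d - 1) (map_poly pderiv F)" unfolding homogeneous_def
    by (auto simp: coeff_map_poly coeff_pderiv of_nat_poly simp flip: of_nat_Suc dest!: *)
  show "homogeneous (d - 1) (map_poly (map_poly pderiv) F)" unfolding homogeneous_def
    by (auto simp: coeff_map_poly coeff_pderiv of_nat_poly simp flip: of_nat_Suc dest!: *)
qed

lemma homogeneous_0_imp_const: "homogeneous 0 F \<Longrightarrow> \<exists>c. F = tri_const c"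
proof -
  assume F: "homogeneous 0 F"
  have "F = tri_const (Polynomial.coeff (Polynomial.coeff (Polynomial.coeff F 0) 0) 0)"
  proof (intro poly_eqI)
    fix i j k
    have "Polynomial.coeff (Polynomial.coeff (Polynomial.coeff F i) j) k \<noteq> 0 \<Longrightarrow> i + j + k = 0"
      using F unfolding homogeneous_def by blast
    then show "Polynomial.coeff (Polynomial.coeff (Polynomial.coeff F i) j) k
      = Polynomial.coeff (Polynomial.coeff (Polynomial.coeff (tri_const (Polynomial.coeff (Polynomial.coeff (Polynomial.coeff F 0) 0) 0)) i) j) k"
      by (auto simp: tri_const_def coeff_pCons split: nat.split)
  qed
  then show ?thesis by blast
qed

lemma tri_const_unit: "c \<noteq> 0 \<Longrightarrow> tri_const c dvd 1"
  by (simp add: tri_const_def is_unit_const_poly_iff)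

lemma irreducible_form_prime:
  fixes F :: tripoly
  shows "Factorial_Ring.irreducible F \<Longrightarrow> prime_elem F"
  by (rule irreducible_imp_prime_elem)

lemma square_dvd_derivation:
  assumes "derivation D" "q ^ 2 dvd u"
  shows "q dvd D u"
proof -
  obtain w where "u = q * (q * w)" using assms(2) by (auto simp: power2_eq_square mult.assoc elim: dvdE)
  moreover have "D (q * (q * w)) = D q * (q * w) + q * D (q * w)"
    using assms(1) by (simp add: derivation_def)
  ultimately show ?thesis by simp
qed

text \<open>A multiple factor \<open>q\<close> of the germ of \<open>F\<close> divides the germs of all three partial derivatives: two of
  them are reached by differentiating in the chart, and the one belonging to the coordinate
  normalised to \<open>1\<close> by Euler's identity. Some partial derivative is nonzero, and having smaller degree
  it is coprime to \<open>F\<close>, so its germ has no factor in common with that of \<open>F\<close>.\<close>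

lemma irreducible_form_locally_squarefree:
  assumes irr: "Factorial_Ring.irreducible F" and hom: "homogeneous d F"
    and q: "Factorial_Ring.irreducible q" and sq: "q ^ 2 dvd local_eq P F"
  shows False
proof -
  interpret l: comm_ring_hom "local_eq P" by (rule local_eq_hom)
  obtain x y z where P: "chart P = (x, y, z)" by (cases "chart P")
  have chain: "D (local_eq P F) = local_eq P (pderiv F) * D x
     + local_eq P (map_poly pderiv F) * D y + local_eq P (map_poly (map_poly pderiv) F) * D z"
    if "derivation D" "\<And>c. D (loc_const c) = 0" for D
    unfolding local_eq_def P by (rule derivation_tri_eval[OF that(1) loc_const_hom that(2)])
  have dX: "q dvd local_eq P (pderiv F) * loc_DX x
     + local_eq P (map_poly pderiv F) * loc_DX y + local_eq P (map_poly (map_poly pderiv) F) * loc_DX z"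
    using square_dvd_derivation[OF derivation_DX sq] chain[OF derivation_DX] by (simp add: loc_D_simps)
  have dY: "q dvd local_eq P (pderiv F) * loc_DY x
     + local_eq P (map_poly pderiv F) * loc_DY y + local_eq P (map_poly (map_poly pderiv) F) * loc_DY z"
    using square_dvd_derivation[OF derivation_DY sq] chain[OF derivation_DY] by (simp add: loc_D_simps)
  have qF: "q dvd local_eq P F" using sq by (metis dvd_trans dvd_triv_left power2_eq_square)
  have vars: "local_eq P var_x = x" "local_eq P var_y = y" "local_eq P var_z = z"
    unfolding local_eq_def P by (simp_all only: tri_eval_var[OF loc_const_hom])
  have eul: "local_eq P (of_nat d * F) = x * local_eq P (pderiv F) + y * local_eq P (map_poly pderiv F)
      + z * local_eq P (map_poly (map_poly pderiv) F)"
    unfolding euler_identity[OF hom, symmetric] l.hom_add l.hom_mult vars ..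
  have eu: "q dvd x * local_eq P (pderiv F) + y * local_eq P (map_poly pderiv F)
      + z * local_eq P (map_poly (map_poly pderiv) F)"
    unfolding eul[symmetric] l.hom_mult using qF by (rule dvd_mult)
  have all: "q dvd local_eq P (pderiv F) \<and> q dvd local_eq P (map_poly pderiv F)
      \<and> q dvd local_eq P (map_poly (map_poly pderiv) F)"
  proof (cases P)
    case (fields a b c)
    have add: "derivation D \<Longrightarrow> D (u + v) = D u + D v" for D and u v :: local_ring by (simp add: derivation_def)
    note D = add[OF derivation_DX] add[OF derivation_DY] loc_D_simps
    consider "a \<noteq> 0" | "a = 0" "b \<noteq> 0" | "a = 0" "b = 0" by blast
    then show ?thesis
    proof cases
      case 1
      then have "x = 1" "y = loc_const b + loc_X" "z = loc_const c + loc_Y" using P fields by auto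
      then show ?thesis using dX dY eu by (simp add: D dvd_add_left_iff)
    next
      case 2
      then have "x = loc_X" "y = 1" "z = loc_const c + loc_Y" using P fields by auto
      then show ?thesis using dX dY eu by (simp add: D dvd_add_left_iff dvd_add_right_iff)
    next
      case 3
      then have "x = loc_X" "y = loc_Y" "z = 1" using P fields by auto
      then show ?thesis using dX dY eu by (simp add: D dvd_add_left_iff dvd_add_right_iff)
    qed
  qed
  have contra: "G = 0" if G: "homogeneous (d - 1) G" "q dvd local_eq P G" for G
  proof (rule ccontr)
    assume "G \<noteq> 0"
    have "d \<noteq> 0"
    proof
      assume "d = 0"
      then obtain c where c: "F = tri_const c" using homogeneous_0_imp_const hom by blast
      have "F \<noteq> 0" "\<not> F dvd 1" using irr by (auto simp: Factorial_Ring.irreducible_def)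
      then show False using c tri_const_unit[of c] by (auto simp: tri_const_def)
    qed
    then have "\<not> F dvd G" using homogeneous_dvd_imp_le[OF hom G(1)] \<open>G \<noteq> 0\<close> by auto
    then have "coprime F G" using prime_elem_imp_coprime[OF irreducible_form_prime[OF irr]] by simp
    then have "finite_colength (local_eq P F) (local_eq P G)"
      by (rule coprime_forms_finite_colength[OF _ hom G(1)])
    then have "finite_colength q (local_eq P G)" by (rule finite_colength_mono[OF _ qF]) simp
    moreover have "\<not> q dvd 1" "q \<noteq> 0" using q by (auto simp: Factorial_Ring.irreducible_def)
    ultimately show False using finite_colength_imp_not_dvd G(2) by blast
  qed
  have z: "pderiv F = 0" "map_poly pderiv F = 0" "map_poly (map_poly pderiv) F = 0"
    using contra[OF homogeneous_partials(1)[OF hom]] contra[OF homogeneous_partials(2)[OF hom]]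
      contra[OF homogeneous_partials(3)[OF hom]] all by simp_all
  have "of_nat d * F = 0" unfolding euler_identity[OF hom, symmetric] z by simp
  moreover have "F \<noteq> 0" using irr by (auto simp: Factorial_Ring.irreducible_def)
  ultimately have "d = 0" by simp
  then obtain c where c: "F = tri_const c" using homogeneous_0_imp_const hom by blast
  then show False using irr tri_const_unit[of c] by (auto simp: Factorial_Ring.irreducible_def tri_const_def)
qed

section \<open>Branches and members of the pencil\<close>

lemma is_unit_tripoly: "(u :: tripoly) dvd 1 \<Longrightarrow> \<exists>c. c \<noteq> 0 \<and> u = tri_const c"
  by (auto simp: tri_const_def is_unit_poly_iff elim!: degree_eq_zeroE)

lemma irreducible_forms_dvd_imp_proportional:
  assumes "Factorial_Ring.irreducible F" "Factorial_Ring.irreducible G" "F dvd G"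
  shows "proportional G F"
proof -
  obtain w where w: "G = F * w" using assms(3) by (elim dvdE)
  have "w dvd 1" using irreducibleD[OF assms(2) w] assms(1) by (auto simp: Factorial_Ring.irreducible_def)
  then show ?thesis using is_unit_tripoly w unfolding proportional_def by (metis mult.commute)
qed

lemma proportional_sym: "proportional F G \<Longrightarrow> proportional G F"
proof -
  assume "proportional F G"
  then obtain c where c: "c \<noteq> 0" "F = tri_const c * G" by (auto simp: proportional_def)
  interpret t: comm_ring_hom tri_const by (rule tri_const_hom)
  have "tri_const (inverse c) * F = tri_const (inverse c * c) * G"
    unfolding c(2) t.hom_mult by (simp add: mult.assoc)
  then have "G = tri_const (inverse c) * F" using c by simp
  then show ?thesis using c unfolding proportional_def by (metis inverse_nonzero_iff_nonzero)
qed

lemma proportional_trans: "proportional F G \<Longrightarrow> proportional G H \<Longrightarrow> proportional F H"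
proof -
  interpret t: comm_ring_hom tri_const by (rule tri_const_hom)
  assume "proportional F G" "proportional G H"
  then obtain c d where "c \<noteq> 0" "F = tri_const c * G" "d \<noteq> 0" "G = tri_const d * H"
    by (auto simp: proportional_def)
  then have "c * d \<noteq> 0" "F = tri_const (c * d) * H" by (simp_all add: t.hom_mult mult.assoc)
  then show ?thesis unfolding proportional_def by blast
qed

lemma homogeneous_tri_const: "homogeneous 0 (tri_const c)"
  by (auto simp: homogeneous_def tri_const_def coeff_pCons split: nat.splits)

lemma homogeneous_add: "homogeneous d F \<Longrightarrow> homogeneous d G \<Longrightarrow> homogeneous d (F + G)"
  unfolding homogeneous_def by (metis add_cancel_right_left coeff_add)

lemma homogeneous_member: "irreducible_pencil \<phi> \<Longrightarrow> homogeneous (pdeg \<phi>) (member \<phi> \<rho>)"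
  unfolding irreducible_pencil_def member_def
  using homogeneous_mult[OF homogeneous_tri_const] by (intro homogeneous_add) auto

lemma P1_eq_of_proportional:
  assumes "(s, t) \<in> P1" "(s', t') \<in> P1" "s * t' = s' * t"
  shows "(s, t) = (s', t')"
  using assms by (auto simp: P1_def)

lemma infinite_P1: "infinite P1"
proof
  assume "finite P1"
  then have "finite (range (\<lambda>t::complex. (1::complex, t)))" by (rule finite_subset[rotated]) (auto simp: P1_def)
  then have "finite (UNIV :: complex set)" by (rule finite_imageD) (auto intro: injI)
  then show False using infinite_UNIV_char_0 by blast
qed

lemma member_linear_combination:
  "tri_const (fst \<rho> * snd \<rho>' - fst \<rho>' * snd \<rho>) * member \<phi> \<sigma>
    = tri_const (fst \<sigma> * snd \<rho>' - fst \<rho>' * snd \<sigma>) * member \<phi> \<rho>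
    + tri_const (fst \<rho> * snd \<sigma> - fst \<sigma> * snd \<rho>) * member \<phi> \<rho>'"
proof -
  interpret t: comm_ring_hom tri_const by (rule tri_const_hom)
  show ?thesis by (simp add: member_def t.hom_mult t.hom_minus algebra_simps)
qed

text \<open>A common divisor of two members divides every member. Two different irreducible members would
  both be proportional to \<open>F\<close>, contradicting the independence of the generators of the pencil.\<close>

lemma irreducible_pencil_no_fixed_component:
  assumes pen: "irreducible_pencil \<phi>" and F: "Factorial_Ring.irreducible F"
    and \<rho>: "\<rho> \<in> P1" "\<rho>' \<in> P1" "\<rho> \<noteq> \<rho>'" and dvd: "F dvd member \<phi> \<rho>" "F dvd member \<phi> \<rho>'"
  shows False
proof -
  have det: "fst \<rho> * snd \<rho>' - fst \<rho>' * snd \<rho> \<noteq> 0"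
    using P1_eq_of_proportional[of "fst \<rho>" "snd \<rho>" "fst \<rho>'" "snd \<rho>'"] \<rho> by auto
  have all: "F dvd member \<phi> \<sigma>" for \<sigma>
  proof -
    have "F dvd tri_const (fst \<rho> * snd \<rho>' - fst \<rho>' * snd \<rho>) * member \<phi> \<sigma>"
      unfolding member_linear_combination[of \<rho> \<rho>' \<phi> \<sigma>] using dvd by (intro dvd_add dvd_mult)
    then show ?thesis using tri_const_unit[OF det] dvd_mult_unit_iff' by blast
  qed
  \<comment> \<open>the projective line is infinite, so at least two members are irreducible\<close>
  define Bad where "Bad = {\<rho> \<in> P1. \<not> Factorial_Ring.irreducible (member \<phi> \<rho>)}"
  have "finite Bad" using pen by (simp add: irreducible_pencil_def Bad_def)
  then have inf: "infinite (P1 - Bad)" using infinite_P1 by simp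
  then obtain \<sigma> where \<sigma>: "\<sigma> \<in> P1 - Bad" by (metis infinite_imp_nonempty ex_in_conv)
  have "infinite (P1 - Bad - {\<sigma>})" using inf by simp
  then obtain \<tau> where \<tau>: "\<tau> \<in> P1 - Bad - {\<sigma>}" by (metis infinite_imp_nonempty ex_in_conv)
  have "proportional (member \<phi> \<sigma>) F" "proportional (member \<phi> \<tau>) F"
    using irreducible_forms_dvd_imp_proportional[OF F _ all] \<sigma> \<tau> by (auto simp: Bad_def)
  then have "proportional (member \<phi> \<sigma>) (member \<phi> \<tau>)" using proportional_sym proportional_trans by blast
  then obtain c where c: "member \<phi> \<sigma> = tri_const c * member \<phi> \<tau>" by (auto simp: proportional_def)
  interpret t: comm_ring_hom tri_const by (rule tri_const_hom)
  have "tri_const (fst \<sigma> - c * fst \<tau>) * penA \<phi> + tri_const (snd \<sigma> - c * snd \<tau>) * penB \<phi> = 0"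
    using c by (simp add: member_def t.hom_mult t.hom_minus algebra_simps)
  then have "fst \<sigma> = c * fst \<tau>" "snd \<sigma> = c * snd \<tau>"
    using pen unfolding irreducible_pencil_def by (metis eq_iff_diff_eq_0)+
  then have "fst \<sigma> * snd \<tau> = fst \<tau> * snd \<sigma>" by simp
  then have "\<sigma> = \<tau>" using P1_eq_of_proportional[of "fst \<sigma>" "snd \<sigma>" "fst \<tau>" "snd \<tau>"] \<sigma> \<tau> by auto
  with \<tau> show False by simp
qed

lemma ideal_sum_unit_add:
  assumes "u dvd 1" "h dvd w"
  shows "ideal_sum h (u * g + w) = ideal_sum h g"
proof -
  obtain v where v: "1 = u * v" using assms(1) by (elim dvdE)
  obtain k where k: "w = h * k" using assms(2) by (elim dvdE)
  have "h * a + (u * g + w) * b = h * (a + k * b) + g * (u * b)" for a b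
    by (simp add: k algebra_simps)
  moreover have "h * a + g * b = h * (a - k * (v * b)) + (u * g + w) * (v * b)" for a b
  proof -
    have "h * (a - k * (v * b)) + (u * g + w) * (v * b) = h * a + g * ((u * v) * b)"
      by (simp add: k algebra_simps)
    then show ?thesis using v by simp
  qed
  ultimately show ?thesis unfolding set_eq_iff ideal_sum_iff by metis
qed

lemma intersection_number_unit_add:
  "u dvd 1 \<Longrightarrow> h dvd w \<Longrightarrow>
    intersection_number (multiples h) (multiples (u * g + w)) = intersection_number (multiples h) (multiples g)"
  unfolding intersection_number_multiples by (simp add: ideal_sum_unit_add)

lemma local_eq_tri_const: "local_eq P (tri_const c) = loc_const c"
  unfolding local_eq_def by (cases "chart P") (simp only: tri_eval_var[OF loc_const_hom])

lemma loc_const_unit: "c \<noteq> 0 \<Longrightarrow> loc_const c dvd 1"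
  by (simp add: local_unit_iff)

lemma finite_comp_index: "finite (comp_index \<phi>)"
proof -
  have "comp_index \<phi> = (SIGMA i:{..<nparts \<phi>}. {..<ncomps \<phi> i})" by (auto simp: comp_index_def)
  then show ?thesis by simp
qed

lemma prime_elem_dvd_prodD:
  assumes "finite A" "prime_elem p" "p dvd (\<Prod>a\<in>A. f a)"
  shows "\<exists>a\<in>A. p dvd f a"
  using assms
proof (induction A rule: finite_induct)
  case empty
  then show ?case by (simp add: prime_elem_def)
next
  case (insert x A)
  then show ?case using prime_elem_dvd_multD[of p "f x"] by auto
qed

context
  fixes \<phi> :: quasi_fiber_data
  assumes qft: "quasi_fiber_type \<phi>"
begin

lemma component_properties:
  "\<forall>(i, j) \<in> comp_index \<phi>. Factorial_Ring.irreducible (qF \<phi> i j) \<and>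
     (\<exists>e. homogeneous e (qF \<phi> i j)) \<and> qmult \<phi> i j > 0"
proof -
  have "decomposed_curve \<phi>" using qft unfolding quasi_fiber_type_def by (rule conjunct1)
  then show ?thesis unfolding decomposed_curve_def by (rule conjunct1[OF conjunct2[OF conjunct2]])
qed

lemma qF_irreducible: "(i, j) \<in> comp_index \<phi> \<Longrightarrow> Factorial_Ring.irreducible (qF \<phi> i j)"
  and qF_homogeneous: "(i, j) \<in> comp_index \<phi> \<Longrightarrow> \<exists>e. homogeneous e (qF \<phi> i j)"
  and qmult_pos: "(i, j) \<in> comp_index \<phi> \<Longrightarrow> qmult \<phi> i j > 0"
  using component_properties by auto

lemma pencil: "irreducible_pencil \<phi>"
  using qft by (simp add: quasi_fiber_type_def)

lemma qpt_P1: "i < nparts \<phi> \<Longrightarrow> qpt \<phi> i \<in> P1"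
  and Gpart_member: "i < nparts \<phi> \<Longrightarrow> proportional (Gpart \<phi> i) (member \<phi> (qpt \<phi> i))"
  and Gpart_homogeneous: "i < nparts \<phi> \<Longrightarrow> homogeneous (pdeg \<phi>) (Gpart \<phi> i)"
  and qH_homogeneous: "i < nparts \<phi> \<Longrightarrow> \<exists>e. homogeneous e (qH \<phi> i)"
  and qH_nonzero: "i < nparts \<phi> \<Longrightarrow> qH \<phi> i \<noteq> 0"
  using qft by (simp_all add: quasi_fiber_type_def parts_in_pencil_def)

lemma qpt_inj: "i < nparts \<phi> \<Longrightarrow> l < nparts \<phi> \<Longrightarrow> i \<noteq> l \<Longrightarrow> qpt \<phi> i \<noteq> qpt \<phi> l"
  using qft unfolding quasi_fiber_type_def parts_in_pencil_def inj_on_def by (metis lessThan_iff)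

lemma qF_coprime:
  assumes "(i, j) \<in> comp_index \<phi>" "(i', j') \<in> comp_index \<phi>" "(i, j) \<noteq> (i', j')"
  shows "coprime (qF \<phi> i j) (qF \<phi> i' j')"
proof -
  have "decomposed_curve \<phi>" using qft unfolding quasi_fiber_type_def by (rule conjunct1)
  then have "\<forall>(i, j) \<in> comp_index \<phi>. \<forall>(i', j') \<in> comp_index \<phi>.
      (i, j) \<noteq> (i', j') \<longrightarrow> \<not> proportional (qF \<phi> i j) (qF \<phi> i' j')"
    unfolding decomposed_curve_def by (rule conjunct1[OF conjunct2[OF conjunct2[OF conjunct2]]])
  from bspec[OF this assms(2)] assms(1,3) have "\<not> proportional (qF \<phi> i' j') (qF \<phi> i j)" by auto
  then have "\<not> qF \<phi> i j dvd qF \<phi> i' j'"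
    using irreducible_forms_dvd_imp_proportional[OF qF_irreducible[OF assms(1)] qF_irreducible[OF assms(2)]]
    by auto
  then show ?thesis using prime_elem_imp_coprime[OF irreducible_form_prime[OF qF_irreducible[OF assms(1)]]] by simp
qed

lemma qF_dvd_Gpart:
  assumes "(i, j) \<in> comp_index \<phi>"
  shows "qF \<phi> i j dvd Gpart \<phi> i"
proof -
  have "qF \<phi> i j dvd qF \<phi> i j ^ qmult \<phi> i j" using qmult_pos[OF assms] by (simp add: dvd_power)
  also have "\<dots> dvd Fpart \<phi> i" unfolding Fpart_def using assms by (intro dvd_prodI) (auto simp: comp_index_def)
  finally show ?thesis by (simp add: Gpart_def)
qed

lemma qF_dvd_member:
  assumes "(i, j) \<in> comp_index \<phi>"
  shows "qF \<phi> i j dvd member \<phi> (qpt \<phi> i)"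
proof -
  have "i < nparts \<phi>" using assms by (auto simp: comp_index_def)
  then obtain c where "member \<phi> (qpt \<phi> i) = tri_const c * Gpart \<phi> i"
    using proportional_sym[OF Gpart_member] by (auto simp: proportional_def)
  then show ?thesis using qF_dvd_Gpart[OF assms] by simp
qed

lemma qF_coprime_member:
  assumes "(i, j) \<in> comp_index \<phi>" "\<rho> \<in> P1" "\<rho> \<noteq> qpt \<phi> i"
  shows "coprime (qF \<phi> i j) (member \<phi> \<rho>)"
proof -
  have "i < nparts \<phi>" using assms by (auto simp: comp_index_def)
  then have "\<not> qF \<phi> i j dvd member \<phi> \<rho>"
    using irreducible_pencil_no_fixed_component[OF pencil qF_irreducible[OF assms(1)] assms(2) qpt_P1 assms(3)]
      qF_dvd_member[OF assms(1)] by blast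
  then show ?thesis using prime_elem_imp_coprime[OF irreducible_form_prime[OF qF_irreducible[OF assms(1)]]] by simp
qed

definition germ :: "pt2 \<Rightarrow> nat \<times> nat \<Rightarrow> local_ring" where
  "germ P a = local_eq P (qF \<phi> (fst a) (snd a))"

lemma germ_finite_colength:
  assumes "a \<in> comp_index \<phi>" "b \<in> comp_index \<phi>" "a \<noteq> b"
  shows "finite_colength (germ P a) (germ P b)"
proof -
  obtain i j i' j' where ab: "a = (i, j)" "b = (i', j')" by fastforce
  obtain d e where "homogeneous d (qF \<phi> i j)" "homogeneous e (qF \<phi> i' j')"
    using qF_homogeneous assms ab by blast
  then show ?thesis unfolding germ_def ab fst_conv snd_conv
    using coprime_forms_finite_colength[OF qF_coprime] assms ab by simp
qed

lemma branch_member_finite_colength: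
  assumes a: "(i, j) \<in> comp_index \<phi>" and h: "h dvd germ P (i, j)" and \<rho>: "\<rho> \<in> P1" "\<rho> \<noteq> qpt \<phi> i"
  shows "finite_colength h (local_eq P (member \<phi> \<rho>))"
proof -
  obtain d where "homogeneous d (qF \<phi> i j)" using qF_homogeneous a by blast
  then have "finite_colength (germ P (i, j)) (local_eq P (member \<phi> \<rho>))"
    unfolding germ_def fst_conv snd_conv
    by (rule coprime_forms_finite_colength[OF qF_coprime_member[OF a \<rho>] _ homogeneous_member[OF pencil]])
  then show ?thesis by (rule finite_colength_mono[OF _ h]) simp
qed

lemma germ_squarefree:
  assumes "a \<in> comp_index \<phi>" "Factorial_Ring.irreducible q"
  shows "\<not> q ^ 2 dvd germ P a"
proof -
  obtain i j where a: "a = (i, j)" by fastforce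
  obtain d where "homogeneous d (qF \<phi> i j)" using qF_homogeneous assms a by blast
  moreover have "Factorial_Ring.irreducible (qF \<phi> i j)" using qF_irreducible assms(1) a by simp
  ultimately show ?thesis
    unfolding a germ_def using irreducible_form_locally_squarefree[OF _ _ assms(2)] by (metis fst_conv snd_conv)
qed

text \<open>The zero series is divisible by every square.\<close>

lemma germ_nonzero: "a \<in> comp_index \<phi> \<Longrightarrow> germ P a \<noteq> 0"
proof
  assume a: "a \<in> comp_index \<phi>" and 0: "germ P a = 0"
  have "Factorial_Ring.irreducible (fps_X :: local_ring)"
    by (rule prime_elem_imp_irreducible[OF prime_elem_fps_X])
  from germ_squarefree[OF a this, of P] 0 show False by simp
qed

lemma sum_over_component_branches:
  assumes a: "a \<in> comp_index \<phi>" and "h \<noteq> 0" and "finite_colength h (germ P a)"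
  shows "(\<Sum>\<delta>\<in>germ_branches (germ P a). intersection_number (multiples h) \<delta>)
      = intersection_number (multiples h) (multiples (germ P a))"
  using sum_over_germ_branches[OF germ_nonzero[OF a] germ_squarefree[OF a]] assms by blast

text \<open>On a branch of the fibre over \<open>qpt \<phi> i\<close> the equation of that fibre vanishes, so the restrictions of
  any two other members of the pencil are proportional, and they generate the same ideal together
  with \<open>h\<close>.\<close>

lemma branch_member_number_eq:
  assumes a: "(i, j) \<in> comp_index \<phi>" and h: "h dvd germ P (i, j)"
    and \<rho>: "\<rho> \<in> P1" "\<rho> \<noteq> qpt \<phi> i" and \<sigma>: "\<sigma> \<in> P1" "\<sigma> \<noteq> qpt \<phi> i"
  shows "intersection_number (multiples h) (multiples (local_eq P (member \<phi> \<rho>)))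
       = intersection_number (multiples h) (multiples (local_eq P (member \<phi> \<sigma>)))"
proof -
  interpret l: comm_ring_hom "local_eq P" by (rule local_eq_hom)
  define \<tau> where "\<tau> = qpt \<phi> i"
  have \<tau>: "\<tau> \<in> P1" unfolding \<tau>_def using qpt_P1 a by (auto simp: comp_index_def)
  define D where "D = (\<lambda>\<rho> \<rho>' :: pt1. fst \<rho> * snd \<rho>' - fst \<rho>' * snd \<rho>)"
  have nz: "D \<sigma> \<tau> \<noteq> 0" "D \<rho> \<tau> \<noteq> 0"
    using P1_eq_of_proportional[of "fst \<sigma>" "snd \<sigma>" "fst \<tau>" "snd \<tau>"] \<tau> \<sigma>
      P1_eq_of_proportional[of "fst \<rho>" "snd \<rho>" "fst \<tau>" "snd \<tau>"] \<rho> by (auto simp: D_def \<tau>_def)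
  let ?g = "\<lambda>\<rho>. local_eq P (member \<phi> \<rho>)"
  have "loc_const (D \<sigma> \<tau>) * ?g \<rho> = loc_const (D \<rho> \<tau>) * ?g \<sigma> + loc_const (D \<sigma> \<rho>) * ?g \<tau>"
    using arg_cong[OF member_linear_combination[of \<sigma> \<tau> \<phi> \<rho>], of "local_eq P"]
    by (simp add: l.hom_add l.hom_mult local_eq_tri_const D_def)
  moreover have "h dvd loc_const (D \<sigma> \<rho>) * ?g \<tau>"
  proof (rule dvd_mult)
    have "germ P (i, j) dvd ?g \<tau>" unfolding germ_def \<tau>_def using qF_dvd_member[OF a] by (auto intro: l.hom_dvd)
    with h show "h dvd ?g \<tau>" by (rule dvd_trans)
  qed
  ultimately show ?thesis
    using intersection_number_unit_add[OF loc_const_unit[OF nz(2)], of h "loc_const (D \<sigma> \<rho>) * ?g \<tau>" "?g \<sigma>"]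
      intersection_number_unit_add[OF loc_const_unit[OF nz(1)], of h 0 "?g \<rho>"] by simp
qed

text \<open>Additivity of intersection numbers applied to \<open>G\<^sub>l = F\<^sub>l H\<^sub>l\<^sup>m\<close> with \<open>m\<close> the orbifold order \<open>m\<^sub>l\<close>; the
  contribution of \<open>H\<^sub>l\<close> is a multiple of \<open>m\<^sub>l\<close>.\<close>

lemma branch_part_number:
  assumes a: "(i, j) \<in> comp_index \<phi>" and irr: "Factorial_Ring.irreducible h" and h: "h dvd germ P (i, j)"
    and l: "l < nparts \<phi>" "l \<noteq> i"
  shows "(\<Sum>j'<ncomps \<phi> l. qmult \<phi> l j' * intersection_number (multiples h) (multiples (germ P (l, j'))))
      + qorder \<phi> l * intersection_number (multiples h) (multiples (local_eq P (qH \<phi> l)))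
      = intersection_number (multiples h) (multiples (local_eq P (member \<phi> (qpt \<phi> l))))"
proof -
  interpret le: comm_ring_hom "local_eq P" by (rule local_eq_hom)
  have h0: "h \<noteq> 0" "\<not> h dvd 1" using irr by (auto simp: Factorial_Ring.irreducible_def)
  have i: "i < nparts \<phi>" using a by (auto simp: comp_index_def)
  obtain c where c: "c \<noteq> 0" "Gpart \<phi> l = tri_const c * member \<phi> (qpt \<phi> l)"
    using Gpart_member[OF l(1)] by (auto simp: proportional_def)
  let ?I = "\<lambda>f. intersection_number (multiples h) (multiples f)"
  have "finite_colength h (local_eq P (member \<phi> (qpt \<phi> l)))"
    using branch_member_finite_colength[OF a h qpt_P1[OF l(1)]] qpt_inj[OF i l(1)] l(2) by metis
  moreover have "local_eq P (Gpart \<phi> l) dvd local_eq P (member \<phi> (qpt \<phi> l))"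
    unfolding c(2) le.hom_mult local_eq_tri_const
    using mult_unit_dvdI[OF loc_const_unit[OF c(1)]] by (simp add: mult.commute)
  ultimately have fc: "finite_colength h (local_eq P (Gpart \<phi> l))"
    by (rule finite_colength_mono[OF _ dvd_refl])
  have eqG: "local_eq P (Gpart \<phi> l) = local_eq P (Fpart \<phi> l) * local_eq P (qH \<phi> l) ^ qorder \<phi> l"
    by (simp add: Gpart_def le.hom_mult le.hom_power)
  have eqF: "local_eq P (Fpart \<phi> l) = (\<Prod>j'<ncomps \<phi> l. germ P (l, j') ^ qmult \<phi> l j')"
    by (simp add: Fpart_def le.hom_prod le.hom_power germ_def)
  have "local_eq P (Gpart \<phi> l) \<noteq> 0"
    using finite_colength_imp_not_dvd[OF fc h0(2,1)] by auto
  then have H0: "local_eq P (qH \<phi> l) ^ qorder \<phi> l \<noteq> 0" "local_eq P (Fpart \<phi> l) \<noteq> 0" by (auto simp: eqG)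
  have fcF: "finite_colength h (local_eq P (Fpart \<phi> l))"
    and fcH: "finite_colength h (local_eq P (qH \<phi> l) ^ qorder \<phi> l)"
    using finite_colength_mono[OF fc dvd_refl] by (simp_all add: eqG)
  have nz: "germ P (l, j') ^ qmult \<phi> l j' \<noteq> 0" if "j' < ncomps \<phi> l" for j'
    using germ_nonzero[of "(l, j')" P] that l by (simp add: comp_index_def)
  have F: "?I (local_eq P (Fpart \<phi> l)) = (\<Sum>j'<ncomps \<phi> l. qmult \<phi> l j' * ?I (germ P (l, j')))"
  proof -
    have "?I (local_eq P (Fpart \<phi> l)) = (\<Sum>j'<ncomps \<phi> l. ?I (germ P (l, j') ^ qmult \<phi> l j'))"
      unfolding eqF using fcF eqF h0 nz by (intro intersection_number_prod) auto
    also have "\<dots> = (\<Sum>j'<ncomps \<phi> l. qmult \<phi> l j' * ?I (germ P (l, j')))"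
    proof (intro sum.cong refl intersection_number_power)
      fix j' assume j': "j' \<in> {..<ncomps \<phi> l}"
      then show "germ P (l, j') \<noteq> 0" using germ_nonzero l by (simp add: comp_index_def)
      have "germ P (l, j') ^ qmult \<phi> l j' dvd local_eq P (Fpart \<phi> l)"
        unfolding eqF using j' by (intro dvd_prodI) auto
      then show "finite_colength h (germ P (l, j') ^ qmult \<phi> l j')"
        by (rule finite_colength_mono[OF fcF dvd_refl])
    qed (rule h0)
    finally show ?thesis .
  qed
  have H: "?I (local_eq P (qH \<phi> l) ^ qorder \<phi> l) = qorder \<phi> l * ?I (local_eq P (qH \<phi> l))"
  proof (cases "qorder \<phi> l = 0")
    case True
    then show ?thesis by (simp add: intersection_number_one)
  next
    case False
    then have "local_eq P (qH \<phi> l) \<noteq> 0" using H0 by (auto simp: power_0_left)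
    then show ?thesis using intersection_number_power fcH h0 by blast
  qed
  have "?I (local_eq P (Gpart \<phi> l)) = ?I (local_eq P (Fpart \<phi> l)) + ?I (local_eq P (qH \<phi> l) ^ qorder \<phi> l)"
    unfolding eqG using fc[unfolded eqG] h0 H0 by (intro intersection_number_mult)
  moreover have "?I (local_eq P (Gpart \<phi> l)) = ?I (local_eq P (member \<phi> (qpt \<phi> l)))"
    using intersection_number_unit_add[OF loc_const_unit[OF c(1)], of h 0]
    by (simp add: c(2) le.hom_mult local_eq_tri_const)
  ultimately show ?thesis unfolding F H by simp
qed

lemma branches_wct_of:
  "branches (wct_of \<phi>) P = germ_branches (\<Prod>a\<in>comp_index \<phi>. germ P a)"
proof -
  interpret l: comm_ring_hom "local_eq P" by (rule local_eq_hom)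
  show ?thesis by (simp add: wct_of_def curve_wct_def l.hom_prod germ_def case_prod_beta)
qed

text \<open>The definite description in \<^const>\<open>curve_wct\<close> denotes the intended component: an irreducible
  factor of the product divides some germ because it is prime, and only one because distinct germs
  have no common factor.\<close>

lemma component_branches:
  assumes b: "b \<in> comp_index \<phi>"
  shows "{\<delta> \<in> branches (wct_of \<phi>) P. comp_of (wct_of \<phi>) P \<delta> = b} = germ_branches (germ P b)"
proof -
  have comp: "comp_of (wct_of \<phi>) P (multiples h) = a"
    if irr: "Factorial_Ring.irreducible h" and a: "a \<in> comp_index \<phi>" "h dvd germ P a" for h a
  proof -
    have "comp_of (wct_of \<phi>) P (multiples h) = (THE a. a \<in> comp_index \<phi> \<and> h dvd germ P a)"
      by (simp add: wct_of_def curve_wct_def germ_def multiples_def case_prod_beta)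
    also have "\<dots> = a"
    proof (rule the_equality)
      fix a' assume a': "a' \<in> comp_index \<phi> \<and> h dvd germ P a'"
      show "a' = a"
      proof (rule ccontr)
        assume "a' \<noteq> a"
        then have "finite_colength (germ P a') (germ P a)" using germ_finite_colength a a' by blast
        then have "finite_colength h h" by (rule finite_colength_mono) (use a a' in auto)
        then show False using finite_colength_imp_not_dvd[of h h] irr
          by (auto simp: Factorial_Ring.irreducible_def)
      qed
    qed (use a in blast)
    finally show ?thesis .
  qed
  show ?thesis
  proof (intro equalityI subsetI)
    fix \<delta> assume "\<delta> \<in> {\<delta> \<in> branches (wct_of \<phi>) P. comp_of (wct_of \<phi>) P \<delta> = b}"
    then obtain h where h: "\<delta> = multiples h" "Factorial_Ring.irreducible h"
        "h dvd (\<Prod>a\<in>comp_index \<phi>. germ P a)" "comp_of (wct_of \<phi>) P \<delta> = b"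
      by (auto simp: branches_wct_of germ_branches_eq)
    have "prime_elem h" using irreducible_fps_imp_prime_elem h(2) by blast
    then obtain a where a: "a \<in> comp_index \<phi>" "h dvd germ P a"
      using prime_elem_dvd_prodD[OF finite_comp_index _ h(3)] by blast
    then have "a = b" using comp[OF h(2) a] h by simp
    then show "\<delta> \<in> germ_branches (germ P b)" using a h by (auto simp: germ_branches_eq)
  next
    fix \<delta> assume "\<delta> \<in> germ_branches (germ P b)"
    then obtain h where h: "\<delta> = multiples h" "Factorial_Ring.irreducible h" "h dvd germ P b"
      by (auto simp: germ_branches_eq)
    moreover have "germ P b dvd (\<Prod>a\<in>comp_index \<phi>. germ P a)" using b finite_comp_index by (rule dvd_prodI[rotated])
    then have "h dvd (\<Prod>a\<in>comp_index \<phi>. germ P a)" using h(3) dvd_trans by blast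
    ultimately show "\<delta> \<in> {\<delta> \<in> branches (wct_of \<phi>) P. comp_of (wct_of \<phi>) P \<delta> = b}"
      using comp[OF h(2) b h(3)] by (auto simp: branches_wct_of germ_branches_eq)
  qed
qed

lemma pdeg_eq:
  assumes "l < nparts \<phi>"
  shows "\<exists>e. pdeg \<phi> = (\<Sum>j<ncomps \<phi> l. qmult \<phi> l j * form_degree (qF \<phi> l j)) + qorder \<phi> l * e"
proof -
  obtain e where e: "homogeneous e (qH \<phi> l)" using qH_homogeneous assms by blast
  have nz: "qF \<phi> l j \<noteq> 0" if "j < ncomps \<phi> l" for j
    using qF_irreducible[of l j] that assms by (auto simp: comp_index_def Factorial_Ring.irreducible_def)
  have "homogeneous (\<Sum>j<ncomps \<phi> l. qmult \<phi> l j * form_degree (qF \<phi> l j)) (Fpart \<phi> l)"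
    unfolding Fpart_def
  proof (intro homogeneous_prod homogeneous_power)
    fix j assume j: "j \<in> {..<ncomps \<phi> l}"
    then obtain d where "homogeneous d (qF \<phi> l j)" using qF_homogeneous[of l j] assms by (auto simp: comp_index_def)
    then show "homogeneous (form_degree (qF \<phi> l j)) (qF \<phi> l j)" using form_degree_eq nz j by auto
  qed simp
  then have "homogeneous ((\<Sum>j<ncomps \<phi> l. qmult \<phi> l j * form_degree (qF \<phi> l j)) + qorder \<phi> l * e) (Gpart \<phi> l)"
    unfolding Gpart_def by (intro homogeneous_mult homogeneous_power e)
  moreover have "Gpart \<phi> l \<noteq> 0"
    unfolding Gpart_def Fpart_def using nz qH_nonzero[OF assms] by simp
  ultimately show ?thesis using Gpart_homogeneous[OF assms] homogeneous_unique by blast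
qed

end

section \<open>Products of associated cochains\<close>

definition component_part :: "('s, 'pt, 'b) wct \<Rightarrow> 'pt \<Rightarrow> 's \<Rightarrow> 'b set" where
  "component_part W P a = {\<delta> \<in> branches W P. comp_of W P \<delta> = a}"

text \<open>With \<open>\<psi>\<^sub>0\<close> a fixed branch at \<open>P\<close>, this is \<open>\<psi>\<^sub>\<delta> \<and> \<psi>\<^sub>0\<close>; modulo the relations every \<open>\<psi>\<^sub>\<delta> \<and> \<psi>\<^sub>\<delta>'\<close> is a
  difference of two such elements.\<close>

definition base_gen :: "('s, 'pt, 'b) wct \<Rightarrow> 'pt \<Rightarrow> 'b \<Rightarrow> ('s, 'pt, 'b) A2_gen \<Rightarrow> 'k::field" where
  "base_gen W P \<delta> = basis_vec (Psi P \<delta> (SOME \<delta>0. \<delta>0 \<in> branches W P))"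

text \<open>The terms of \<open>\<sigma>\<^sub>a \<and> \<sigma>\<^sub>b\<close> that are attached to branches of \<open>a\<close>; the remaining terms are the same
  expression with \<open>a\<close> and \<open>b\<close> interchanged. The coefficient of a branch depends on \<open>b\<close> only through
  the intersection number of that branch with the whole component \<open>b\<close>.\<close>

definition half_wedge :: "('s, 'pt, 'b) wct \<Rightarrow> 's \<Rightarrow> 's \<Rightarrow> ('s, 'pt, 'b) A2_gen \<Rightarrow> 'k::field" where
  "half_wedge W a b =
     (\<Sum>P\<in>sing W. \<Sum>\<delta>\<in>component_part W P a.
        fun_scale (of_nat (\<Sum>\<delta>'\<in>component_part W P b. mult W P \<delta> \<delta>')) (base_gen W P \<delta>))
     + fun_scale (of_nat (cdeg W b)) (basis_vec (Psi_inf a))"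

text \<open>The cyclic relation for \<open>\<delta>\<close>, \<open>\<delta>'\<close> and the fixed branch, corrected by one antisymmetry relation.\<close>

lemma Psi_split:
  assumes "P \<in> sing W" "\<delta> \<in> branches W P" "\<delta>' \<in> branches W P"
  shows "basis_vec (Psi P \<delta> \<delta>') - (base_gen W P \<delta> - base_gen W P \<delta>')
    \<in> fun_vs.span (A2_relations W :: (('s, 'pt, 'b) A2_gen \<Rightarrow> 'k::field) set)"
proof -
  define \<delta>0 where "\<delta>0 = (SOME \<delta>0. \<delta>0 \<in> branches W P)"
  have \<delta>0: "\<delta>0 \<in> branches W P" unfolding \<delta>0_def using assms(2) by (rule someI)
  let ?b = "\<lambda>x y. basis_vec (Psi P x y) :: ('s, 'pt, 'b) A2_gen \<Rightarrow> 'k"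
  have "?b \<delta> \<delta>' + ?b \<delta>' \<delta>0 + ?b \<delta>0 \<delta> \<in> A2_relations W"
    using assms \<delta>0 unfolding A2_relations_def by blast
  moreover have "?b \<delta>0 \<delta> + ?b \<delta> \<delta>0 \<in> A2_relations W"
    using assms \<delta>0 unfolding A2_relations_def by blast
  ultimately have "(?b \<delta> \<delta>' + ?b \<delta>' \<delta>0 + ?b \<delta>0 \<delta>) - (?b \<delta>0 \<delta> + ?b \<delta> \<delta>0) \<in> fun_vs.span (A2_relations W)"
    by (intro fun_vs.span_diff fun_vs.span_base)
  also have "(?b \<delta> \<delta>' + ?b \<delta>' \<delta>0 + ?b \<delta>0 \<delta>) - (?b \<delta>0 \<delta> + ?b \<delta> \<delta>0)
      = ?b \<delta> \<delta>' - (base_gen W P \<delta> - base_gen W P \<delta>')"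
    by (simp add: base_gen_def \<delta>0_def[symmetric])
  finally show ?thesis .
qed

lemma sigma_wedge_split:
  assumes sym: "\<And>P \<delta> \<delta>'. mult W P \<delta> \<delta>' = mult W P \<delta>' \<delta>"
  shows "sigma_wedge W a b - (half_wedge W a b - half_wedge W b a)
    \<in> fun_vs.span (A2_relations W :: (('s, 'pt, 'b) A2_gen \<Rightarrow> 'k::field) set)"
proof -
  let ?C = "component_part W"
  let ?m = "\<lambda>P \<delta> \<delta>'. of_nat (mult W P \<delta> \<delta>') :: 'k"
  let ?e = "base_gen W :: 'pt \<Rightarrow> 'b \<Rightarrow> ('s, 'pt, 'b) A2_gen \<Rightarrow> 'k"
  have ab: "half_wedge W a b = (\<Sum>P\<in>sing W. \<Sum>\<delta>\<in>?C P a. \<Sum>\<delta>'\<in>?C P b. fun_scale (?m P \<delta> \<delta>') (?e P \<delta>))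
     + fun_scale (of_nat (cdeg W b)) (basis_vec (Psi_inf a))"
    by (simp add: half_wedge_def fun_vs.scale_sum_left)
  have ba: "half_wedge W b a = (\<Sum>P\<in>sing W. \<Sum>\<delta>\<in>?C P a. \<Sum>\<delta>'\<in>?C P b. fun_scale (?m P \<delta> \<delta>') (?e P \<delta>'))
     + fun_scale (of_nat (cdeg W a)) (basis_vec (Psi_inf b))"
  proof -
    have "(\<Sum>P\<in>sing W. \<Sum>\<delta>\<in>?C P a. \<Sum>\<delta>'\<in>?C P b. fun_scale (?m P \<delta> \<delta>') (?e P \<delta>'))
       = (\<Sum>P\<in>sing W. \<Sum>\<delta>'\<in>?C P b. \<Sum>\<delta>\<in>?C P a. fun_scale (?m P \<delta> \<delta>') (?e P \<delta>'))"
      by (intro sum.cong refl sum.swap)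
    then show ?thesis by (simp add: half_wedge_def fun_vs.scale_sum_left sym)
  qed
  have "sigma_wedge W a b - (half_wedge W a b - half_wedge W b a)
     = (\<Sum>P\<in>sing W. \<Sum>\<delta>\<in>?C P a. \<Sum>\<delta>'\<in>?C P b.
          fun_scale (?m P \<delta> \<delta>') (basis_vec (Psi P \<delta> \<delta>') - (?e P \<delta> - ?e P \<delta>')))"
    unfolding ab ba sigma_wedge_def component_part_def[symmetric]
    by (simp add: fun_vs.scale_right_diff_distrib sum_subtractf sum.distrib algebra_simps)
  also have "\<dots> \<in> fun_vs.span (A2_relations W)"
    by (intro fun_vs.span_sum fun_vs.span_scale Psi_split) (auto simp: component_part_def)
  finally show ?thesis .
qed

lemma sum_fun_apply: "(\<Sum>x\<in>A. f x) y = (\<Sum>x\<in>A. f x y)"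
  for f :: "'a \<Rightarrow> 'b \<Rightarrow> 'c::comm_monoid_add"
  by (induction A rule: infinite_finite_induct) auto

lemma associated_cochain_apply:
  "associated_cochain \<phi> \<alpha> (i, j) = (if (i, j) \<in> comp_index \<phi> then of_nat (qmult \<phi> i j) * \<alpha> i else 0)"
proof -
  have "associated_cochain \<phi> \<alpha> (i, j)
      = (\<Sum>a\<in>comp_index \<phi>. if a = (i, j) then of_nat (qmult \<phi> i j) * \<alpha> i else 0)"
    unfolding associated_cochain_def sum_fun_apply
    by (intro sum.cong refl) (auto simp: fun_scale_def basis_vec_def split: if_splits)
  then show ?thesis using finite_comp_index by simp
qed

lemma sum_comp_index: "(\<Sum>a\<in>comp_index \<phi>. g a) = (\<Sum>l<nparts \<phi>. \<Sum>j<ncomps \<phi> l. g (l, j))"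
proof -
  have "comp_index \<phi> = (SIGMA i:{..<nparts \<phi>}. {..<ncomps \<phi> i})" by (auto simp: comp_index_def)
  then show ?thesis by (simp add: sum.Sigma)
qed

text \<open>Antisymmetrising, the product of the cochains of \<open>\<beta>\<close> and \<open>\<alpha>\<close> is congruent to the sum over
  \<open>a = (i, j)\<close>, \<open>b = (l, j')\<close> of \<open>m\<^sub>a m\<^sub>b (\<beta>\<^sub>i \<alpha>\<^sub>l - \<beta>\<^sub>l \<alpha>\<^sub>i)\<close> times \<open>half_wedge W a b\<close>. The terms with
  \<open>l = i\<close> vanish. If the sum over \<open>j'\<close> of \<open>m\<^sub>b half_wedge W a b\<close> is the same element \<open>E a\<close> for all
  \<open>l \<noteq> i\<close>, then \<open>E a\<close> appears with the coefficient
  \<open>m\<^sub>a (\<beta>\<^sub>i \<Sum>\<alpha> - \<alpha>\<^sub>i \<Sum>\<beta>)\<close>.\<close>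

lemma wedge_associated_cochains_in_relations:
  fixes W :: "(nat \<times> nat, 'pt, 'b) wct" and \<alpha> \<beta> :: "nat \<Rightarrow> 'k::field"
  assumes W: "comps W = comp_index \<phi>"
    and sym: "\<And>P \<delta> \<delta>'. mult W P \<delta> \<delta>' = mult W P \<delta>' \<delta>"
    and fibered: "\<And>i j l. (i, j) \<in> comp_index \<phi> \<Longrightarrow> l < nparts \<phi> \<Longrightarrow> l \<noteq> i \<Longrightarrow>
      (\<Sum>j'<ncomps \<phi> l. fun_scale (of_nat (qmult \<phi> l j')) (half_wedge W (i, j) (l, j'))) = E (i, j)"
    and coef: "\<And>i j. (i, j) \<in> comp_index \<phi> \<Longrightarrow>
      fun_scale (\<beta> i * (\<Sum>l<nparts \<phi>. \<alpha> l) - \<alpha> i * (\<Sum>l<nparts \<phi>. \<beta> l)) (E (i, j)) = 0"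
  shows "wedge W (associated_cochain \<phi> \<beta>) (associated_cochain \<phi> \<alpha>)
    \<in> fun_vs.span (A2_relations W :: ((nat \<times> nat, 'pt, 'b) A2_gen \<Rightarrow> 'k) set)"
proof -
  let ?I = "comp_index \<phi>"
  let ?H = "half_wedge W :: _ \<Rightarrow> _ \<Rightarrow> (nat \<times> nat, 'pt, 'b) A2_gen \<Rightarrow> 'k"
  define \<eta> where "\<eta> = associated_cochain \<phi> \<beta>"
  define \<omega> where "\<omega> = associated_cochain \<phi> \<alpha>"
  let ?D = "\<lambda>a b. ?H a b - ?H b a"
  have "wedge W \<eta> \<omega> - (\<Sum>a\<in>?I. \<Sum>b\<in>?I - {a}. fun_scale (\<eta> a * \<omega> b) (?D a b))
      = (\<Sum>a\<in>?I. \<Sum>b\<in>?I - {a}. fun_scale (\<eta> a * \<omega> b) (sigma_wedge W a b - ?D a b))"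
    unfolding wedge_def W by (simp only: fun_vs.scale_right_diff_distrib sum_subtractf)
  also have "\<dots> \<in> fun_vs.span (A2_relations W)"
    by (intro fun_vs.span_sum fun_vs.span_scale sigma_wedge_split sym)
  finally have mem: "wedge W \<eta> \<omega> - (\<Sum>a\<in>?I. \<Sum>b\<in>?I - {a}. fun_scale (\<eta> a * \<omega> b) (?D a b))
      \<in> fun_vs.span (A2_relations W)" .
  have "(\<Sum>a\<in>?I. \<Sum>b\<in>?I - {a}. fun_scale (\<eta> a * \<omega> b) (?D a b))
      = (\<Sum>a\<in>?I. \<Sum>b\<in>?I. fun_scale (\<eta> a * \<omega> b) (?D a b))"
    using finite_comp_index[of \<phi>] by (intro sum.cong refl sum.mono_neutral_left) auto
  also have "\<dots> = (\<Sum>a\<in>?I. \<Sum>b\<in>?I. fun_scale (\<eta> a * \<omega> b) (?H a b))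
      - (\<Sum>a\<in>?I. \<Sum>b\<in>?I. fun_scale (\<eta> a * \<omega> b) (?H b a))"
    by (simp only: fun_vs.scale_right_diff_distrib sum_subtractf)
  also have "(\<Sum>a\<in>?I. \<Sum>b\<in>?I. fun_scale (\<eta> a * \<omega> b) (?H b a))
      = (\<Sum>a\<in>?I. \<Sum>b\<in>?I. fun_scale (\<eta> b * \<omega> a) (?H a b))"
    by (rule sum.swap)
  also have "(\<Sum>a\<in>?I. \<Sum>b\<in>?I. fun_scale (\<eta> a * \<omega> b) (?H a b))
      - (\<Sum>a\<in>?I. \<Sum>b\<in>?I. fun_scale (\<eta> b * \<omega> a) (?H a b))
      = (\<Sum>a\<in>?I. \<Sum>b\<in>?I. fun_scale (\<eta> a * \<omega> b - \<eta> b * \<omega> a) (?H a b))"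
    by (simp only: fun_vs.scale_left_diff_distrib sum_subtractf)
  also have "\<dots> = (\<Sum>a\<in>?I. 0)"
  proof (intro sum.cong refl)
    fix a assume a: "a \<in> ?I"
    obtain i j where ij: "a = (i, j)" by fastforce
    have "(\<Sum>b\<in>?I. fun_scale (\<eta> a * \<omega> b - \<eta> b * \<omega> a) (?H a b))
        = (\<Sum>l<nparts \<phi>. \<Sum>j'<ncomps \<phi> l. fun_scale (of_nat (qmult \<phi> i j) * (\<beta> i * \<alpha> l - \<beta> l * \<alpha> i))
            (fun_scale (of_nat (qmult \<phi> l j')) (?H a (l, j'))))"
      unfolding sum_comp_index
      by (intro sum.cong refl)
         (use a in \<open>simp add: ij \<eta>_def \<omega>_def associated_cochain_apply comp_index_def algebra_simps\<close>)
    also have "\<dots> = (\<Sum>l<nparts \<phi>. fun_scale (of_nat (qmult \<phi> i j) * (\<beta> i * \<alpha> l - \<beta> l * \<alpha> i)) (E a))"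
    proof (intro sum.cong refl)
      fix l assume l: "l \<in> {..<nparts \<phi>}"
      show "(\<Sum>j'<ncomps \<phi> l. fun_scale (of_nat (qmult \<phi> i j) * (\<beta> i * \<alpha> l - \<beta> l * \<alpha> i))
            (fun_scale (of_nat (qmult \<phi> l j')) (?H a (l, j'))))
          = fun_scale (of_nat (qmult \<phi> i j) * (\<beta> i * \<alpha> l - \<beta> l * \<alpha> i)) (E a)"
      proof (cases "l = i")
        case True
        then show ?thesis by (simp add: mult.commute)
      next
        case False
        then have "(\<Sum>j'<ncomps \<phi> l. fun_scale (of_nat (qmult \<phi> l j')) (?H a (l, j'))) = E a"
          using fibered[of i j l] a l ij by simp
        then show ?thesis by (simp only: fun_vs.scale_sum_right[symmetric])
      qed
    qed
    also have "\<dots> = fun_scale (of_nat (qmult \<phi> i j)) (fun_scale (\<Sum>l<nparts \<phi>. \<beta> i * \<alpha> l - \<beta> l * \<alpha> i) (E a))"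
      by (simp add: fun_vs.scale_sum_left fun_vs.scale_sum_right)
    also have "(\<Sum>l<nparts \<phi>. \<beta> i * \<alpha> l - \<beta> l * \<alpha> i)
        = \<beta> i * (\<Sum>l<nparts \<phi>. \<alpha> l) - \<alpha> i * (\<Sum>l<nparts \<phi>. \<beta> l)"
      by (simp add: sum_subtractf sum_distrib_left mult.commute)
    also have "fun_scale \<dots> (E a) = 0" using coef a ij by blast
    finally show "(\<Sum>b\<in>?I. fun_scale (\<eta> a * \<omega> b - \<eta> b * \<omega> a) (?H a b)) = 0" by (simp only: fun_vs.scale_zero_right)
  qed
  finally have "(\<Sum>a\<in>?I. \<Sum>b\<in>?I - {a}. fun_scale (\<eta> a * \<omega> b) (?D a b)) = 0"
    by (simp only: sum.neutral_const)
  with mem show ?thesis by (simp only: diff_zero \<eta>_def \<omega>_def)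
qed

section \<open>Counting cocycles\<close>

lemma A1_subset_span: "finite (comps W) \<Longrightarrow> A1 W \<subseteq> fun_vs.span (basis_vec ` comps W)"
proof
  fix \<eta> :: "'a \<Rightarrow> 'k::field" assume fin: "finite (comps W)" and "\<eta> \<in> A1 W"
  then have "\<eta> = (\<Sum>a\<in>comps W. fun_scale (\<eta> a) (basis_vec a))"
    by (intro ext) (auto simp: A1_def sum_fun_apply fun_scale_def basis_vec_def if_distrib sum.delta cong: if_cong)
  also have "\<dots> \<in> fun_vs.span (basis_vec ` comps W)"
    by (intro fun_vs.span_sum fun_vs.span_scale fun_vs.span_base) auto
  finally show "\<eta> \<in> fun_vs.span (basis_vec ` comps W)" .
qed

lemma associated_cochain_linear:
  "finite K \<Longrightarrow> (\<Sum>k\<in>K. fun_scale (c k) (associated_cochain \<phi> (b k)))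
    = associated_cochain \<phi> (\<lambda>i. \<Sum>k\<in>K. c k * b k i)"
  by (rule ext, clarify)
     (simp add: sum_fun_apply fun_scale_def associated_cochain_apply sum_distrib_left mult.left_commute)

text \<open>The multiplicities in the part \<open>i\<close> have greatest common divisor \<open>1\<close>, so they do not all vanish in
  the field.\<close>

lemma associated_cochain_eq_0_imp:
  fixes \<beta> :: "nat \<Rightarrow> 'k::field"
  assumes dc: "decomposed_curve \<phi>" and i: "i < nparts \<phi>" and 0: "associated_cochain \<phi> \<beta> = 0"
  shows "\<beta> i = 0"
proof (rule ccontr)
  assume nz: "\<beta> i \<noteq> 0"
  have "CHAR('k) dvd qmult \<phi> i j" if j: "j < ncomps \<phi> i" for j
  proof -
    have "associated_cochain \<phi> \<beta> (i, j) = 0" using 0 by simp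
    then have "(of_nat (qmult \<phi> i j) :: 'k) = 0"
      using nz i j by (simp add: associated_cochain_apply comp_index_def)
    then show ?thesis by (simp add: of_nat_eq_0_iff_char_dvd)
  qed
  then have "CHAR('k) dvd Gcd (qmult \<phi> i ` {..<ncomps \<phi> i})" by (auto intro: Gcd_greatest)
  also have "Gcd (qmult \<phi> i ` {..<ncomps \<phi> i}) = 1" using dc i by (simp add: decomposed_curve_def)
  finally have "(of_nat 1 :: 'k) = 0" by (simp only: of_nat_eq_0_iff_char_dvd)
  then show False by simp
qed

lemma h1_lower_bound:
  fixes W :: "(nat \<times> nat, 'pt, 'b) wct" and \<alpha> :: "nat \<Rightarrow> 'k::field"
  assumes W: "comps W = comp_index \<phi>" and K: "finite K"
    and rel: "\<And>k. k \<in> K \<Longrightarrow> wedge W (associated_cochain \<phi> (b k)) (associated_cochain \<phi> \<alpha>)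
       \<in> fun_vs.span (A2_relations W :: ((nat \<times> nat, 'pt, 'b) A2_gen \<Rightarrow> 'k) set)"
    and dc: "decomposed_curve \<phi>"
    and ind: "\<And>c k. (\<And>i. i < nparts \<phi> \<Longrightarrow> (\<Sum>k\<in>K. c k * b k i) = 0) \<Longrightarrow> k \<in> K \<Longrightarrow> c k = 0"
  shows "card K \<le> h1 W (associated_cochain \<phi> \<alpha>) + 1"
proof -
  define w where "w = (\<lambda>k. associated_cochain \<phi> (b k))"
  have inA1: "associated_cochain \<phi> \<beta> \<in> A1 W" for \<beta> :: "nat \<Rightarrow> 'k"
    by (auto simp: A1_def W associated_cochain_apply)
  have fam: "c k = 0" if "(\<Sum>k\<in>K. fun_scale (c k) (w k)) = 0" "k \<in> K" for c k
  proof (rule ind)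
    show "(\<Sum>k\<in>K. c k * b k i) = 0" if "i < nparts \<phi>" for i
      using associated_cochain_eq_0_imp[OF dc that, of "\<lambda>i. \<Sum>k\<in>K. c k * b k i"]
        \<open>(\<Sum>k\<in>K. fun_scale (c k) (w k)) = 0\<close> associated_cochain_linear[OF K, of c \<phi> b]
      by (simp add: w_def)
  qed fact
  have 1: "fun_vs.independent (w ` K)" by (rule fun_vs.independent_family(1)[OF K]) (rule fam)
  have 2: "card (w ` K) = card K" by (rule fun_vs.independent_family(2)[OF K]) (rule fam)
  let ?U = "{\<eta> \<in> A1 W. wedge W \<eta> (associated_cochain \<phi> \<alpha>) \<in> fun_vs.span (A2_relations W)}"
  have "card (w ` K) \<le> quotient_dim fun_scale ?U (range (\<lambda>c. fun_scale c (associated_cochain \<phi> \<alpha>))) + 1"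
  proof (rule fun_vs.card_le_quotient_dim_line)
    show "finite (basis_vec ` comps W)" using finite_comp_index W by simp
    show "?U \<subseteq> fun_vs.span (basis_vec ` comps W)"
      using A1_subset_span[of W] finite_comp_index[of \<phi>] W by auto
    show "w ` K \<subseteq> ?U" using rel inA1 by (auto simp: w_def)
    show "fun_vs.independent (w ` K)" by (rule 1)
  qed (rule refl)
  then show ?thesis using 2 by (simp add: h1_def)
qed

text \<open>The element \<open>E(a)\<close>, the common value of the weighted sums of \<^const>\<open>half_wedge\<close> over the
  components of a part other than that of \<open>a\<close>. Here \<open>\<rho> i\<close> stands for a member of the pencil different from \<open>G\<^sub>i\<close>, with which
  the branches of the part \<open>i\<close> are intersected.\<close>

definition fiber_term :: "quasi_fiber_data \<Rightarrow> (nat \<Rightarrow> pt1) \<Rightarrow> nat \<times> nat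
    \<Rightarrow> (nat \<times> nat, pt2, local_ring set) A2_gen \<Rightarrow> 'k::field" where
  "fiber_term \<phi> \<rho> a = (\<Sum>P\<in>sing (wct_of \<phi>). \<Sum>\<delta>\<in>component_part (wct_of \<phi>) P a.
      fun_scale (of_nat (intersection_number \<delta> (multiples (local_eq P (member \<phi> (\<rho> (fst a)))))))
        (base_gen (wct_of \<phi>) P \<delta>))
     + fun_scale (of_nat (pdeg \<phi>)) (basis_vec (Psi_inf a))"

text \<open>As \<open>m\<^sub>l\<close> vanishes in the field, the intersection numbers of a branch \<open>\<delta>\<close> with \<open>F\<^sub>l\<close> and with \<open>G\<^sub>l\<close>
  agree there, and all members other than \<open>G\<^sub>i\<close> have the same intersection number with \<open>\<delta>\<close>. For the
  same reason the weighted degrees of the components of \<open>F\<^sub>l\<close> add up to the degree of the pencil in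
  the field.\<close>

lemma fiber_term_eq:
  fixes \<phi> :: quasi_fiber_data
  assumes qft: "quasi_fiber_type \<phi>"
    and m: "\<And>i. i < nparts \<phi> \<Longrightarrow> (of_nat (qorder \<phi> i) :: 'k::field) = 0"
    and a: "(i, j) \<in> comp_index \<phi>" and l: "l < nparts \<phi>" "l \<noteq> i"
    and \<rho>: "\<rho> i \<in> P1" "\<rho> i \<noteq> qpt \<phi> i"
  shows "(\<Sum>j'<ncomps \<phi> l. fun_scale (of_nat (qmult \<phi> l j')) (half_wedge (wct_of \<phi>) (i, j) (l, j')))
     = (fiber_term \<phi> \<rho> (i, j) :: _ \<Rightarrow> 'k)"
proof -
  let ?W = "wct_of \<phi>"
  let ?g = "\<lambda>P. local_eq P (member \<phi> (\<rho> i))"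
  have i: "i < nparts \<phi>" using a by (auto simp: comp_index_def)
  have part: "component_part ?W P b = germ_branches (germ \<phi> P b)" if "b \<in> comp_index \<phi>" for P b
    using component_branches[OF qft that] by (simp add: component_part_def)
  have num: "(\<Sum>j'<ncomps \<phi> l. of_nat (qmult \<phi> l j') *
        of_nat (\<Sum>\<delta>'\<in>component_part ?W P (l, j'). mult ?W P \<delta> \<delta>'))
      = (of_nat (intersection_number \<delta> (multiples (?g P))) :: 'k)"
    if \<delta>: "\<delta> \<in> component_part ?W P (i, j)" for P \<delta>
  proof -
    obtain h where h: "\<delta> = multiples h" "Factorial_Ring.irreducible h" "h dvd germ \<phi> P (i, j)"
      using \<delta> part[OF a] by (auto simp: germ_branches_eq)
    have h0: "h \<noteq> 0" using h by (auto simp: Factorial_Ring.irreducible_def)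
    let ?n = "\<lambda>f. intersection_number (multiples h) (multiples f)"
    have mW: "mult ?W P = intersection_number" by (simp add: wct_of_def curve_wct_def)
    have br: "(\<Sum>\<delta>'\<in>component_part ?W P (l, j'). mult ?W P \<delta> \<delta>') = ?n (germ \<phi> P (l, j'))"
      if j': "j' < ncomps \<phi> l" for j'
    proof -
      have b: "(l, j') \<in> comp_index \<phi>" using j' l by (simp add: comp_index_def)
      have "finite_colength (germ \<phi> P (i, j)) (germ \<phi> P (l, j'))"
        using germ_finite_colength[OF qft a b] l by auto
      then have "finite_colength h (germ \<phi> P (l, j'))" by (rule finite_colength_mono[OF _ h(3) dvd_refl])
      from sum_over_component_branches[OF qft b h0 this] show ?thesis
        by (simp add: part[OF b] h(1) mW)
    qed
    have "(\<Sum>j'<ncomps \<phi> l. qmult \<phi> l j' * ?n (germ \<phi> P (l, j'))) + qorder \<phi> l * ?n (local_eq P (qH \<phi> l))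
        = ?n (?g P)"
      using branch_part_number[OF qft a h(2,3) l]
        branch_member_number_eq[OF qft a h(3) qpt_P1[OF qft l(1)] _ \<rho>] qpt_inj[OF qft i l(1)] l(2) by metis
    from arg_cong[OF this, of "of_nat :: nat \<Rightarrow> 'k"]
    have "(\<Sum>j'<ncomps \<phi> l. of_nat (qmult \<phi> l j') * of_nat (?n (germ \<phi> P (l, j')))) = (of_nat (?n (?g P)) :: 'k)"
      using m[OF l(1)] by simp
    then show ?thesis using br by (simp add: h(1))
  qed
  have deg: "(\<Sum>j'<ncomps \<phi> l. of_nat (qmult \<phi> l j') * of_nat (cdeg ?W (l, j'))) = (of_nat (pdeg \<phi>) :: 'k)"
  proof -
    obtain e where "pdeg \<phi> = (\<Sum>j<ncomps \<phi> l. qmult \<phi> l j * form_degree (qF \<phi> l j)) + qorder \<phi> l * e"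
      using pdeg_eq[OF qft l(1)] by blast
    from arg_cong[OF this, of "of_nat :: nat \<Rightarrow> 'k"] show ?thesis
      using m[OF l(1)] by (simp add: wct_of_def curve_wct_def)
  qed
  have "(\<Sum>j'<ncomps \<phi> l. fun_scale (of_nat (qmult \<phi> l j')) (half_wedge ?W (i, j) (l, j')))
    = (\<Sum>j'<ncomps \<phi> l. \<Sum>P\<in>sing ?W. \<Sum>\<delta>\<in>component_part ?W P (i, j).
        fun_scale (of_nat (qmult \<phi> l j') * of_nat (\<Sum>\<delta>'\<in>component_part ?W P (l, j'). mult ?W P \<delta> \<delta>'))
          (base_gen ?W P \<delta>))
    + (\<Sum>j'<ncomps \<phi> l. fun_scale (of_nat (qmult \<phi> l j') * of_nat (cdeg ?W (l, j'))) (basis_vec (Psi_inf (i, j)) :: _ \<Rightarrow> 'k))"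
    by (simp only: half_wedge_def fun_vs.scale_right_distrib fun_vs.scale_sum_right fun_vs.scale_scale sum.distrib)
  also have "(\<Sum>j'<ncomps \<phi> l. \<Sum>P\<in>sing ?W. \<Sum>\<delta>\<in>component_part ?W P (i, j).
        fun_scale (of_nat (qmult \<phi> l j') * of_nat (\<Sum>\<delta>'\<in>component_part ?W P (l, j'). mult ?W P \<delta> \<delta>'))
          (base_gen ?W P \<delta> :: _ \<Rightarrow> 'k))
     = (\<Sum>P\<in>sing ?W. \<Sum>j'<ncomps \<phi> l. \<Sum>\<delta>\<in>component_part ?W P (i, j).
        fun_scale (of_nat (qmult \<phi> l j') * of_nat (\<Sum>\<delta>'\<in>component_part ?W P (l, j'). mult ?W P \<delta> \<delta>'))
          (base_gen ?W P \<delta>))"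
    by (rule sum.swap)
  also have "\<dots> = (\<Sum>P\<in>sing ?W. \<Sum>\<delta>\<in>component_part ?W P (i, j). \<Sum>j'<ncomps \<phi> l.
        fun_scale (of_nat (qmult \<phi> l j') * of_nat (\<Sum>\<delta>'\<in>component_part ?W P (l, j'). mult ?W P \<delta> \<delta>'))
          (base_gen ?W P \<delta>))"
    by (intro sum.cong refl sum.swap)
  also have "\<dots> = (\<Sum>P\<in>sing ?W. \<Sum>\<delta>\<in>component_part ?W P (i, j).
        fun_scale (of_nat (intersection_number \<delta> (multiples (?g P)))) (base_gen ?W P \<delta>))"
    by (intro sum.cong refl) (simp only: fun_vs.scale_sum_left[symmetric] num)
  finally show ?thesis
    unfolding fun_vs.scale_sum_left[symmetric] deg fiber_term_def fst_conv .
qed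

text \<open>With the member \<open>G\<^sup>k\<close> as reference, all intersection numbers and the degree of the pencil are multiples
  of \<open>k\<close>.\<close>

lemma fiber_term_index_zero:
  assumes qft: "quasi_fiber_type \<phi>"
    and a: "(i, j) \<in> comp_index \<phi>"
    and \<rho>: "\<rho> i \<in> P1" "\<rho> i \<noteq> qpt \<phi> i" and G: "homogeneous e G" "member \<phi> (\<rho> i) = G ^ k"
    and k: "(of_nat k :: 'k::field) = 0"
  shows "(fiber_term \<phi> \<rho> (i, j) :: _ \<Rightarrow> 'k) = 0"
proof -
  let ?W = "wct_of \<phi>"
  have part: "component_part ?W P (i, j) = germ_branches (germ \<phi> P (i, j))" for P
    using component_branches[OF qft a] by (simp add: component_part_def)
  have num: "(of_nat (intersection_number \<delta> (multiples (local_eq P (member \<phi> (\<rho> i))))) :: 'k) = 0"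
    if \<delta>: "\<delta> \<in> component_part ?W P (i, j)" for P \<delta>
  proof -
    interpret l: comm_ring_hom "local_eq P" by (rule local_eq_hom)
    obtain h where h: "\<delta> = multiples h" "Factorial_Ring.irreducible h" "h dvd germ \<phi> P (i, j)"
      using \<delta> part by (auto simp: germ_branches_eq)
    have h0: "h \<noteq> 0" "\<not> h dvd 1" using h by (auto simp: Factorial_Ring.irreducible_def)
    have fc: "finite_colength h (local_eq P G ^ k)"
      using branch_member_finite_colength[OF qft a h(3) \<rho>] by (simp add: G(2) l.hom_power)
    have "local_eq P G ^ k \<noteq> 0"
    proof
      assume "local_eq P G ^ k = 0"
      then have "h dvd local_eq P G ^ k" by (simp only: dvd_0_right)
      then show False using finite_colength_imp_not_dvd[OF fc h0(2,1)] by simp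
    qed
    then have "k = 0 \<or> local_eq P G \<noteq> 0" by (auto simp: power_0_left)
    moreover have "k = 0 \<Longrightarrow> ?thesis" by (simp add: h(1) G(2) l.hom_power intersection_number_one)
    moreover have "local_eq P G \<noteq> 0 \<Longrightarrow> ?thesis"
      using intersection_number_power[OF fc h0(1)] k by (simp add: h(1) G(2) l.hom_power)
    ultimately show ?thesis by blast
  qed
  have "member \<phi> (\<rho> i) \<noteq> 0"
  proof
    assume 0: "member \<phi> (\<rho> i) = 0"
    from qF_coprime_member[OF qft a \<rho>] have "qF \<phi> i j dvd 1" unfolding 0 by simp
    then show False using qF_irreducible[OF qft a] by (simp add: Factorial_Ring.irreducible_def)
  qed
  moreover have "homogeneous (k * e) (member \<phi> (\<rho> i))" unfolding G(2) by (rule homogeneous_power[OF G(1)])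
  ultimately have "pdeg \<phi> = k * e" using homogeneous_unique homogeneous_member[OF pencil[OF qft]] by blast
  then have "(of_nat (pdeg \<phi>) :: 'k) = 0" using k by simp
  moreover have "(\<Sum>P\<in>sing ?W. \<Sum>\<delta>\<in>component_part ?W P (i, j).
      fun_scale (of_nat (intersection_number \<delta> (multiples (local_eq P (member \<phi> (\<rho> i)))))) (base_gen ?W P \<delta> :: _ \<Rightarrow> 'k)) = 0"
    by (intro sum.neutral ballI) (simp add: num)
  ultimately show ?thesis by (simp add: fiber_term_def)
qed

lemma comps_wct_of: "comps (wct_of \<phi>) = comp_index \<phi>"
  by (simp add: wct_of_def curve_wct_def)

lemma mult_wct_of_sym: "mult (wct_of \<phi>) P \<delta> \<delta>' = mult (wct_of \<phi>) P \<delta>' \<delta>"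
proof -
  have "{u + v | u v. u \<in> \<delta> \<and> v \<in> \<delta>'} = {u + v | u v. u \<in> \<delta>' \<and> v \<in> \<delta>}"
    by (auto simp: add.commute) (metis add.commute)+
  then show ?thesis by (simp add: wct_of_def curve_wct_def intersection_number_def)
qed

lemma associated_cochain_A1: "associated_cochain \<phi> \<alpha> \<in> A1 (wct_of \<phi>)"
  by (auto simp: A1_def comps_wct_of associated_cochain_apply)

text \<open>The cochains of all \<open>\<beta>\<close> with \<open>\<Sum>\<beta> = 0\<close> are cocycles; they form a space of dimension \<open>r - 1\<close>.\<close>

lemma resonance_sum_zero:
  fixes \<alpha> :: "nat \<Rightarrow> 'k::field"
  assumes qft: "quasi_fiber_type \<phi>" and m: "\<And>i. i < nparts \<phi> \<Longrightarrow> (of_nat (qorder \<phi> i) :: 'k) = 0"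
    and \<alpha>: "(\<Sum>i<nparts \<phi>. \<alpha> i) = 0"
  shows "associated_cochain \<phi> \<alpha> \<in> resonance (nparts \<phi> - 2) (wct_of \<phi>)"
proof -
  have dc: "decomposed_curve \<phi>" using qft unfolding quasi_fiber_type_def by (rule conjunct1)
  \<comment> \<open>any member other than \<open>G\<^sub>i\<close> serves as reference for the branches of the part \<open>i\<close>\<close>
  define \<rho> :: "nat \<Rightarrow> pt1" where "\<rho> = (\<lambda>i. if qpt \<phi> i = (1, 0) then (0, 1) else (1, 0))"
  have \<rho>: "\<rho> i \<in> P1" "\<rho> i \<noteq> qpt \<phi> i" for i by (auto simp: \<rho>_def P1_def)
  \<comment> \<open>the vectors \<open>e\<^sub>k - e\<^sub>0\<close> for \<open>k \<ge> 1\<close>\<close>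
  define b :: "nat \<Rightarrow> nat \<Rightarrow> 'k" where "b = (\<lambda>k i. (if i = k then 1 else 0) - (if i = 0 then 1 else 0))"
  have "card {1..<nparts \<phi>} \<le> h1 (wct_of \<phi>) (associated_cochain \<phi> \<alpha>) + 1"
  proof (rule h1_lower_bound[OF comps_wct_of _ _ dc])
    fix k assume k: "k \<in> {1..<nparts \<phi>}"
    have "(\<Sum>i<nparts \<phi>. b k i) = 0" using k by (simp add: b_def sum_subtractf)
    then show "wedge (wct_of \<phi>) (associated_cochain \<phi> (b k)) (associated_cochain \<phi> \<alpha>)
       \<in> fun_vs.span (A2_relations (wct_of \<phi>))"
      using \<alpha> by (intro wedge_associated_cochains_in_relations[where \<phi> = \<phi> and E = "fiber_term \<phi> \<rho>"]
          comps_wct_of mult_wct_of_sym fiber_term_eq[OF qft m _ _ _ \<rho>]) simp_all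
  next
    fix c :: "nat \<Rightarrow> 'k" and k
    assume c: "\<And>i. i < nparts \<phi> \<Longrightarrow> (\<Sum>k\<in>{1..<nparts \<phi>}. c k * b k i) = 0" and k: "k \<in> {1..<nparts \<phi>}"
    have "(\<Sum>l\<in>{1..<nparts \<phi>}. c l * b l k) = (\<Sum>l\<in>{1..<nparts \<phi>}. if l = k then c l else 0)"
      using k by (intro sum.cong refl) (auto simp: b_def)
    then show "c k = 0" using c[of k] k by simp
  qed simp
  then show ?thesis using associated_cochain_A1 by (auto simp: resonance_def)
qed

text \<open>All the elements \<open>E(a)\<close> vanish, so every associated cochain is a cocycle.\<close>

lemma resonance_index:
  fixes \<alpha> :: "nat \<Rightarrow> 'k::field"
  assumes qft: "quasi_fiber_type \<phi>" and m: "\<And>i. i < nparts \<phi> \<Longrightarrow> (of_nat (qorder \<phi> i) :: 'k) = 0"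
    and k: "has_index \<phi> k" "(of_nat k :: 'k) = 0"
  shows "associated_cochain \<phi> \<alpha> \<in> resonance (nparts \<phi> - 1) (wct_of \<phi>)"
proof -
  have dc: "decomposed_curve \<phi>" using qft unfolding quasi_fiber_type_def by (rule conjunct1)
  obtain \<sigma> G e where \<sigma>: "\<sigma> \<in> P1" "\<sigma> \<notin> qpt \<phi> ` {..<nparts \<phi>}"
    and G: "homogeneous e G" "member \<phi> \<sigma> = G ^ k"
    using k(1) unfolding has_index_def by blast
  define \<rho> where "\<rho> = (\<lambda>i :: nat. \<sigma>)"
  have \<rho>: "\<rho> i \<in> P1" for i using \<sigma> by (simp add: \<rho>_def)
  have \<rho>': "\<rho> i \<noteq> qpt \<phi> i" if "(i, j) \<in> comp_index \<phi>" for i j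
    using \<sigma> that by (auto simp: \<rho>_def comp_index_def)
  define b :: "nat \<Rightarrow> nat \<Rightarrow> 'k" where "b = (\<lambda>k i. if i = k then 1 else 0)"
  have "card {..<nparts \<phi>} \<le> h1 (wct_of \<phi>) (associated_cochain \<phi> \<alpha>) + 1"
  proof (rule h1_lower_bound[OF comps_wct_of _ _ dc])
    fix l assume "l \<in> {..<nparts \<phi>}"
    show "wedge (wct_of \<phi>) (associated_cochain \<phi> (b l)) (associated_cochain \<phi> \<alpha>)
       \<in> fun_vs.span (A2_relations (wct_of \<phi>))"
    proof (rule wedge_associated_cochains_in_relations[where \<phi> = \<phi> and E = "fiber_term \<phi> \<rho>"])
      fix i j assume a: "(i, j) \<in> comp_index \<phi>"
      have "member \<phi> (\<rho> i) = G ^ k" by (simp add: \<rho>_def G)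
      from fiber_term_index_zero[where \<rho> = \<rho>, OF qft a \<rho> \<rho>'[OF a] G(1) this k(2)]
      show "fun_scale (b l i * (\<Sum>l<nparts \<phi>. \<alpha> l) - \<alpha> i * (\<Sum>i<nparts \<phi>. b l i)) (fiber_term \<phi> \<rho> (i, j)) = 0"
        by simp
      fix l' assume "l' < nparts \<phi>" "l' \<noteq> i"
      then show "(\<Sum>j'<ncomps \<phi> l'. fun_scale (of_nat (qmult \<phi> l' j')) (half_wedge (wct_of \<phi>) (i, j) (l', j')))
          = (fiber_term \<phi> \<rho> (i, j) :: _ \<Rightarrow> 'k)"
        by (intro fiber_term_eq[OF qft m a] \<rho> \<rho>'[OF a])
    qed (rule comps_wct_of mult_wct_of_sym)+
  next
    fix c :: "nat \<Rightarrow> 'k" and l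
    assume c: "\<And>i. i < nparts \<phi> \<Longrightarrow> (\<Sum>k\<in>{..<nparts \<phi>}. c k * b k i) = 0" and l: "l \<in> {..<nparts \<phi>}"
    have "(\<Sum>k\<in>{..<nparts \<phi>}. c k * b k l) = (\<Sum>k\<in>{..<nparts \<phi>}. if k = l then c k else 0)"
      by (intro sum.cong refl) (auto simp: b_def)
    then show "c l = 0" using c[of l] l by simp
  qed simp
  then show ?thesis using associated_cochain_A1 by (auto simp: resonance_def)
qed

theorem theorem30:
  fixes \<phi> :: quasi_fiber_data and \<alpha> :: "nat \<Rightarrow> 'p::prime_card mod_ring"
  assumes "quasi_fiber_type \<phi>"
    and "\<forall>i<nparts \<phi>. of_nat (qorder \<phi> i) = (0 :: 'p mod_ring)"
  shows "((\<Sum>i<nparts \<phi>. \<alpha> i) = 0 \<longrightarrow>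
            associated_cochain \<phi> \<alpha> \<in> resonance (nparts \<phi> - 2) (wct_of \<phi>))
       \<and> (\<forall>k. has_index \<phi> k \<and> of_nat k = (0 :: 'p mod_ring) \<longrightarrow>
            (associated_cochains \<phi> :: (nat \<times> nat \<Rightarrow> 'p mod_ring) set)
              \<subseteq> resonance (nparts \<phi> - 1) (wct_of \<phi>))"
proof (intro conjI allI impI)
  assume "(\<Sum>i<nparts \<phi>. \<alpha> i) = 0"
  then show "associated_cochain \<phi> \<alpha> \<in> resonance (nparts \<phi> - 2) (wct_of \<phi>)"
    using resonance_sum_zero[OF assms(1)] assms(2) by blast
next
  fix k assume k: "has_index \<phi> k \<and> of_nat k = (0 :: 'p mod_ring)"
  have "associated_cochain \<phi> \<beta> \<in> resonance (nparts \<phi> - 1) (wct_of \<phi>)" for \<beta> :: "nat \<Rightarrow> 'p mod_ring"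
    by (rule resonance_index[OF assms(1)]) (use assms(2) k in auto)
  then show "(associated_cochains \<phi> :: (nat \<times> nat \<Rightarrow> 'p mod_ring) set)
      \<subseteq> resonance (nparts \<phi> - 1) (wct_of \<phi>)"
    by (auto simp: associated_cochains_def)
qed

end
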